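(* Let $M\ge1$ be an integer and let $B=B(0,1)\subset\mathbb R^3$. There exist two random potentials $q_A,q_B$, each taking finitely many values among nonnegative radial potentials that are real analytic in a neighborhood of $\overline{B}$, such that, for every integer $1\le r\le M$ and all real boundary values $f_j,g_j\in H^{1/2}(\partial B;\mathbb R)$, $1\le j\le r$, \[ \mathbb E\prod_{j=1}^r\langle\Lambda_{q_A}f_j,g_j\rangle=\mathbb E\prod_{j=1}^r\langle\Lambda_{q_B}f_j,g_j\rangle, \] but $\mathbb E q_A\neq\mathbb E q_B$. Moreover, the same random potentials satisfy the corresponding identities for complex boundary values $f_j,g_j\in H^{1/2}(\partial B;\mathbb C)$ with the sesquilinear pairing, including the identities in which any prescribed subset of the factors $\langle\Lambda_{q}f_j,g_j\rangle$ is replaced (on both sides) by complex conjugates. All expectations in these identities are finite.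
   Context: For a bounded domain $\Omega\subset\mathbb R^n$ with smooth boundary and a nonnegative real potential $q\in C^\infty(\overline\Omega)$, the Schrödinger Dirichlet-to-Neumann map is $\Lambda_q f=\partial_\nu u_f|_{\partial\Omega}$, where $u_f$ is the unique solution of $(-\Delta+q)u_f=0$ in $\Omega$, $u_f|_{\partial\Omega}=f$, with $\nu$ the outer unit normal; it is a bounded operator $H^{1/2}(\partial\Omega)\to H^{-1/2}(\partial\Omega)$, and $\langle\cdot,\cdot\rangle$ is the $H^{-1/2}$–$H^{1/2}$ duality (bilinear for real, sesquilinear for complex scalars). $\mathbb E q$ denotes the pointwise mean of the random potential. *)

theory Defs
  imports "HOL-Probability.Probability"
begin

section \<open>Real analytic and smooth functions\<close>

definition real_analytic_on :: "(real ^ 'n \<Rightarrow> real) \<Rightarrow> (real ^ 'n) set \<Rightarrow> bool" where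
  "real_analytic_on f U \<longleftrightarrow>
     (\<forall>x\<in>U. \<exists>(a :: nat ^ 'n \<Rightarrow> real) r. r > 0 \<and>
        (\<forall>y\<in>ball x r. ((\<lambda>\<alpha>. a \<alpha> * (\<Prod>i\<in>UNIV. (y $ i - x $ i) ^ (\<alpha> $ i))) has_sum f y) UNIV))"

definition gradient :: "(real ^ 'n \<Rightarrow> 'a::real_normed_vector) \<Rightarrow> real ^ 'n \<Rightarrow> 'a ^ 'n" where
  "gradient \<phi> x = (\<chi> i. frechet_derivative \<phi> (at x) (axis i 1))"

fun C_diff :: "nat \<Rightarrow> (real ^ 'n \<Rightarrow> 'a::real_normed_vector) \<Rightarrow> bool" where
  "C_diff 0 \<phi> \<longleftrightarrow> continuous_on UNIV \<phi>"
| "C_diff (Suc k) \<phi> \<longleftrightarrow>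
     (\<forall>x. \<phi> differentiable (at x)) \<and> (\<forall>i. C_diff k (\<lambda>x. gradient \<phi> x $ i))"

definition smooth :: "(real ^ 'n \<Rightarrow> 'a::real_normed_vector) \<Rightarrow> bool" where
  "smooth \<phi> \<longleftrightarrow> (\<forall>k. C_diff k \<phi>)"

definition test_function :: "(real ^ 'n) set \<Rightarrow> (real ^ 'n \<Rightarrow> real) \<Rightarrow> bool" where
  "test_function \<Omega> \<phi> \<longleftrightarrow>
     smooth \<phi> \<and> (\<exists>K. compact K \<and> K \<subseteq> \<Omega> \<and> (\<forall>x. x \<notin> K \<longrightarrow> \<phi> x = 0))"


section \<open>The Sobolev space of order one\<close>

text \<open>
  The scalar type \<open>'a\<close> below is meant to be \<open>real\<close> or \<open>complex\<close>. Elements of $L^2$ and of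
  Sobolev spaces are represented by Borel functions; their values outside the set carrying the
  measure are irrelevant.
\<close>

definition L2 :: "'b measure \<Rightarrow> ('b \<Rightarrow> 'v::euclidean_space) \<Rightarrow> bool" where
  "L2 M f \<longleftrightarrow> f \<in> borel_measurable M \<and> integrable M (\<lambda>x. (norm (f x))\<^sup>2)"

abbreviation vol :: "(real ^ 'n) set \<Rightarrow> (real ^ 'n) measure" where
  "vol \<Omega> \<equiv> restrict_space lborel \<Omega>"

definition is_weak_gradient ::
    "(real ^ 'n) set \<Rightarrow> (real ^ 'n \<Rightarrow> 'a::euclidean_space) \<Rightarrow> (real ^ 'n \<Rightarrow> 'a ^ 'n) \<Rightarrow> bool" where
  "is_weak_gradient \<Omega> u G \<longleftrightarrow> L2 (vol \<Omega>) u \<and> L2 (vol \<Omega>) G \<and>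
     (\<forall>\<phi> i. test_function \<Omega> \<phi> \<longrightarrow>
        (\<integral>x. gradient \<phi> x $ i *\<^sub>R u x \<partial>vol \<Omega>) = - (\<integral>x. \<phi> x *\<^sub>R (G x $ i) \<partial>vol \<Omega>))"

definition H1 :: "(real ^ 'n) set \<Rightarrow> (real ^ 'n \<Rightarrow> 'a::euclidean_space) set" where
  "H1 \<Omega> = {u. \<exists>G. is_weak_gradient \<Omega> u G}"

text \<open>For open \<open>\<Omega>\<close> the weak gradient is unique up to null sets, and it is only used under integrals.\<close>

definition weak_gradient ::
    "(real ^ 'n) set \<Rightarrow> (real ^ 'n \<Rightarrow> 'a::euclidean_space) \<Rightarrow> real ^ 'n \<Rightarrow> 'a ^ 'n" where
  "weak_gradient \<Omega> u = (SOME G. is_weak_gradient \<Omega> u G)"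

text \<open>\<open>\<Delta>u = h\<close> in the sense of distributions, for \<open>u \<in> H1 \<Omega>\<close> and \<open>h\<close> square integrable.\<close>

definition is_weak_laplacian ::
    "(real ^ 'n) set \<Rightarrow> (real ^ 'n \<Rightarrow> 'a::euclidean_space) \<Rightarrow> (real ^ 'n \<Rightarrow> 'a) \<Rightarrow> bool" where
  "is_weak_laplacian \<Omega> u h \<longleftrightarrow> u \<in> H1 \<Omega> \<and> L2 (vol \<Omega>) h \<and>
     (\<forall>\<phi>. test_function \<Omega> \<phi> \<longrightarrow>
        (\<integral>x. (\<Sum>i\<in>UNIV. gradient \<phi> x $ i *\<^sub>R (weak_gradient \<Omega> u x $ i)) \<partial>vol \<Omega>)
          = - (\<integral>x. \<phi> x *\<^sub>R h x \<partial>vol \<Omega>))"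


section \<open>Traces on the unit sphere\<close>

abbreviation B :: "(real ^ 3) set" where
  "B \<equiv> ball 0 1"

text \<open>
  Surface measure of the unit sphere, as the cone measure: the area of \<open>A\<close> is three times the
  volume of the set of points of the unit ball whose radial projection lies in \<open>A\<close>.
\<close>

definition sphere_measure :: "(real ^ 3) measure" where
  "sphere_measure = scale_measure 3 (distr (vol B) borel (\<lambda>x. x /\<^sub>R norm x))"

text \<open>
  The trace operator is the continuous extension of the restriction map from functions that are
  smooth up to the boundary.
\<close>

definition has_trace :: "(real ^ 3 \<Rightarrow> 'a::euclidean_space) \<Rightarrow> (real ^ 3 \<Rightarrow> 'a) \<Rightarrow> bool" where
  "has_trace u f \<longleftrightarrow> u \<in> H1 B \<and> L2 sphere_measure f \<and>
     (\<exists>\<phi> :: nat \<Rightarrow> real ^ 3 \<Rightarrow> 'a. (\<forall>k. smooth (\<phi> k)) \<and>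
        (\<lambda>k. \<integral>x. (norm (\<phi> k x - u x))\<^sup>2 + (norm (gradient (\<phi> k) x - weak_gradient B u x))\<^sup>2 \<partial>vol B)
          \<longlonglongrightarrow> 0 \<and>
        (\<lambda>k. \<integral>x. (norm (\<phi> k x - f x))\<^sup>2 \<partial>sphere_measure) \<longlonglongrightarrow> 0)"

text \<open>The space $H^{1/2}(\partial B)$ is the range of the trace operator on $H^1(B)$.\<close>

definition H_half :: "(real ^ 3 \<Rightarrow> 'a::euclidean_space) set" where
  "H_half = {f. \<exists>u. has_trace u f}"


section \<open>The Dirichlet-to-Neumann map\<close>

text \<open>
  Elements of $H^{-1/2}(\partial B)$ are represented as linear functionals on \<open>H_half\<close>; a function
  \<open>\<psi>\<close> on the sphere corresponds to \<open>\<lambda>g. \<integral>x. \<psi> x * g x \<partial>sphere_measure\<close>, without conjugation.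
  The normal derivative of \<open>u\<close> with square integrable Laplacian is given by Green's formula
  $\int_{\partial B} (\partial_\nu u)\, v = \int_B \nabla u\cdot\nabla v + (\Delta u)\, v$,
  whose right-hand side depends only on the trace \<open>g\<close> of \<open>v\<close>.
\<close>

definition normal_derivative ::
    "(real ^ 3 \<Rightarrow> 'a::{real_normed_field,euclidean_space}) \<Rightarrow> (real ^ 3 \<Rightarrow> 'a) \<Rightarrow> 'a" where
  "normal_derivative u = (\<lambda>g. THE c. \<exists>h v. is_weak_laplacian B u h \<and> has_trace v g \<and>
     c = (\<integral>x. (\<Sum>i\<in>UNIV. weak_gradient B u x $ i * weak_gradient B v x $ i) + h x * v x \<partial>vol B))"

definition dirichlet_solution ::
    "(real ^ 3 \<Rightarrow> real) \<Rightarrow> (real ^ 3 \<Rightarrow> 'a::euclidean_space) \<Rightarrow> (real ^ 3 \<Rightarrow> 'a) \<Rightarrow> bool" where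
  "dirichlet_solution q f u \<longleftrightarrow> is_weak_laplacian B u (\<lambda>x. q x *\<^sub>R u x) \<and> has_trace u f"

text \<open>The solution is unique up to null sets; the choice of a representative is immaterial.\<close>

definition DN_map ::
    "(real ^ 3 \<Rightarrow> real) \<Rightarrow> (real ^ 3 \<Rightarrow> 'a::{real_normed_field,euclidean_space})
      \<Rightarrow> (real ^ 3 \<Rightarrow> 'a) \<Rightarrow> 'a" where
  "DN_map q f = normal_derivative (SOME u. dirichlet_solution q f u)"

definition pairing :: "((real ^ 3 \<Rightarrow> real) \<Rightarrow> real) \<Rightarrow> (real ^ 3 \<Rightarrow> real) \<Rightarrow> real" where
  "pairing T g = T g"

text \<open>Extends $\int_{\partial B} \psi\,\overline{g}$: linear in the first, antilinear in the second argument.\<close>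

definition sesq_pairing ::
    "((real ^ 3 \<Rightarrow> complex) \<Rightarrow> complex) \<Rightarrow> (real ^ 3 \<Rightarrow> complex) \<Rightarrow> complex" where
  "sesq_pairing T g = T (\<lambda>x. cnj (g x))"


section \<open>Random potentials\<close>

definition admissible_potential :: "(real ^ 3 \<Rightarrow> real) \<Rightarrow> bool" where
  "admissible_potential q \<longleftrightarrow>
     (\<forall>x\<in>cball 0 1. 0 \<le> q x) \<and>
     (\<forall>x\<in>cball 0 1. \<forall>y\<in>cball 0 1. norm x = norm y \<longrightarrow> q x = q y) \<and>
     (\<exists>U. open U \<and> cball 0 1 \<subseteq> U \<and> real_analytic_on q U)"

text \<open>A random potential with finitely many values is given by its law.\<close>

definition random_potential :: "(real ^ 3 \<Rightarrow> real) pmf \<Rightarrow> bool" where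
  "random_potential P \<longleftrightarrow> finite (set_pmf P) \<and> (\<forall>q\<in>set_pmf P. admissible_potential q)"

definition mean_potential :: "(real ^ 3 \<Rightarrow> real) pmf \<Rightarrow> real ^ 3 \<Rightarrow> real" where
  "mean_potential P x = measure_pmf.expectation P (\<lambda>q. q x)"

definition real_DN_product ::
    "nat \<Rightarrow> (nat \<Rightarrow> real ^ 3 \<Rightarrow> real) \<Rightarrow> (nat \<Rightarrow> real ^ 3 \<Rightarrow> real) \<Rightarrow> (real ^ 3 \<Rightarrow> real) \<Rightarrow> real" where
  "real_DN_product r f g q = (\<Prod>j=1..r. pairing (DN_map q (f j)) (g j))"

text \<open>The factors with index in \<open>S\<close> are conjugated.\<close>

definition complex_DN_product ::
    "nat \<Rightarrow> nat set \<Rightarrow> (nat \<Rightarrow> real ^ 3 \<Rightarrow> complex) \<Rightarrow> (nat \<Rightarrow> real ^ 3 \<Rightarrow> complex)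
      \<Rightarrow> (real ^ 3 \<Rightarrow> real) \<Rightarrow> complex" where
  "complex_DN_product r S f g q =
     (\<Prod>j=1..r. if j \<in> S then cnj (sesq_pairing (DN_map q (f j)) (g j))
                else sesq_pairing (DN_map q (f j)) (g j))"

end

theory Submission
  imports Defs "HOL-Complex_Analysis.Cauchy_Integral_Formula"
begin

text \<open>
  For \<open>0 < b < a = N + 1/2\<close> put \<open>\<beta> = (a - b) / (a + b)\<close>. The radial potential
  \<open>q = 8 b\<^sup>2 \<beta> r\<^bsup>2b-2\<^esup> / (1 - \<beta> r\<^bsup>2b\<^esup>)\<^sup>2\<close> arises from the zero potential by a Darboux
  transformation: if \<open>u\<^sub>0\<close> is harmonic and \<open>v(x) = \<integral>\<^sub>0\<^sup>1 t\<^sup>N u\<^sub>0(t x) dt\<close>, which is harmonic too,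
  then \<open>u\<^sub>0 + m v\<close> solves the Schroedinger equation for a radial function \<open>m\<close> that vanishes on the
  sphere, and \<open>\<partial>\<^sub>\<nu> m = a\<^sup>2 - b\<^sup>2\<close> there. Hence the Dirichlet data do not depend on \<open>b\<close>, and the
  Neumann data are affine in \<open>b\<^sup>2\<close>, whereas \<open>q\<close> depends on \<open>b\<close> in a nonlinear way.

  With \<open>b = d + 1\<close>, a product of at most \<open>M\<close> matrix elements of \<open>\<Lambda>\<^sub>q\<close> is a polynomial in \<open>d\<close> of degree
  at most \<open>2 M\<close>, so its alternating sum over the subsets of a set with \<open>2 M + 1\<close> elements, with
  \<open>d\<close> the cardinality of the subset, vanishes. Drawing the subset uniformly among those of even or
  odd cardinality thus yields the same moments. The mean potentials differ at the origin, where
  only \<open>d = 0\<close> contributes.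
\<close>

section \<open>Closure of the C-infinity class under sums, products, dilations and
  reciprocals\<close>

subsection \<open>Smooth functions\<close>

text \<open>In the variable s = log r, the function r^(1/2) u solves a one-dimensional Schroedinger
  equation with potential r^2 q, in which degree l enters only through the energy -(l + 1/2)^2; this
  is the setting of the classical Darboux transformation. Its superpotential W = m + a satisfies r
  W' = W^2 - b^2 and r^2 q = 2 r W'. The constant \<beta> is the one with W = a on the sphere for
  every b, so that a single v, which involves only N, serves all potentials; on harmonics of degree
  l the map is l + (a^2 - b^2) / (l + N + 1). A half-integral a makes the power of t in v integral,
  an integral b makes q analytic at the origin, and b < a makes q nonnegative. Boundary data lie
  only in H^(1/2), so all identities are weak ones. The crux is that functions of zero trace may
  replace test functions, which rests on a trace inequality in thin shells at the sphere. A trace of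
  v is never constructed: v enters with a factor vanishing on the sphere, or inside the volume
  integral of a divergence.\<close>

lemma gradient_nth:
  assumes "(\<phi> has_derivative D) (at x)"
  shows "gradient \<phi> x $ i = D (axis i 1)"
  using frechet_derivative_at[OF assms] by (simp add: gradient_def)

lemma gradient_cong_open:
  assumes "open U" "x \<in> U" "\<And>y. y \<in> U \<Longrightarrow> f y = g y"
  shows "gradient f x = gradient g x"
proof -
  have "(f has_derivative D) (at x) \<longleftrightarrow> (g has_derivative D) (at x)" for D
    using has_derivative_transform_within_open[of f D x UNIV U g]
      has_derivative_transform_within_open[of g D x UNIV U f] assms by auto
  then show ?thesis by (simp add: gradient_def frechet_derivative_def)
qed

text \<open>\<open>C_diff (Suc k)\<close> asks for differentiability and for regularity of the
  partial derivatives, not for continuity of the function itself, so monotonicity in k rests on the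
  continuity of differentiable functions.\<close>

lemma C_diff_lower:
  fixes \<phi> :: "real ^ 'n \<Rightarrow> 'a::real_normed_vector"
  shows "C_diff (Suc k) \<phi> \<Longrightarrow> C_diff k \<phi>"
proof (induction k arbitrary: \<phi>)
  case 0
  then show ?case
    by (auto intro!: differentiable_imp_continuous_on simp: differentiable_on_def)
next
  case (Suc k)
  then have "\<And>x. \<phi> differentiable (at x)" "\<And>i. C_diff (Suc k) (\<lambda>x. gradient \<phi> x $ i)"
    by simp_all
  then show ?case using Suc.IH by simp
qed

text \<open>Partial derivatives can be read off from any explicit derivative, which keeps the choice
  inside \<open>frechet_derivative\<close> out of the inductions below.\<close>

lemma C_diff_SucI:
  assumes "\<And>x. (\<phi> has_derivative D x) (at x)"
    and "\<And>i. C_diff k (\<lambda>x. D x (axis i 1))"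
  shows "C_diff (Suc k) \<phi>"
proof -
  have "gradient \<phi> x $ i = D x (axis i 1)" for x i
    by (rule gradient_nth[OF assms(1)])
  with assms show ?thesis by (auto simp: differentiable_def)
qed

lemma differentiable_gradient:
  assumes "\<phi> differentiable (at x)"
  shows "(\<phi> has_derivative (\<lambda>h. \<Sum>i\<in>UNIV. h $ i *\<^sub>R (gradient \<phi> x $ i))) (at x)"
proof -
  let ?D = "frechet_derivative \<phi> (at x)"
  have D: "(\<phi> has_derivative ?D) (at x)" using assms by (rule frechet_derivative_works[THEN iffD1])
  then have lin: "linear ?D" by (rule has_derivative_linear)
  have "?D h = (\<Sum>i\<in>UNIV. h $ i *\<^sub>R (gradient \<phi> x $ i))" for h
  proof -
    have "h = (\<Sum>i\<in>UNIV. h $ i *\<^sub>R axis i 1)"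
      by (simp add: basis_expansion flip: scalar_mult_eq_scaleR)
    then have "?D h = ?D (\<Sum>i\<in>UNIV. h $ i *\<^sub>R axis i 1)" by simp
    also have "\<dots> = (\<Sum>i\<in>UNIV. h $ i *\<^sub>R ?D (axis i 1))"
      by (simp add: linear_sum[OF lin] linear_scale[OF lin])
    finally show ?thesis by (simp add: gradient_def)
  qed
  then have "?D = (\<lambda>h. \<Sum>i\<in>UNIV. h $ i *\<^sub>R (gradient \<phi> x $ i))" by (rule ext)
  with D show ?thesis by metis
qed

lemma C_diff_continuous: "C_diff k \<phi> \<Longrightarrow> continuous_on UNIV \<phi>"
  by (induction k) (use C_diff_lower in \<open>blast | simp\<close>)+

lemma smooth_continuous: "smooth \<phi> \<Longrightarrow> continuous_on S \<phi>"
  using C_diff_continuous continuous_on_subset unfolding smooth_def by blast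

lemma smooth_differentiable: "smooth \<phi> \<Longrightarrow> \<phi> differentiable (at x)"
  unfolding smooth_def using C_diff.simps(2) by blast

lemma smooth_partial: "smooth \<phi> \<Longrightarrow> smooth (\<lambda>x. gradient \<phi> x $ i)"
  unfolding smooth_def using C_diff.simps(2) by blast

lemmas smooth_has_derivative = differentiable_gradient[OF smooth_differentiable]

lemma smooth_gradient_continuous:
  assumes "smooth \<phi>" shows "continuous_on S (gradient \<phi>)"
  using continuous_on_vec_lambda[OF smooth_continuous[OF smooth_partial[OF assms]], of S "\<lambda>i. i"]
  by (simp add: vec_lambda_eta)

lemma C_diff_const: "C_diff k (\<lambda>x::real^'n. c)"
proof (induction k arbitrary: c)
  case (Suc k)
  show ?case by (rule C_diff_SucI[where D="\<lambda>x h. 0"]) (use Suc in auto)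
qed auto

lemma C_diff_nth: "C_diff k (\<lambda>x::real^'n. x $ j)"
proof (cases k)
  case (Suc l)
  show ?thesis unfolding Suc
    by (rule C_diff_SucI[where D="\<lambda>x h. h $ j"])
      (auto intro!: C_diff_const bounded_linear_imp_has_derivative bounded_linear_vec_nth)
qed (auto intro: continuous_intros)

lemma C_diff_bounded_linear:
  assumes T: "bounded_linear T"
  shows "C_diff k \<phi> \<Longrightarrow> C_diff k (\<lambda>x. T (\<phi> x))"
proof (induction k arbitrary: \<phi>)
  case 0
  then show ?case using bounded_linear.continuous_on[OF T] by auto
next
  case (Suc k)
  then have d: "\<And>x. (\<phi> has_derivative frechet_derivative \<phi> (at x)) (at x)"
    by (simp add: frechet_derivative_works[THEN iffD1])
  show ?case
    by (rule C_diff_SucI[where D="\<lambda>x h. T (frechet_derivative \<phi> (at x) h)"])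
      (use Suc in \<open>auto simp: gradient_def intro!: bounded_linear.has_derivative[OF T] d\<close>)
qed

lemma C_diff_add: "C_diff k \<phi> \<Longrightarrow> C_diff k \<psi> \<Longrightarrow> C_diff k (\<lambda>x. \<phi> x + \<psi> x)"
proof (induction k arbitrary: \<phi> \<psi>)
  case 0
  then show ?case by (auto intro: continuous_on_add)
next
  case (Suc k)
  then have d: "\<And>x. (\<phi> has_derivative frechet_derivative \<phi> (at x)) (at x)"
     "\<And>x. (\<psi> has_derivative frechet_derivative \<psi> (at x)) (at x)"
    by (simp_all add: frechet_derivative_works[THEN iffD1])
  show ?case
    by (rule C_diff_SucI[where D="\<lambda>x h. frechet_derivative \<phi> (at x) h + frechet_derivative \<psi> (at x) h"])
      (use Suc in \<open>auto simp: gradient_def intro!: has_derivative_add d\<close>)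
qed

text \<open>The derivative of a product is a sum of two products in which only one factor is
  differentiated. The other one is brought down to level k by \<open>C_diff_lower\<close>, and the
  induction ranges over both factors.\<close>

lemma C_diff_bilinear:
  assumes P: "bounded_bilinear P"
  shows "C_diff k \<phi> \<Longrightarrow> C_diff k \<psi> \<Longrightarrow> C_diff k (\<lambda>x. P (\<phi> x) (\<psi> x))"
proof (induction k arbitrary: \<phi> \<psi>)
  case 0
  then show ?case by (auto intro: bounded_bilinear.continuous_on[OF P])
next
  case (Suc k)
  then have d: "\<And>x. (\<phi> has_derivative frechet_derivative \<phi> (at x)) (at x)"
     "\<And>x. (\<psi> has_derivative frechet_derivative \<psi> (at x)) (at x)"
    by (simp_all add: frechet_derivative_works[THEN iffD1])
  show ?case
    by (rule C_diff_SucI[OF bounded_bilinear.FDERIV[OF P d], rule_format])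
       (rule C_diff_add; rule Suc.IH; use Suc.prems C_diff_lower[OF Suc.prems(1)] C_diff_lower[OF Suc.prems(2)] in \<open>auto simp: gradient_def\<close>)
qed

lemma smooth_const: "smooth (\<lambda>x::real^'n. c)"
  and smooth_nth: "smooth (\<lambda>x::real^'n. x $ j)"
  by (auto simp: smooth_def C_diff_const C_diff_nth)

lemma smooth_add: "smooth \<phi> \<Longrightarrow> smooth \<psi> \<Longrightarrow> smooth (\<lambda>x. \<phi> x + \<psi> x)"
  by (auto simp: smooth_def C_diff_add)

lemma smooth_bounded_linear: "bounded_linear T \<Longrightarrow> smooth \<phi> \<Longrightarrow> smooth (\<lambda>x. T (\<phi> x))"
  by (auto simp: smooth_def C_diff_bounded_linear)

lemma smooth_bilinear: "bounded_bilinear P \<Longrightarrow> smooth \<phi> \<Longrightarrow> smooth \<psi> \<Longrightarrow> smooth (\<lambda>x. P (\<phi> x) (\<psi> x))"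
  by (auto simp: smooth_def C_diff_bilinear)

lemmas smooth_scaleR = smooth_bilinear[OF bounded_bilinear_scaleR]
  and smooth_mult = smooth_bilinear[OF bounded_bilinear_mult]
  and smooth_uminus = smooth_bounded_linear[OF bounded_linear_minus[OF bounded_linear_ident]]

lemma smooth_diff: "smooth \<phi> \<Longrightarrow> smooth \<psi> \<Longrightarrow> smooth (\<lambda>x. \<phi> x - \<psi> x)"
  using smooth_add[OF _ smooth_uminus] by simp

lemma smooth_sum: "(\<And>i. i \<in> I \<Longrightarrow> smooth (\<phi> i)) \<Longrightarrow> smooth (\<lambda>x. \<Sum>i\<in>I. \<phi> i x)"
  by (induction I rule: infinite_finite_induct) (auto intro: smooth_const smooth_add)

lemma smooth_power: "smooth \<phi> \<Longrightarrow> smooth (\<lambda>x. \<phi> x ^ n :: real)"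
  by (induction n) (auto intro: smooth_const smooth_mult)

lemma smooth_prod: "(\<And>i. i \<in> I \<Longrightarrow> smooth (\<phi> i)) \<Longrightarrow> smooth (\<lambda>x. \<Prod>i\<in>I. \<phi> i x :: real)"
  by (induction I rule: infinite_finite_induct) (auto intro: smooth_const smooth_mult)

lemma smooth_power2_norm: "smooth (\<lambda>x::real^'n. (norm x)\<^sup>2)"
proof -
  have "(norm x)\<^sup>2 = (\<Sum>i\<in>UNIV. x $ i * x $ i)" for x :: "real^'n"
    by (simp add: power2_norm_eq_inner inner_vec_def)
  then show ?thesis by (auto intro!: smooth_sum smooth_mult smooth_nth)
qed

lemma gradient_add:
  assumes "smooth \<phi>" "smooth \<psi>"
  shows "gradient (\<lambda>x. \<phi> x + \<psi> x) x $ i = gradient \<phi> x $ i + gradient \<psi> x $ i"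
  using gradient_nth[OF has_derivative_add[OF smooth_has_derivative[OF assms(1)] smooth_has_derivative[OF assms(2)]], where i=i]
    gradient_nth[OF smooth_has_derivative[OF assms(1)], where i=i] gradient_nth[OF smooth_has_derivative[OF assms(2)], where i=i]
  by simp

lemma gradient_bilinear:
  assumes P: "bounded_bilinear P" and "smooth \<phi>" "smooth \<psi>"
  shows "gradient (\<lambda>x::real^'n. P (\<phi> x) (\<psi> x)) x $ i = P (\<phi> x) (gradient \<psi> x $ i) + P (gradient \<phi> x $ i) (\<psi> x)"
proof -
  have d: "(\<phi> has_derivative frechet_derivative \<phi> (at x)) (at x)"
     "(\<psi> has_derivative frechet_derivative \<psi> (at x)) (at x)"
    using assms by (simp_all add: frechet_derivative_works[THEN iffD1] smooth_differentiable)
  show ?thesis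
    using gradient_nth[OF bounded_bilinear.FDERIV[OF P d]] by (simp add: gradient_def)
qed

lemmas gradient_scaleR = gradient_bilinear[OF bounded_bilinear_scaleR]
  and gradient_mult = gradient_bilinear[OF bounded_bilinear_mult]

lemma gradient_bounded_linear:
  assumes T: "bounded_linear T" and "smooth \<phi>"
  shows "gradient (\<lambda>x. T (\<phi> x)) x $ i = T (gradient \<phi> x $ i)"
  using gradient_nth[OF bounded_linear.has_derivative[OF T smooth_has_derivative[OF assms(2)]], where i=i]
    gradient_nth[OF smooth_has_derivative[OF assms(2)], where i=i] by simp

lemma gradient_const: "gradient (\<lambda>x::real^'n. c) x = 0"
  by (simp add: vec_eq_iff gradient_nth[where D="\<lambda>_. 0"])

lemma gradient_coordinate: "gradient (\<lambda>x::real^'n. x $ j) x $ i = (if i = j then 1 else 0)"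
proof -
  have "((\<lambda>x::real^'n. x $ j) has_derivative (\<lambda>h. h $ j)) (at x)"
    by (auto intro: bounded_linear_imp_has_derivative bounded_linear_vec_nth)
  from gradient_nth[OF this, where i=i] show ?thesis by (auto simp: axis_def)
qed

lemma C_diff_dilate:
  fixes \<phi> :: "real ^ 'b \<Rightarrow> 'a::real_normed_vector"
  shows "C_diff k \<phi> \<Longrightarrow> C_diff k (\<lambda>x. \<phi> (c *\<^sub>R x))"
proof (induction k arbitrary: \<phi>)
  case 0
  then have "continuous_on UNIV \<phi>" by simp
  moreover have "continuous_on UNIV (\<lambda>x::real^'b. c *\<^sub>R x)" by (intro continuous_intros)
  ultimately have "continuous_on UNIV (\<lambda>x. \<phi> (c *\<^sub>R x))"
    by (rule continuous_on_compose2) simp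
  then show ?case by simp
next
  case (Suc k)
  have "((\<lambda>x. c *\<^sub>R x) has_derivative (\<lambda>h. c *\<^sub>R h)) (at x)" for x :: "real^'b"
    by (intro bounded_linear_imp_has_derivative bounded_linear_scaleR_right)
  moreover have "(\<phi> has_derivative frechet_derivative \<phi> (at x)) (at x)" for x
    using Suc.prems by (simp add: frechet_derivative_works[THEN iffD1])
  ultimately have d: "((\<lambda>x. \<phi> (c *\<^sub>R x)) has_derivative
      (\<lambda>h. frechet_derivative \<phi> (at (c *\<^sub>R x)) (c *\<^sub>R h))) (at x)" for x
    by (rule has_derivative_compose)
  have "linear (frechet_derivative \<phi> (at y))" for y
    using Suc.prems by (auto intro: linear_frechet_derivative)
  then have *: "frechet_derivative \<phi> (at (c *\<^sub>R x)) (c *\<^sub>R axis i 1) = c *\<^sub>R (gradient \<phi> (c *\<^sub>R x) $ i)" for x i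
    by (simp add: linear_scale gradient_def)
  show ?case
    by (rule C_diff_SucI[OF d]) (use Suc in \<open>auto simp: * intro!: C_diff_bounded_linear[OF bounded_linear_scaleR_right]\<close>)
qed

lemma smooth_dilate: "smooth \<phi> \<Longrightarrow> smooth (\<lambda>x. \<phi> (c *\<^sub>R x))"
  by (auto simp: smooth_def C_diff_dilate)

lemma gradient_dilate:
  assumes "smooth \<phi>"
  shows "gradient (\<lambda>x. \<phi> (c *\<^sub>R x)) x $ i = c *\<^sub>R (gradient \<phi> (c *\<^sub>R x) $ i)"
proof -
  have "((\<lambda>x. \<phi> (c *\<^sub>R x)) has_derivative
     (\<lambda>h. \<Sum>i\<in>UNIV. (c *\<^sub>R h) $ i *\<^sub>R (gradient \<phi> (c *\<^sub>R x) $ i))) (at x)"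
    by (rule has_derivative_compose[where f="\<lambda>x. c *\<^sub>R x", OF _ smooth_has_derivative[OF assms]])
      (auto intro!: derivative_eq_intros)
  from gradient_nth[OF this, where i=i] have "gradient (\<lambda>x. \<phi> (c *\<^sub>R x)) x $ i
     = c *\<^sub>R (\<Sum>j\<in>UNIV. axis i 1 $ j *\<^sub>R (gradient \<phi> (c *\<^sub>R x) $ j))"
    by (simp add: scaleR_sum_right)
  with gradient_nth[OF smooth_has_derivative[OF assms], where x="c *\<^sub>R x" and i=i]
  show ?thesis by simp
qed

text \<open>The derivative of the reciprocal contains the reciprocal itself, undifferentiated, so
  the induction hypothesis for the same function suffices.\<close>

lemma C_diff_inverse:
  assumes "\<And>x. \<phi> x \<noteq> (0::real)"
  shows "C_diff k \<phi> \<Longrightarrow> C_diff k (\<lambda>x. inverse (\<phi> x))"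
proof (induction k)
  case 0
  then show ?case using assms by (auto intro!: continuous_intros)
next
  case (Suc k)
  then have d: "\<And>x. (\<phi> has_derivative frechet_derivative \<phi> (at x)) (at x)"
    by (simp_all add: frechet_derivative_works[THEN iffD1])
  have i: "C_diff k (\<lambda>x. inverse (\<phi> x))" using Suc C_diff_lower by blast
  show ?case
  proof (rule C_diff_SucI[OF Deriv.has_derivative_inverse[OF assms d]])
    fix i
    have "C_diff k (\<lambda>x. (- inverse (\<phi> x) * (gradient \<phi> x $ i)) * inverse (\<phi> x))"
      using Suc.prems i
      by (intro C_diff_bilinear[OF bounded_bilinear_mult] C_diff_bounded_linear[OF bounded_linear_minus[OF bounded_linear_ident]]) auto
    then show "C_diff k (\<lambda>x. - (inverse (\<phi> x) * frechet_derivative \<phi> (at x) (axis i 1) * inverse (\<phi> x)))"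
      by (simp add: gradient_def)
  qed
qed

lemma smooth_inverse: "(\<And>x. \<phi> x \<noteq> (0::real)) \<Longrightarrow> smooth \<phi> \<Longrightarrow> smooth (\<lambda>x. inverse (\<phi> x))"
  by (auto simp: smooth_def C_diff_inverse)

section \<open>Smooth transition functions built from exp(-1/t)\<close>

subsection \<open>Cutoff functions\<close>

text \<open>The family is closed under differentiation up to linear combinations, see \<open>bump_deriv\<close>.\<close>

definition bump :: "nat \<Rightarrow> real \<Rightarrow> real" where
  "bump m t = (if t \<le> 0 then 0 else (1 / t) ^ m * exp (- (1 / t)))"

lemma bump_nonneg: "0 \<le> bump m t" and bump_pos: "0 < t \<Longrightarrow> 0 < bump m t" and bump_zero: "t \<le> 0 \<Longrightarrow> bump m t = 0"
  by (auto simp: bump_def)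

text \<open>At 0 the difference quotient from the right is t^(-m-1) exp(-1/t), which tends to 0
  because the exponential beats every power; from the left it is identically 0. Both terms of the
  claimed derivative vanish there.\<close>

lemma bump_deriv: "(bump m has_field_derivative bump (m + 2) t - m * bump (m + 1) t) (at t)"
proof -
  consider "t < 0" | "t > 0" | "t = 0" by linarith
  then show ?thesis
  proof cases
    case 1
    have "((\<lambda>_. 0) has_field_derivative 0) (at t)" by simp
    then have "(bump m has_field_derivative 0) (at t)"
      by (rule has_field_derivative_transform_within_open[where S="{..<0}"]) (use 1 in \<open>auto simp: bump_def\<close>)
    with 1 show ?thesis by (simp add: bump_def)
  next
    case 2
    have "((\<lambda>t. (1 / t) ^ m * exp (- (1 / t))) has_field_derivative bump (m + 2) t - m * bump (m + 1) t) (at t)"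
    proof -
      have i: "((\<lambda>t. 1 / t) has_field_derivative - (1 / t)\<^sup>2) (at t)"
        using 2 by (auto intro!: derivative_eq_intros simp: power2_eq_square)
      have e: "((\<lambda>t. exp (- (1 / t))) has_field_derivative exp (- (1 / t)) * (1 / t)\<^sup>2) (at t)"
        using DERIV_chain2[OF DERIV_exp DERIV_minus[OF i]] by simp
      \<comment> \<open>The power rule produces the truncated exponent m - 1; for m = 0 the
        prefactor makes it harmless.\<close>
      have "real m * (- z\<^sup>2 * z ^ (m - Suc 0)) * E + E * z\<^sup>2 * z ^ m
          = z ^ (m + 2) * E - real m * (z ^ (m + 1) * E)" for z E :: real
        by (cases m) (simp_all add: power2_eq_square algebra_simps)
      from DERIV_cong[OF DERIV_mult[OF DERIV_power[OF i, of m] e] this] show ?thesis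
        using 2 by (simp add: bump_def del: power_one_over)
    qed
    then show ?thesis
      by (rule has_field_derivative_transform_within_open[where S="{0<..}"]) (use 2 in \<open>auto simp: bump_def\<close>)
  next
    case 3
    have "((\<lambda>h. (1 / h) ^ (m + 1) * exp (- (1 / h))) \<longlongrightarrow> 0) (at_right (0::real))"
    proof -
      \<comment> \<open>The substitution x = 1/h turns decay at infinity into the limit at 0 from
        the right.\<close>
      have "((\<lambda>x::real. x ^ (m + 1) / exp x) \<longlongrightarrow> 0) at_top" by (rule tendsto_power_div_exp_0)
      then have "((\<lambda>h. inverse h ^ (m + 1) / exp (inverse h)) \<longlongrightarrow> 0) (at_right (0::real))"
        by (rule filterlim_compose[OF _ filterlim_inverse_at_top_right])
      then show ?thesis by (simp add: exp_minus field_simps)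
    qed
    then have "((\<lambda>h. bump m h / h) \<longlongrightarrow> 0) (at_right 0)"
      by (rule Lim_transform_eventually) (auto simp: bump_def eventually_at_right_less eventually_at_filter)
    moreover have "((\<lambda>h. bump m h / h) \<longlongrightarrow> 0) (at_left 0)"
      by (rule Lim_transform_eventually[OF tendsto_const]) (auto simp: bump_def eventually_at_filter)
    ultimately have "((\<lambda>h. bump m h / h) \<longlongrightarrow> 0) (at 0)"
      by (simp add: filterlim_at_split)
    then have "(bump m has_field_derivative 0) (at 0)"
      by (simp add: DERIV_def bump_zero)
    with 3 show ?thesis by (simp add: bump_def)
  qed
qed

lemma continuous_on_bump: "continuous_on S (bump m)"
  using bump_deriv DERIV_isCont continuous_at_imp_continuous_on by blast

text \<open>Differentiation raises the index m, hence the induction on k for all m at once.\<close>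

lemma C_diff_bump: "C_diff k \<phi> \<Longrightarrow> C_diff k (\<lambda>x. bump m (\<phi> x))"
proof (induction k arbitrary: m)
  case 0
  then show ?case by (auto intro: continuous_on_compose2[OF continuous_on_bump])
next
  case (Suc k)
  then have d: "\<And>x. (\<phi> has_derivative frechet_derivative \<phi> (at x)) (at x)"
    by (simp_all add: frechet_derivative_works[THEN iffD1])
  have c: "C_diff k (\<lambda>x. bump m (\<phi> x))" for m using Suc C_diff_lower by blast
  have "((\<lambda>x. bump m (\<phi> x)) has_derivative
    (\<lambda>h. (bump (m + 2) (\<phi> x) - m * bump (m + 1) (\<phi> x)) * frechet_derivative \<phi> (at x) h)) (at x)" for x
    using has_derivative_compose[OF d bump_deriv[unfolded has_field_derivative_def]] by simp
  then show ?case
  proof (rule C_diff_SucI)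
    fix i
    have "C_diff k (\<lambda>x. (bump (m + 2) (\<phi> x) + (- m) * bump (m + 1) (\<phi> x)) * gradient \<phi> x $ i)"
      using Suc.prems by (intro C_diff_bilinear[OF bounded_bilinear_mult] C_diff_add C_diff_const c) auto
    then show "C_diff k (\<lambda>x. (bump (m + 2) (\<phi> x) - m * bump (m + 1) (\<phi> x)) * frechet_derivative \<phi> (at x) (axis i 1))"
      by (simp add: gradient_def)
  qed
qed

definition step :: "real \<Rightarrow> real" where
  "step t = bump 0 t / (bump 0 t + bump 0 (1 - t))"

lemma step_denominator_pos: "0 < bump 0 t + bump 0 (1 - t)"
  using bump_nonneg[of 0 t] bump_nonneg[of 0 "1 - t"] bump_pos[of t 0] bump_pos[of "1 - t" 0]
  by (cases "t > 0") (auto intro: add_pos_nonneg add_nonneg_pos)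

lemma step_le_0: "t \<le> 0 \<Longrightarrow> step t = 0" and step_ge_1: "1 \<le> t \<Longrightarrow> step t = 1"
  and step_nonneg: "0 \<le> step t" and step_le_1: "step t \<le> 1"
  using step_denominator_pos[of t] bump_nonneg[of 0 t] bump_nonneg[of 0 "1 - t"] bump_zero[of "1 - t" 0] bump_zero[of t 0]
  by (auto simp: step_def divide_le_eq_1)

lemma smooth_step: "smooth \<phi> \<Longrightarrow> smooth (\<lambda>x. step (\<phi> x))"
  unfolding step_def divide_inverse
  by (intro smooth_mult smooth_inverse smooth_add)
    (auto intro!: C_diff_bump smooth_diff[unfolded smooth_def, rule_format] C_diff_const
      simp: smooth_def less_imp_neq[OF step_denominator_pos, symmetric])

text \<open>The derivative is continuous, so bounded on the compact interval, and vanishes outside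
  it. The bound later becomes a gradient bound of order n for the cutoffs.\<close>

lemma step_deriv_bounded:
  obtains D L where "\<And>t. (step has_field_derivative D t) (at t)" "\<And>t. \<bar>D t\<bar> \<le> L"
    "\<And>t. t \<notin> {0..1} \<Longrightarrow> D t = 0"
proof -
  define b' where "b' t = bump 2 t" for t
  define D where "D t = (b' t * (bump 0 t + bump 0 (1 - t)) - bump 0 t * (b' t - b' (1 - t))) /
     ((bump 0 t + bump 0 (1 - t)) * (bump 0 t + bump 0 (1 - t)))" for t
  have b: "(bump 0 has_field_derivative b' t) (at t)" for t
    using bump_deriv[of 0 t] by (simp add: b'_def numeral_2_eq_2)
  have b1: "((\<lambda>t. bump 0 (1 - t)) has_field_derivative - b' (1 - t)) (at t)" for t
    by (rule DERIV_cong[OF DERIV_chain2[OF b, of "\<lambda>t. 1 - t" "-1"]]) (auto intro!: derivative_eq_intros)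
  have D: "(step has_field_derivative D t) (at t)" for t
    unfolding step_def[abs_def] D_def
    using step_denominator_pos[of t] DERIV_divide[OF b DERIV_add[OF b b1], of t] by simp
  have "continuous_on {0..1} D"
    unfolding D_def b'_def
    by (intro continuous_intros continuous_on_compose2[OF continuous_on_bump])
      (auto simp: less_imp_neq[OF step_denominator_pos, symmetric])
  then have "compact (D ` {0..1})" by (rule compact_continuous_image) simp
  then obtain L where L: "\<And>t. t \<in> {0..1} \<Longrightarrow> \<bar>D t\<bar> \<le> L"
    using compact_imp_bounded bounded_iff by (metis imageI real_norm_def)
  have z: "D t = 0" if "t \<notin> {0..1}" for t
    using that by (auto simp: D_def b'_def bump_def)
  have l: "\<bar>D t\<bar> \<le> L" for t
    using L[of t] L[of 0] z[of t] by (cases "t \<in> {0..1}") auto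
  from D l z show ?thesis by (rule that)
qed

section \<open>Calculus in L2: Cauchy-Schwarz, convergence, completeness\<close>

subsection \<open>Square integrable functions\<close>

lemma norm_add_power2_le:
  fixes a b :: "'a::real_normed_vector"
  shows "(norm (a + b))\<^sup>2 \<le> 2 * (norm a)\<^sup>2 + 2 * (norm b)\<^sup>2"
proof -
  have "(norm (a + b))\<^sup>2 \<le> (norm a + norm b)\<^sup>2" by (simp add: norm_triangle_ineq power_mono)
  also have "\<dots> \<le> 2 * (norm a)\<^sup>2 + 2 * (norm b)\<^sup>2"
    using sum_squares_bound[of "norm a" "norm b"] by (simp add: power2_sum)
  finally show ?thesis .
qed

lemma L2_measurable [measurable_dest]: "L2 M f \<Longrightarrow> f \<in> borel_measurable M"
  and L2_integrable: "L2 M f \<Longrightarrow> integrable M (\<lambda>x. (norm (f x))\<^sup>2)"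
  by (auto simp: L2_def)

lemma L2_bound:
  assumes "g \<in> borel_measurable M" "integrable M h" "\<And>x. x \<in> space M \<Longrightarrow> (norm (g x))\<^sup>2 \<le> h x"
  shows "L2 M g"
  unfolding L2_def
proof
  show "integrable M (\<lambda>x. (norm (g x))\<^sup>2)"
    by (rule Bochner_Integration.integrable_bound[OF assms(2)]) (use assms(1) in \<open>auto intro!: AE_I2 order_trans[OF assms(3) abs_ge_self]\<close>)
qed fact

lemma L2_zero: "L2 M (\<lambda>x. 0)"
  by (simp add: L2_def)

lemma L2_add: "L2 M f \<Longrightarrow> L2 M g \<Longrightarrow> L2 M (\<lambda>x. f x + g x)"
  by (rule L2_bound[where h="\<lambda>x. 2 * (norm (f x))\<^sup>2 + 2 * (norm (g x))\<^sup>2"])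
     (auto simp: L2_def norm_add_power2_le)

lemma L2_bounded_linear:
  assumes T: "bounded_linear T" and f: "L2 M f"
  shows "L2 M (\<lambda>x. T (f x))"
proof -
  obtain K where K: "\<And>x. norm (T x) \<le> norm x * K" using bounded_linear.bounded[OF T] by blast
  have "(norm (T x))\<^sup>2 \<le> K\<^sup>2 * (norm x)\<^sup>2" for x
    using power_mono[OF K, of x 2] by (simp add: power_mult_distrib mult.commute)
  moreover have "(\<lambda>x. T (f x)) \<in> borel_measurable M"
    using L2_measurable[OF f] borel_measurable_continuous_onI[OF linear_continuous_on[OF T]] by measurable
  ultimately show ?thesis
    by (intro L2_bound[where h="\<lambda>x. K\<^sup>2 * (norm (f x))\<^sup>2"]) (auto intro: L2_integrable f)
qed

lemmas L2_nth = L2_bounded_linear[OF bounded_linear_vec_nth]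
  and L2_inner = L2_bounded_linear[OF bounded_linear_inner_left]
  and L2_uminus = L2_bounded_linear[OF bounded_linear_minus[OF bounded_linear_ident]]

lemma L2_diff: "L2 M f \<Longrightarrow> L2 M g \<Longrightarrow> L2 M (\<lambda>x. f x - g x)"
  using L2_add[OF _ L2_uminus] by fastforce

lemma L2_Pair:
  assumes "L2 M f" "L2 M g" shows "L2 M (\<lambda>x. (f x, g x))"
proof (rule L2_bound)
  show "(\<lambda>x. (f x, g x)) \<in> borel_measurable M" using assms by (auto simp: L2_def)
  show "integrable M (\<lambda>x. (norm (f x))\<^sup>2 + (norm (g x))\<^sup>2)" using assms by (auto simp: L2_def)
qed (simp add: norm_prod_def)

lemma L2_sum: "(\<And>i. i \<in> I \<Longrightarrow> L2 M (f i)) \<Longrightarrow> L2 M (\<lambda>x. \<Sum>i\<in>I. f i x)"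
  by (induction I rule: infinite_finite_induct) (auto simp: L2_zero L2_add)

lemma L2_vec_lambda:
  assumes "\<And>i. L2 M (\<lambda>x. f x i)" shows "L2 M (\<lambda>x. \<chi> i. f x i)"
proof (rule L2_bound)
  have *: "(\<lambda>x. f x i \<bullet> b) \<in> borel_measurable M" for i b
    using L2_measurable[OF assms[of i]] by measurable
  show "(\<lambda>x. \<chi> i. f x i) \<in> borel_measurable M"
    by (subst borel_measurable_euclidean_space) (auto simp: Basis_vec_def inner_axis *)
  show "integrable M (\<lambda>x. \<Sum>i\<in>UNIV. (norm (f x i))\<^sup>2)" using assms by (auto simp: L2_def)
qed (simp add: norm_vec_def L2_set_def sum_nonneg)

lemma L2_bounded_mult:
  fixes m :: "'b \<Rightarrow> real"
  assumes m: "m \<in> borel_measurable M" "\<And>x. x \<in> space M \<Longrightarrow> \<bar>m x\<bar> \<le> L" and f: "L2 M f"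
  shows "L2 M (\<lambda>x. m x *\<^sub>R f x)"
proof (rule L2_bound[where h="\<lambda>x. L\<^sup>2 * (norm (f x))\<^sup>2"])
  show "(\<lambda>x. m x *\<^sub>R f x) \<in> borel_measurable M" using m L2_measurable[OF f] by measurable
  show "(norm (m x *\<^sub>R f x))\<^sup>2 \<le> L\<^sup>2 * (norm (f x))\<^sup>2" if "x \<in> space M" for x
  proof -
    have "(m x)\<^sup>2 \<le> L\<^sup>2" using power_mono[OF m(2)[OF that], of 2] by simp
    then show ?thesis by (simp add: power_mult_distrib mult_right_mono)
  qed
qed (auto intro: L2_integrable f)

text \<open>By 2 |a| |b| \<le> |a|^2 + |b|^2 a bilinear expression in two L2 functions has an
  integrable majorant.\<close>

lemma L2_bilinear_integrable:
  fixes P :: "'v::euclidean_space \<Rightarrow> 'w::euclidean_space \<Rightarrow> 'u::euclidean_space"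
  assumes P: "bounded_bilinear P" and f: "L2 M f" and g: "L2 M g"
  shows "integrable M (\<lambda>x. P (f x) (g x))"
proof -
  obtain K where K: "\<And>a b. norm (P a b) \<le> norm a * norm b * K" and K0: "0 \<le> K"
    using bounded_bilinear.nonneg_bounded[OF P] by blast
  have "norm (P a b) \<le> K * ((norm a)\<^sup>2 + (norm b)\<^sup>2)" for a b
  proof -
    have "norm a * norm b \<le> (norm a)\<^sup>2 + (norm b)\<^sup>2"
      using sum_squares_bound[of "norm a" "norm b"] mult_nonneg_nonneg[of "norm a" "norm b"]
      by (simp del: mult_nonneg_nonneg)
    then show ?thesis using order_trans[OF K] mult_right_mono[OF _ K0] by (metis mult.commute)
  qed
  note bd = this
  have "continuous_on UNIV (\<lambda>z. P (fst z) (snd z))"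
    by (intro bounded_bilinear.continuous_on[OF P] continuous_intros)
  then have "(\<lambda>z. P (fst z) (snd z)) \<in> borel_measurable borel" by (rule borel_measurable_continuous_onI)
  then have "(\<lambda>x. P (f x) (g x)) \<in> borel_measurable M"
    using measurable_compose[OF L2_measurable[OF L2_Pair[OF f g]], of "\<lambda>z. P (fst z) (snd z)"] by simp
  moreover have i: "integrable M (\<lambda>x. K * ((norm (f x))\<^sup>2 + (norm (g x))\<^sup>2))"
    using f g by (simp add: L2_integrable)
  ultimately show ?thesis
    by (intro Bochner_Integration.integrable_bound[OF i] AE_I2)
      (use order_trans[OF bd abs_ge_self] in auto)
qed

lemma L2_integrable_finite:
  assumes "finite_measure M" "L2 M f" shows "integrable M f"
proof -
  have "L2 M (\<lambda>_. 1::real)" using finite_measure.integrable_const[OF assms(1)] by (simp add: L2_def)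
  from L2_bilinear_integrable[OF bounded_bilinear_scaleR this assms(2)] show ?thesis by simp
qed

text \<open>The weighted inequality 2 |f| |g| \<le> t |f|^2 + |g|^2 / t is integrated and then
  optimized in t.\<close>

lemma Cauchy_Schwarz_L2:
  fixes f :: "'b \<Rightarrow> 'v::euclidean_space" and g :: "'b \<Rightarrow> 'w::euclidean_space"
  assumes f: "L2 M f" and g: "L2 M g"
  shows "(\<integral>x. norm (f x) * norm (g x) \<partial>M) \<le> sqrt (\<integral>x. (norm (f x))\<^sup>2 \<partial>M) * sqrt (\<integral>x. (norm (g x))\<^sup>2 \<partial>M)"
    (is "?I \<le> sqrt ?A * sqrt ?B")
proof -
  have i: "integrable M (\<lambda>x. norm (f x) * norm (g x))"
    using L2_bilinear_integrable[OF bounded_bilinear_mult, of M "\<lambda>x. norm (f x)" "\<lambda>x. norm (g x)"] f g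
    by (auto simp: L2_def)
  have nn: "0 \<le> ?A" "0 \<le> ?B" by simp_all
  have *: "2 * ?I \<le> t * ?A + ?B / t" if "t > 0" for t
  proof -
    have "2 * (norm (f x) * norm (g x)) \<le> t * (norm (f x))\<^sup>2 + (norm (g x))\<^sup>2 / t" for x
    proof -
      have "0 \<le> (sqrt t * norm (f x) - norm (g x) / sqrt t)\<^sup>2" by simp
      then show ?thesis using that by (simp add: power2_diff power_mult_distrib power_divide)
    qed
    then have "(\<integral>x. 2 * (norm (f x) * norm (g x)) \<partial>M) \<le> (\<integral>x. t * (norm (f x))\<^sup>2 + (norm (g x))\<^sup>2 / t \<partial>M)"
      using i f g
      by (intro integral_mono Bochner_Integration.integrable_add integrable_mult_right integrable_divide L2_integrable) auto
    then show ?thesis using f g by (simp add: L2_integrable)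
  qed
  \<comment> \<open>The optimal weight is the quotient of the two norms. Adding e > 0 to both keeps
    it defined when a norm is zero; e tends to 0 at the end.\<close>
  have "?I \<le> (sqrt ?A + e) * (sqrt ?B + e)" if "e > 0" for e
  proof -
    define a b where "a = sqrt ?A + e" and "b = sqrt ?B + e"
    have ab: "a > 0" "b > 0" using that nn by (simp_all add: a_def b_def add_nonneg_pos)
    have "?A \<le> a\<^sup>2" "?B \<le> b\<^sup>2"
      using power_mono[of "sqrt ?A" a 2] power_mono[of "sqrt ?B" b 2] that nn by (simp_all add: a_def b_def)
    then have "b / a * ?A \<le> b / a * a\<^sup>2" "?B / (b / a) \<le> b\<^sup>2 / (b / a)"
      using ab by (intro mult_left_mono divide_right_mono; simp)+
    moreover have "b / a * a\<^sup>2 = a * b" "b\<^sup>2 / (b / a) = a * b"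
      using ab by (simp_all add: power2_eq_square)
    moreover have "0 < b / a" using ab by simp
    ultimately have "?I \<le> a * b" using *[of "b / a"] by linarith
    then show ?thesis by (simp add: a_def b_def)
  qed
  then have "\<forall>\<^sub>F e in at_right 0. ?I \<le> (sqrt ?A + e) * (sqrt ?B + e)"
    by (intro eventually_at_rightI[of 0 1]) auto
  moreover have "((\<lambda>e. (sqrt ?A + e) * (sqrt ?B + e)) \<longlongrightarrow> (sqrt ?A + 0) * (sqrt ?B + 0)) (at_right 0)"
    by (intro tendsto_intros)
  ultimately show ?thesis
    using tendsto_lowerbound[of "\<lambda>e. (sqrt ?A + e) * (sqrt ?B + e)" _ "at_right 0" ?I] by simp
qed

lemma L2_bilinear_bound:
  fixes P :: "'v::euclidean_space \<Rightarrow> 'w::euclidean_space \<Rightarrow> 'u::euclidean_space"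
  assumes P: "bounded_bilinear P"
  obtains K where "0 \<le> K" "\<And>f g. L2 M f \<Longrightarrow> L2 M g \<Longrightarrow>
    norm (\<integral>x. P (f x) (g x) \<partial>M) \<le> K * (sqrt (\<integral>x. (norm (f x))\<^sup>2 \<partial>M) * sqrt (\<integral>x. (norm (g x))\<^sup>2 \<partial>M))"
proof -
  obtain K where K: "\<And>a b. norm (P a b) \<le> norm a * norm b * K" and K0: "0 \<le> K"
    using bounded_bilinear.nonneg_bounded[OF P] by blast
  have "norm (\<integral>x. P (f x) (g x) \<partial>M) \<le> K * (sqrt (\<integral>x. (norm (f x))\<^sup>2 \<partial>M) * sqrt (\<integral>x. (norm (g x))\<^sup>2 \<partial>M))"
    if f: "L2 M f" and g: "L2 M g" for f g
  proof -
    have i: "integrable M (\<lambda>x. norm (f x) * norm (g x))"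
      using L2_bilinear_integrable[OF bounded_bilinear_mult, of M "\<lambda>x. norm (f x)" "\<lambda>x. norm (g x)"] f g
      by (auto simp: L2_def)
    have "norm (\<integral>x. P (f x) (g x) \<partial>M) \<le> (\<integral>x. norm (P (f x) (g x)) \<partial>M)" by simp
    also have "\<dots> \<le> (\<integral>x. K * (norm (f x) * norm (g x)) \<partial>M)"
      using K i f g by (intro integral_mono integrable_norm L2_bilinear_integrable[OF P]) (auto simp: mult.commute)
    also have "\<dots> = K * (\<integral>x. norm (f x) * norm (g x) \<partial>M)" by simp
    also have "\<dots> \<le> K * (sqrt (\<integral>x. (norm (f x))\<^sup>2 \<partial>M) * sqrt (\<integral>x. (norm (g x))\<^sup>2 \<partial>M))"
      by (rule mult_left_mono[OF Cauchy_Schwarz_L2[OF f g] K0])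
    finally show ?thesis .
  qed
  with K0 that show thesis by blast
qed

lemma LIMSEQ_0_upper:
  fixes g h :: "nat \<Rightarrow> real"
  assumes "h \<longlonglongrightarrow> 0" "\<And>k. 0 \<le> g k" "\<And>k. g k \<le> h k"
  shows "g \<longlonglongrightarrow> 0"
  by (rule tendsto_sandwich[of "\<lambda>_. 0" g _ h]) (use assms in auto)

text \<open>Membership in L2 is part of the notion: the Bochner integral of a non-integrable
  function is 0, so the bare limit could hold vacuously.\<close>

definition L2_tendsto :: "'b measure \<Rightarrow> (nat \<Rightarrow> 'b \<Rightarrow> 'v::euclidean_space) \<Rightarrow> ('b \<Rightarrow> 'v) \<Rightarrow> bool" where
  "L2_tendsto M F f \<longleftrightarrow> (\<forall>k. L2 M (F k)) \<and> L2 M f \<and> (\<lambda>k. \<integral>x. (norm (F k x - f x))\<^sup>2 \<partial>M) \<longlonglongrightarrow> 0"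

lemma L2_tendsto_dominated:
  assumes "\<And>k. L2 M (G k)" "L2 M g" "L2_tendsto M F f"
    and "\<And>k x. x \<in> space M \<Longrightarrow> (norm (G k x - g x))\<^sup>2 \<le> K * (norm (F k x - f x))\<^sup>2"
  shows "L2_tendsto M G g"
proof -
  have "(\<lambda>k. K * (\<integral>x. (norm (F k x - f x))\<^sup>2 \<partial>M)) \<longlonglongrightarrow> 0"
    using assms(3) by (intro tendsto_mult_right_zero) (auto simp: L2_tendsto_def)
  then have "(\<lambda>k. \<integral>x. (norm (G k x - g x))\<^sup>2 \<partial>M) \<longlonglongrightarrow> 0"
  proof (rule LIMSEQ_0_upper)
    fix k
    have "(\<integral>x. (norm (G k x - g x))\<^sup>2 \<partial>M) \<le> (\<integral>x. K * (norm (F k x - f x))\<^sup>2 \<partial>M)"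
      using assms by (intro integral_mono integrable_mult_right L2_integrable L2_diff) (auto simp: L2_tendsto_def)
    then show "(\<integral>x. (norm (G k x - g x))\<^sup>2 \<partial>M) \<le> K * (\<integral>x. (norm (F k x - f x))\<^sup>2 \<partial>M)" by simp
  qed simp
  with assms show ?thesis by (simp add: L2_tendsto_def)
qed

lemma L2_tendsto_add:
  assumes "L2_tendsto M F f" "L2_tendsto M G g"
  shows "L2_tendsto M (\<lambda>k x. F k x + G k x) (\<lambda>x. f x + g x)"
proof -
  have "(\<lambda>k. 2 * (\<integral>x. (norm (F k x - f x))\<^sup>2 \<partial>M) + 2 * (\<integral>x. (norm (G k x - g x))\<^sup>2 \<partial>M)) \<longlonglongrightarrow> 0"
    using assms by (intro tendsto_add_zero tendsto_mult_right_zero) (auto simp: L2_tendsto_def)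
  then have "(\<lambda>k. \<integral>x. (norm ((F k x + G k x) - (f x + g x)))\<^sup>2 \<partial>M) \<longlonglongrightarrow> 0"
  proof (rule LIMSEQ_0_upper)
    fix k
    have "(\<integral>x. (norm ((F k x + G k x) - (f x + g x)))\<^sup>2 \<partial>M)
       \<le> (\<integral>x. 2 * (norm (F k x - f x))\<^sup>2 + 2 * (norm (G k x - g x))\<^sup>2 \<partial>M)"
      using assms norm_add_power2_le[of "F k x - f x" "G k x - g x" for x]
      by (intro integral_mono L2_integrable L2_diff L2_add Bochner_Integration.integrable_add integrable_mult_right)
        (auto simp: L2_tendsto_def algebra_simps)
    moreover have "(\<integral>x. 2 * (norm (F k x - f x))\<^sup>2 + 2 * (norm (G k x - g x))\<^sup>2 \<partial>M) =
       2 * (\<integral>x. (norm (F k x - f x))\<^sup>2 \<partial>M) + 2 * (\<integral>x. (norm (G k x - g x))\<^sup>2 \<partial>M)"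
      using assms by (subst Bochner_Integration.integral_add) (auto simp: L2_tendsto_def intro!: L2_integrable L2_diff)
    ultimately show "(\<integral>x. (norm ((F k x + G k x) - (f x + g x)))\<^sup>2 \<partial>M)
        \<le> 2 * (\<integral>x. (norm (F k x - f x))\<^sup>2 \<partial>M) + 2 * (\<integral>x. (norm (G k x - g x))\<^sup>2 \<partial>M)"
      by simp
  qed simp
  with assms show ?thesis by (simp add: L2_tendsto_def L2_add)
qed

lemma L2_tendsto_bounded_linear:
  assumes T: "bounded_linear T" and F: "L2_tendsto M F f"
  shows "L2_tendsto M (\<lambda>k x. T (F k x)) (\<lambda>x. T (f x))"
proof -
  obtain K where K: "\<And>x. norm (T x) \<le> norm x * K" using bounded_linear.bounded[OF T] by blast
  have *: "(norm (T x))\<^sup>2 \<le> K\<^sup>2 * (norm x)\<^sup>2" for x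
    using power_mono[OF K, of x 2] by (simp add: power_mult_distrib mult.commute)
  show ?thesis
  proof (rule L2_tendsto_dominated[OF _ _ F, where K="K\<^sup>2"])
    show "(norm (T (F k x) - T (f x)))\<^sup>2 \<le> K\<^sup>2 * (norm (F k x - f x))\<^sup>2" for k x
      using *[of "F k x - f x"] by (simp add: bounded_linear.linear[OF T] linear_diff)
  qed (use F in \<open>auto intro!: L2_bounded_linear[OF T] simp: L2_tendsto_def\<close>)
qed

lemmas L2_tendsto_nth = L2_tendsto_bounded_linear[OF bounded_linear_vec_nth]

lemma L2_tendsto_bounded_mult:
  fixes m :: "'b \<Rightarrow> real"
  assumes m: "m \<in> borel_measurable M" "\<And>x. x \<in> space M \<Longrightarrow> \<bar>m x\<bar> \<le> L" and F: "L2_tendsto M F f"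
  shows "L2_tendsto M (\<lambda>k x. m x *\<^sub>R F k x) (\<lambda>x. m x *\<^sub>R f x)"
proof (rule L2_tendsto_dominated[OF _ _ F, where K="L\<^sup>2"])
  show "(norm (m x *\<^sub>R F k x - m x *\<^sub>R f x))\<^sup>2 \<le> L\<^sup>2 * (norm (F k x - f x))\<^sup>2" if "x \<in> space M" for k x
  proof -
    have "(m x)\<^sup>2 \<le> L\<^sup>2" using power_mono[OF m(2)[OF that], of 2] by simp
    then show ?thesis by (simp add: power_mult_distrib mult_right_mono flip: scaleR_diff_right)
  qed
qed (use F in \<open>auto intro!: L2_bounded_mult[OF m] simp: L2_tendsto_def\<close>)

lemma L2_tendsto_const: "L2 M f \<Longrightarrow> L2_tendsto M (\<lambda>k. f) f"
  by (simp add: L2_tendsto_def)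

lemma L2_tendsto_integral_bilinear:
  fixes P :: "'v::euclidean_space \<Rightarrow> 'w::euclidean_space \<Rightarrow> 'u::euclidean_space"
  assumes P: "bounded_bilinear P" and F: "L2_tendsto M F f" and g: "L2 M g"
  shows "(\<lambda>k. \<integral>x. P (F k x) (g x) \<partial>M) \<longlonglongrightarrow> (\<integral>x. P (f x) (g x) \<partial>M)"
proof -
  obtain K where K: "\<And>f g. L2 M f \<Longrightarrow> L2 M g \<Longrightarrow>
    norm (\<integral>x. P (f x) (g x) \<partial>M) \<le> K * (sqrt (\<integral>x. (norm (f x))\<^sup>2 \<partial>M) * sqrt (\<integral>x. (norm (g x))\<^sup>2 \<partial>M))"
    using L2_bilinear_bound[OF P] by blast
  have L: "L2 M (\<lambda>x. F k x - f x)" for k using F by (auto simp: L2_tendsto_def intro: L2_diff)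
  have "(\<lambda>k. sqrt (\<integral>x. (norm (F k x - f x))\<^sup>2 \<partial>M)) \<longlonglongrightarrow> sqrt 0"
    using F unfolding L2_tendsto_def by (intro tendsto_real_sqrt) blast
  then have "(\<lambda>k. K * (sqrt (\<integral>x. (norm (F k x - f x))\<^sup>2 \<partial>M) * sqrt (\<integral>x. (norm (g x))\<^sup>2 \<partial>M))) \<longlonglongrightarrow> 0"
    by (intro tendsto_mult_right_zero tendsto_mult_left_zero) simp
  then have "(\<lambda>k. norm (\<integral>x. P (F k x - f x) (g x) \<partial>M)) \<longlonglongrightarrow> 0"
    by (rule LIMSEQ_0_upper) (auto intro: K L g)
  then have "(\<lambda>k. \<integral>x. P (F k x - f x) (g x) \<partial>M) \<longlonglongrightarrow> 0"
    by (rule tendsto_norm_zero_cancel)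
  moreover have "(\<integral>x. P (F k x - f x) (g x) \<partial>M) = (\<integral>x. P (F k x) (g x) \<partial>M) - (\<integral>x. P (f x) (g x) \<partial>M)" for k
    using F g by (simp add: bounded_bilinear.diff_left[OF P] L2_bilinear_integrable[OF P] L2_tendsto_def)
  ultimately show ?thesis by (simp add: LIM_zero_iff)
qed

text \<open>In |F|^2 = |F - f|^2 + 2 F . f - |f|^2 the first term tends to 0 and the mixed term
  converges by \<open>L2_tendsto_integral_bilinear\<close>.\<close>

lemma L2_tendsto_norm:
  assumes "L2_tendsto M F f"
  shows "(\<lambda>k. \<integral>x. (norm (F k x))\<^sup>2 \<partial>M) \<longlonglongrightarrow> (\<integral>x. (norm (f x))\<^sup>2 \<partial>M)"
proof -
  have F: "\<And>k. L2 M (F k)" "L2 M f" using assms by (auto simp: L2_tendsto_def)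
  have "(norm (F k x))\<^sup>2 = (norm (F k x - f x))\<^sup>2 + 2 * (F k x \<bullet> f x) - f x \<bullet> f x" for k x
    by (simp add: power2_norm_eq_inner algebra_simps inner_commute)
  then have "(\<integral>x. (norm (F k x))\<^sup>2 \<partial>M) = (\<integral>x. (norm (F k x - f x))\<^sup>2 \<partial>M) + 2 * (\<integral>x. F k x \<bullet> f x \<partial>M)
     - (\<integral>x. f x \<bullet> f x \<partial>M)" for k
    using F by (simp add: L2_integrable[OF L2_diff] L2_bilinear_integrable[OF bounded_bilinear_inner])
  moreover have "(\<lambda>k. (\<integral>x. (norm (F k x - f x))\<^sup>2 \<partial>M) + 2 * (\<integral>x. F k x \<bullet> f x \<partial>M) - (\<integral>x. f x \<bullet> f x \<partial>M))
     \<longlonglongrightarrow> 0 + 2 * (\<integral>x. f x \<bullet> f x \<partial>M) - (\<integral>x. f x \<bullet> f x \<partial>M)"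
    using assms F by (intro tendsto_intros L2_tendsto_integral_bilinear[OF bounded_bilinear_inner]) (auto simp: L2_tendsto_def)
  ultimately show ?thesis by (simp add: power2_norm_eq_inner)
qed

text \<open>Riesz-Fischer: a rapidly converging subsequence converges almost everywhere, and Fatou's
  lemma transfers the Cauchy estimate to its pointwise limit.\<close>

lemma L2_complete:
  fixes F :: "nat \<Rightarrow> 'b \<Rightarrow> 'v::euclidean_space"
  assumes F: "\<And>k. L2 M (F k)"
    and Cauchy: "\<And>e. e > 0 \<Longrightarrow> \<exists>N. \<forall>m\<ge>N. \<forall>n\<ge>N. (\<integral>x. (norm (F m x - F n x))\<^sup>2 \<partial>M) < e"
  shows "\<exists>f. L2_tendsto M F f"
proof -
  have meas[measurable]: "\<And>k. F k \<in> borel_measurable M" using F by (simp add: L2_def)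
  have nn: "(\<integral>\<^sup>+x. ennreal ((norm (F m x - F n x))\<^sup>2) \<partial>M) = ennreal (\<integral>x. (norm (F m x - F n x))\<^sup>2 \<partial>M)" for m n
    by (intro nn_integral_eq_integral L2_integrable L2_diff F) auto
  have "\<forall>k. \<exists>N. \<forall>m\<ge>N. \<forall>n\<ge>N. (\<integral>x. (norm (F m x - F n x))\<^sup>2 \<partial>M) < (1/4)^k"
    using Cauchy by simp
  from choice[OF this] obtain r
    where r: "\<And>k m n. m \<ge> r k \<Longrightarrow> n \<ge> r k \<Longrightarrow> (\<integral>x. (norm (F m x - F n x))\<^sup>2 \<partial>M) < (1/4)^k"
    by blast
  \<comment> \<open>Partial sums of \<open>r\<close> give a monotone sequence above
    \<open>r\<close>; the summand k makes it tend to infinity.\<close>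
  define s where "s k = (\<Sum>j\<le>k. r j) + k" for k
  have s_ge: "r k \<le> s k" "s k \<le> s (Suc k)" "k \<le> s k" for k
    by (auto simp: s_def intro: trans_le_add1 member_le_sum)
  define g where "g k x = F (s (Suc k)) x - F (s k) x" for k x
  have [measurable]: "\<And>k. g k \<in> borel_measurable M" by (simp add: g_def[abs_def])
  have gk: "(\<integral>\<^sup>+x. ennreal ((norm (g k x))\<^sup>2) \<partial>M) \<le> ennreal ((1/4)^k)" for k
    using r[of k "s (Suc k)" "s k"] s_ge[of k] unfolding g_def nn
    by (intro ennreal_leI) auto
  \<comment> \<open>The weight 2^k is affordable because the squared increments decay like 4^(-k),
    and it makes the increments themselves summable below.\<close>
  have "(\<integral>\<^sup>+x. (\<Sum>k. ennreal (2^k * (norm (g k x))\<^sup>2)) \<partial>M) = (\<Sum>k. \<integral>\<^sup>+x. ennreal (2^k * (norm (g k x))\<^sup>2) \<partial>M)"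
    by (rule nn_integral_suminf) auto
  also have "\<dots> \<le> (\<Sum>k. ennreal ((1/2)^k))"
  proof (intro suminf_le allI)
    fix k
    have "(\<integral>\<^sup>+x. ennreal (2^k * (norm (g k x))\<^sup>2) \<partial>M) = ennreal (2^k) * (\<integral>\<^sup>+x. ennreal ((norm (g k x))\<^sup>2) \<partial>M)"
      by (simp add: ennreal_mult nn_integral_cmult)
    also have "\<dots> \<le> ennreal (2^k) * ennreal ((1/4)^k)" by (intro mult_left_mono gk) auto
    also have "\<dots> = ennreal (2^k * (1/4)^k)" by (simp add: ennreal_mult del: power_one_over)
    also have "(2::real)^k * (1/4)^k = (1/2)^k" by (simp flip: power_mult_distrib)
    finally show "(\<integral>\<^sup>+x. ennreal (2^k * (norm (g k x))\<^sup>2) \<partial>M) \<le> ennreal ((1/2)^k)" .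
  qed auto
  also have "\<dots> = ennreal (\<Sum>k. (1/2)^k)"
    by (intro suminf_ennreal2) (auto simp: summable_geometric del: power_one_over)
  also have "\<dots> < \<infinity>" by simp
  finally have "AE x in M. (\<Sum>k. ennreal (2^k * (norm (g k x))\<^sup>2)) \<noteq> \<infinity>"
    by (intro nn_integral_PInf_AE) auto
  then have conv: "AE x in M. (\<lambda>k. F (s k) x) \<longlonglongrightarrow> lim (\<lambda>k. F (s k) x)"
  proof eventually_elim
    case (elim x)
    have "summable (\<lambda>k. 2^k * (norm (g k x))\<^sup>2)"
      using elim unfolding infinity_ennreal_def by (intro summable_suminf_not_top) simp_all
    then have "summable (\<lambda>k. (1/2)^k + 2^k * (norm (g k x))\<^sup>2)"
      by (intro summable_add summable_geometric) auto
    \<comment> \<open>Either the increment is at most 2^(-k), or it is at most 2^k times its own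
      square.\<close>
    moreover have "norm (g k x) \<le> (1/2)^k + 2^k * (norm (g k x))\<^sup>2" for k
    proof (cases "norm (g k x) \<le> (1/2)^k")
      case False
      then have "1 \<le> 2^k * norm (g k x)" by (simp add: field_simps power_one_over)
      then have "1 * norm (g k x) \<le> 2^k * norm (g k x) * norm (g k x)" by (intro mult_right_mono) auto
      then show ?thesis by (simp add: power2_eq_square add_increasing)
    qed (simp add: add_increasing2)
    ultimately have "summable (\<lambda>k. norm (g k x))"
      by (rule_tac summable_comparison_test'[where N=0]) auto
    then have "summable (\<lambda>k. g k x)" by (rule summable_norm_cancel)
    then have "convergent (\<lambda>n. \<Sum>k<n. g k x)" by (simp add: summable_iff_convergent)
    then have "convergent (\<lambda>n. F (s n) x - F (s 0) x)" using sum_lessThan_telescope[of "\<lambda>n. F (s n) x"] by (simp add: g_def)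
    from convergent_add[OF this convergent_const[of "F (s 0) x"]]
    show ?case by (simp add: convergent_LIMSEQ_iff)
  qed
  define f where "f x = lim (\<lambda>k. F (s k) x)" for x
  have [measurable]: "f \<in> borel_measurable M" unfolding f_def[abs_def] by measurable
  \<comment> \<open>Fatou along the subsequence, in the extended reals because integrability of the
    difference to the limit is not yet known.\<close>
  have *: "(\<integral>\<^sup>+x. ennreal ((norm (F n x - f x))\<^sup>2) \<partial>M) \<le> ennreal e"
    if "e > 0" and N: "\<And>m n. m \<ge> N \<Longrightarrow> n \<ge> N \<Longrightarrow> (\<integral>x. (norm (F m x - F n x))\<^sup>2 \<partial>M) < e" and "n \<ge> N" for e N n
  proof -
    have "(\<integral>\<^sup>+x. ennreal ((norm (F n x - f x))\<^sup>2) \<partial>M) = (\<integral>\<^sup>+x. liminf (\<lambda>k. ennreal ((norm (F n x - F (s k) x))\<^sup>2)) \<partial>M)"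
    proof (rule nn_integral_cong_AE, use conv in eventually_elim)
      case (elim x)
      have "(\<lambda>k. ennreal ((norm (F n x - F (s k) x))\<^sup>2)) \<longlonglongrightarrow> ennreal ((norm (F n x - f x))\<^sup>2)"
        using elim by (intro tendsto_intros) (auto simp: f_def)
      from lim_imp_Liminf[OF _ this] show ?case by simp
    qed
    also have "\<dots> \<le> liminf (\<lambda>k. \<integral>\<^sup>+x. ennreal ((norm (F n x - F (s k) x))\<^sup>2) \<partial>M)"
      by (rule nn_integral_liminf) auto
    also have "\<dots> \<le> limsup (\<lambda>k. \<integral>\<^sup>+x. ennreal ((norm (F n x - F (s k) x))\<^sup>2) \<partial>M)"
      by (rule Liminf_le_Limsup) simp
    also have "\<dots> \<le> ennreal e"
    proof (rule Limsup_bounded)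
      show "\<forall>\<^sub>F k in sequentially. (\<integral>\<^sup>+x. ennreal ((norm (F n x - F (s k) x))\<^sup>2) \<partial>M) \<le> ennreal e"
        using eventually_ge_at_top[of N]
      proof eventually_elim
        case (elim k)
        then have "s k \<ge> N" using s_ge(3)[of k] by simp
        then show ?case unfolding nn using N[OF \<open>n \<ge> N\<close>, of "s k"] by (intro ennreal_leI) simp
      qed
    qed
    finally show ?thesis .
  qed
  have L2d: "L2 M (\<lambda>x. F n x - f x) \<and> (\<integral>x. (norm (F n x - f x))\<^sup>2 \<partial>M) \<le> e"
    if "e > 0" and N: "\<And>m n. m \<ge> N \<Longrightarrow> n \<ge> N \<Longrightarrow> (\<integral>x. (norm (F m x - F n x))\<^sup>2 \<partial>M) < e" and "n \<ge> N" for e N n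
  proof
    have "(\<integral>\<^sup>+x. ennreal ((norm (F n x - f x))\<^sup>2) \<partial>M) < \<infinity>"
      using *[OF that] le_less_trans by fastforce
    then show l: "L2 M (\<lambda>x. F n x - f x)"
      unfolding L2_def by (auto intro!: integrableI_nonneg)
    have "ennreal (\<integral>x. (norm (F n x - f x))\<^sup>2 \<partial>M) \<le> ennreal e"
      using *[OF that] by (subst nn_integral_eq_integral[symmetric]) (auto intro: L2_integrable l)
    then show "(\<integral>x. (norm (F n x - f x))\<^sup>2 \<partial>M) \<le> e" using that(1) by simp
  qed
  have f: "L2 M f"
  proof -
    obtain N where "\<And>m n. m \<ge> N \<Longrightarrow> n \<ge> N \<Longrightarrow> (\<integral>x. (norm (F m x - F n x))\<^sup>2 \<partial>M) < 1"
      using Cauchy[of 1] by auto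
    then have "L2 M (\<lambda>x. F N x - f x)" using L2d[of 1 N N] by auto
    from L2_diff[OF F[of N] this] show ?thesis by simp
  qed
  have "(\<lambda>k. \<integral>x. (norm (F k x - f x))\<^sup>2 \<partial>M) \<longlonglongrightarrow> 0"
  proof (rule LIMSEQ_I)
    fix e :: real assume "e > 0"
    then obtain N where "\<And>m n. m \<ge> N \<Longrightarrow> n \<ge> N \<Longrightarrow> (\<integral>x. (norm (F m x - F n x))\<^sup>2 \<partial>M) < e / 2"
      using Cauchy[of "e/2"] by auto
    then have "(\<integral>x. (norm (F n x - f x))\<^sup>2 \<partial>M) \<le> e / 2" if "n \<ge> N" for n
      using L2d[of "e/2" N n] that \<open>e > 0\<close> by auto
    then show "\<exists>no. \<forall>n\<ge>no. norm ((\<integral>x. (norm (F n x - f x))\<^sup>2 \<partial>M) - 0) < e"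
      using \<open>e > 0\<close> by (intro exI[of _ N]) (auto intro: le_less_trans[of _ "e / 2"])
  qed
  with f F show ?thesis by (auto simp: L2_tendsto_def)
qed

section \<open>Lebesgue measure on the ball and the cone measure on the sphere\<close>

subsection \<open>Integration over the unit ball and the unit sphere\<close>

lemma space_vol_B [simp]: "space (vol B) = B"
  by (simp add: space_restrict_space)

lemma borel_imp_vol: "f \<in> borel_measurable borel \<Longrightarrow> f \<in> borel_measurable (vol B)"
  by (intro measurable_restrict_space1) simp

lemma finite_measure_vol_B: "finite_measure (vol B)"
proof
  have "emeasure lborel B \<le> emeasure lborel (cball 0 1 :: (real^3) set)"
    by (intro emeasure_mono) auto
  also have "\<dots> < \<infinity>" by (intro emeasure_compact_finite) simp
  finally show "emeasure (vol B) (space (vol B)) \<noteq> \<infinity>"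
    by (simp add: emeasure_restrict_space)
qed

lemma radial_projection_measurable: "(\<lambda>x::real^3. x /\<^sub>R norm x) \<in> vol B \<rightarrow>\<^sub>M borel"
  by (intro borel_imp_vol) measurable

lemma sets_sphere_measure [simp, measurable_cong]: "sets sphere_measure = sets borel"
  and space_sphere_measure [simp]: "space sphere_measure = UNIV"
  by (simp_all add: sphere_measure_def space_scale_measure)

lemma nn_integral_sphere:
  assumes "f \<in> borel_measurable borel"
  shows "(\<integral>\<^sup>+x. f x \<partial>sphere_measure) = 3 * (\<integral>\<^sup>+x. f (x /\<^sub>R norm x) \<partial>vol B)"
  using assms unfolding sphere_measure_def
  by (subst nn_integral_scale_measure) (simp_all add: nn_integral_distr[OF radial_projection_measurable])

lemma finite_measure_sphere: "finite_measure sphere_measure"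
proof
  have "emeasure sphere_measure UNIV = 3 * emeasure (vol B) B"
    unfolding sphere_measure_def
    by (simp add: emeasure_distr[OF radial_projection_measurable])
  also have "\<dots> < \<infinity>"
    using finite_measure.emeasure_finite[OF finite_measure_vol_B, of B] by (auto simp: ennreal_mult_less_top less_top)
  finally show "emeasure sphere_measure (space sphere_measure) \<noteq> \<infinity>" by simp
qed

text \<open>Division by the norm sends the origin to itself and not to the sphere, so the origin is
  first discarded as a null set.\<close>

lemma AE_sphere:
  assumes "\<And>x. norm x = 1 \<Longrightarrow> P x" "Measurable.pred borel P"
  shows "AE x in sphere_measure. P x"
proof -
  have [measurable]: "{x. \<not> P x} \<in> sets borel" using assms(2) by measurable
  have "AE x in vol B. x \<noteq> 0"
    using AE_lborel_singleton[of "0::real^3"] by (auto simp: AE_restrict_space_iff elim: eventually_mono)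
  then have "AE x in vol B. P (x /\<^sub>R norm x)"
    by eventually_elim (auto intro!: assms(1))
  then have "AE x in distr (vol B) borel (\<lambda>x. x /\<^sub>R norm x). P x"
    using assms(2) by (subst AE_distr_iff[OF radial_projection_measurable]) auto
  then have "emeasure (distr (vol B) borel (\<lambda>x. x /\<^sub>R norm x)) {x. \<not> P x} = 0"
    by (subst (asm) AE_iff_measurable[where N="{x. \<not> P x}"]) auto
  then have "emeasure sphere_measure {x. \<not> P x} = 0"
    by (simp add: sphere_measure_def)
  then show ?thesis by (subst AE_iff_measurable[where N="{x. \<not> P x}"]) auto
qed

lemma continuous_on_compact_bounded:
  fixes f :: "'a::topological_space \<Rightarrow> 'b::real_normed_vector"
  assumes "compact K" "continuous_on K f"
  obtains C where "0 \<le> C" "\<And>x. x \<in> K \<Longrightarrow> norm (f x) \<le> C"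
proof -
  have "bounded (f ` K)" using assms by (intro compact_imp_bounded compact_continuous_image)
  then obtain C where "\<forall>y\<in>f ` K. norm y \<le> C" unfolding bounded_iff by blast
  then have "norm (f x) \<le> max C 0" if "x \<in> K" for x using that by (simp add: le_max_iff_disj)
  then show thesis by (rule that[OF max.cobounded2])
qed

lemma continuous_bounded_cball:
  assumes "continuous_on UNIV (f :: real^3 \<Rightarrow> 'a::real_normed_vector)"
  obtains L where "0 \<le> L" "\<And>x. norm x \<le> 1 \<Longrightarrow> norm (f x) \<le> L"
  using continuous_on_compact_bounded[OF compact_cball continuous_on_subset[OF assms subset_UNIV], of 0 1]
  by auto

lemma L2_continuous_B:
  fixes f :: "real^3 \<Rightarrow> 'v::euclidean_space"
  assumes "continuous_on UNIV f" shows "L2 (vol B) f"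
proof -
  obtain L where L: "0 \<le> L" "\<And>x. norm x \<le> 1 \<Longrightarrow> norm (f x) \<le> L" using continuous_bounded_cball[OF assms] by blast
  show ?thesis
    by (rule L2_bound[where h="\<lambda>_. L\<^sup>2"])
      (use L in \<open>auto intro!: borel_imp_vol borel_measurable_continuous_onI assms
        finite_measure.integrable_const finite_measure_vol_B power_mono\<close>)
qed

lemma L2_continuous_sphere:
  fixes f :: "real^3 \<Rightarrow> 'v::euclidean_space"
  assumes "continuous_on UNIV f" shows "L2 sphere_measure f"
proof -
  obtain L where L: "0 \<le> L" "\<And>x. norm x \<le> 1 \<Longrightarrow> norm (f x) \<le> L" using continuous_bounded_cball[OF assms] by blast
  have f[measurable]: "f \<in> borel_measurable borel" by (rule borel_measurable_continuous_onI[OF assms])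
  have "AE x in sphere_measure. (norm (f x))\<^sup>2 \<le> L\<^sup>2"
    by (rule AE_sphere) (use L in \<open>auto intro!: power_mono\<close>)
  moreover have "integrable sphere_measure (\<lambda>_. L\<^sup>2)"
    by (intro finite_measure.integrable_const finite_measure_sphere)
  ultimately have "integrable sphere_measure (\<lambda>x. (norm (f x))\<^sup>2)"
    by (rule_tac Bochner_Integration.integrable_bound[where f="\<lambda>_. L\<^sup>2"]) auto
  then show ?thesis by (simp add: L2_def)
qed

lemma integral_vol_B:
  "(\<integral>x. f x \<partial>vol B) = (\<integral>x. indicator B x *\<^sub>R f x \<partial>lborel)"
  for f :: "real^3 \<Rightarrow> 'v::euclidean_space"
  by (rule integral_restrict_space) simp

section \<open>Vanishing integrals of partial derivatives with compact support\<close>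

subsection \<open>Integration by parts\<close>

lemma gradient_zero_outside:
  assumes "closed K" "\<And>x. x \<notin> K \<Longrightarrow> \<phi> x = 0" "x \<notin> K"
  shows "gradient \<phi> x = 0"
proof -
  have "gradient \<phi> x = gradient (\<lambda>_. 0) x"
    using assms by (intro gradient_cong_open[of "- K"]) auto
  then show ?thesis by (simp add: gradient_const)
qed

text \<open>Difference quotients of F have integral zero by translation invariance of Lebesgue
  measure, and they converge to the partial derivative under an integrable bound.\<close>

lemma integral_partial_eq_0:
  fixes F :: "real^3 \<Rightarrow> 'v::euclidean_space"
  assumes F: "smooth F" and K: "compact K" "\<And>x. x \<notin> K \<Longrightarrow> F x = 0"
  shows "(\<integral>x. gradient F x $ i \<partial>lborel) = 0"
proof -
  let ?D = "\<lambda>x h. \<Sum>j\<in>UNIV. h $ j *\<^sub>R (gradient F x $ j)"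
  have cont: "continuous_on UNIV F" by (rule smooth_continuous[OF F])
  have gcont: "continuous_on S (\<lambda>x. gradient F x $ j)" for j S
    by (rule smooth_continuous[OF smooth_partial[OF F]])
  have "\<exists>L. \<forall>x. norm (gradient F x $ j) \<le> L" for j
  proof -
    obtain L where L: "\<And>x. x \<in> K \<Longrightarrow> norm (gradient F x $ j) \<le> L"
      using continuous_on_compact_bounded[OF K(1) gcont] by blast
    have "norm (gradient F x $ j) \<le> max L 0" for x
      using L[of x] gradient_zero_outside[OF compact_imp_closed[OF K(1)], where \<phi>=F and x=x] K(2) by (cases "x \<in> K") auto
    then show ?thesis by blast
  qed
  then have "\<forall>j. \<exists>L. \<forall>x. norm (gradient F x $ j) \<le> L" by blast
  from choice[OF this] obtain L where L: "\<And>x j. norm (gradient F x $ j) \<le> L j" by blast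
  have on: "onorm (?D x) \<le> sum L UNIV" for x
  proof (rule onorm_le)
    fix h :: "real^3"
    have "norm (?D x h) \<le> (\<Sum>j\<in>UNIV. \<bar>h $ j\<bar> * norm (gradient F x $ j))"
      by (rule order_trans[OF norm_sum]) simp
    also have "\<dots> \<le> (\<Sum>j\<in>UNIV. norm h * L j)"
      by (intro sum_mono mult_mono L component_le_norm_cart) auto
    finally show "norm (?D x h) \<le> sum L UNIV * norm h" by (simp add: sum_distrib_left mult.commute)
  qed
  \<comment> \<open>The gradient vanishes off K and is therefore bounded; the mean value inequality
    turns this into a uniform bound for all difference quotients.\<close>
  have lip: "norm (F y - F x) \<le> sum L UNIV * norm (y - x)" for x y
    by (rule differentiable_bound[where S=UNIV and f'="?D"])
      (auto intro: has_derivative_at_withinI smooth_has_derivative F on)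
  obtain R where R: "\<And>x. x \<in> K \<Longrightarrow> norm x \<le> R"
    using compact_imp_bounded[OF K(1)] unfolding bounded_iff by blast
  define h where "h n = inverse (real (Suc n))" for n
  have h: "0 < h n" "h n \<le> 1" for n by (auto simp: h_def field_simps)
  have h0: "h \<longlonglongrightarrow> 0" unfolding h_def[abs_def] by (rule LIMSEQ_inverse_real_of_nat)
  define s where "s n x = (F (x + h n *\<^sub>R axis i 1) - F x) /\<^sub>R h n" for n x
  have Fm[measurable]: "F \<in> borel_measurable borel" by (rule borel_measurable_continuous_onI[OF cont])
  have Gm[measurable]: "(\<lambda>x. gradient F x $ i) \<in> borel_measurable borel" by (rule borel_measurable_continuous_onI[OF gcont])
  obtain C where C: "\<And>x. x \<in> K \<Longrightarrow> norm (F x) \<le> C"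
    using continuous_on_compact_bounded[OF K(1) continuous_on_subset[OF cont subset_UNIV]] by blast
  have Cint: "integrable lborel (\<lambda>x. indicator K x * C)"
    using K(1) by (intro integrable_mult_left integrable_real_indicator)
      (auto simp: borel_compact emeasure_compact_finite[unfolded infinity_ennreal_def])
  have Fint: "integrable lborel F"
    by (rule Bochner_Integration.integrable_bound[OF Cint])
      (use C K(2) in \<open>auto simp: indicator_def intro: order_trans[OF C abs_ge_self]\<close>)
  have shift: "(\<integral>x. F (x + c) \<partial>lborel) = (\<integral>x. F x \<partial>lborel)" "integrable lborel (\<lambda>x. F (x + c))" for c
  proof -
    have "(\<integral>x. F x \<partial>lborel) = (\<integral>x. F x \<partial>distr lborel borel ((+) c))" by (simp add: lborel_distr_plus)
    then show "(\<integral>x. F (x + c) \<partial>lborel) = (\<integral>x. F x \<partial>lborel)"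
      by (simp add: integral_distr add.commute)
    have "integrable (distr lborel borel ((+) c)) F" using Fint by (simp add: lborel_distr_plus)
    then show "integrable lborel (\<lambda>x. F (x + c))"
      by (subst (asm) integrable_distr_eq) (auto simp: add.commute)
  qed
  have "(\<integral>x. s n x \<partial>lborel) = 0" for n
    unfolding s_def using shift Fint by simp
  \<comment> \<open>The increments are at most 1, so all quotients are supported in the ball of
    radius R + 1.\<close>
  moreover have "(\<lambda>n. \<integral>x. s n x \<partial>lborel) \<longlonglongrightarrow> (\<integral>x. gradient F x $ i \<partial>lborel)"
  proof (rule integral_dominated_convergence[where w="\<lambda>x. indicator (cball 0 (R + 1)) x * sum L UNIV"])
    show "integrable lborel (\<lambda>x. indicator (cball 0 (R + 1) :: (real^3) set) x * sum L UNIV)"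
      by (intro integrable_mult_left integrable_real_indicator) (auto simp: emeasure_compact_finite[unfolded infinity_ennreal_def])
    have "norm (s n x) \<le> indicator (cball 0 (R + 1)) x * sum L UNIV" for n x
    proof (cases "norm x \<le> R + 1")
      case True
      have "norm (s n x) = inverse (h n) * norm (F (x + h n *\<^sub>R axis i 1) - F x)"
        using h[of n] by (simp add: s_def)
      also have "\<dots> \<le> inverse (h n) * (sum L UNIV * norm ((x + h n *\<^sub>R axis i 1) - x))"
        using h[of n] by (intro mult_left_mono lip) simp
      also have "\<dots> = sum L UNIV" using h[of n] by simp
      finally show ?thesis using True by simp
    next
      case False
      have "norm x \<le> norm (x + h n *\<^sub>R axis i 1) + norm (h n *\<^sub>R axis i 1 :: real^3)"
        using norm_triangle_ineq4[of "x + h n *\<^sub>R axis i 1" "h n *\<^sub>R axis i 1"] by simp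
      also have "norm (h n *\<^sub>R axis i 1 :: real^3) \<le> 1" using h[of n] by simp
      finally have "x + h n *\<^sub>R axis i 1 \<notin> K" "x \<notin> K"
        using R[of x] R[of "x + h n *\<^sub>R axis i 1"] False by auto
      then show ?thesis using K(2) False by (simp add: s_def)
    qed
    then show "AE x in lborel. norm (s n x) \<le> indicator (cball 0 (R + 1)) x * sum L UNIV" for n by simp
    have "(\<lambda>n. s n x) \<longlonglongrightarrow> gradient F x $ i" for x
    proof -
      have "((\<lambda>t. F (x + t *\<^sub>R axis i 1)) has_derivative (\<lambda>t. ?D x (t *\<^sub>R axis i 1))) (at 0)"
        by (rule has_derivative_compose[where f="\<lambda>t. x + t *\<^sub>R axis i 1" and g=F])
          (auto intro!: derivative_eq_intros smooth_has_derivative[OF F])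
      moreover have "?D x (t *\<^sub>R axis i 1) = t *\<^sub>R (gradient F x $ i)" for t
      proof -
        have "?D x (t *\<^sub>R axis i 1) = t *\<^sub>R ?D x (axis i 1)" by (simp add: scaleR_sum_right)
        then show ?thesis
          using gradient_nth[OF smooth_has_derivative[OF F], where x=x and i=i] by simp
      qed
      ultimately have "((\<lambda>t. norm (F (x + t *\<^sub>R axis i 1) - F x - t *\<^sub>R (gradient F x $ i)) / norm t) \<longlongrightarrow> 0) (at 0)"
        by (simp add: has_derivative_at)
      moreover have "filterlim h (at 0) sequentially"
        unfolding filterlim_at using h0 h by (auto simp: less_imp_neq[symmetric])
      ultimately have "(\<lambda>n. norm (F (x + h n *\<^sub>R axis i 1) - F x - h n *\<^sub>R (gradient F x $ i)) / norm (h n)) \<longlonglongrightarrow> 0"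
        by (rule filterlim_compose)
      moreover have "norm (F (x + h n *\<^sub>R axis i 1) - F x - h n *\<^sub>R (gradient F x $ i)) / norm (h n) = norm (s n x - gradient F x $ i)" for n
      proof -
        have "s n x - gradient F x $ i = (F (x + h n *\<^sub>R axis i 1) - F x - h n *\<^sub>R (gradient F x $ i)) /\<^sub>R h n"
          using h[of n] by (simp add: s_def scaleR_diff_right)
        then show ?thesis using h[of n] by (simp add: divide_inverse_commute)
      qed
      ultimately have "(\<lambda>n. norm (s n x - gradient F x $ i)) \<longlonglongrightarrow> 0" by simp
      then show ?thesis by (simp add: tendsto_norm_zero_iff LIM_zero_iff)
    qed
    then show "AE x in lborel. (\<lambda>n. s n x) \<longlonglongrightarrow> gradient F x $ i" by simp
  qed (auto simp: s_def[abs_def] intro: borel_measurable_continuous_onI)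
  ultimately show ?thesis by (simp add: LIMSEQ_const_iff)
qed

section \<open>The fundamental lemma of the calculus of variations and uniqueness of weak
  gradients\<close>

subsection \<open>Test functions and weak gradients\<close>

lemma test_functionD:
  assumes "test_function \<Omega> \<phi>"
  obtains K where "smooth \<phi>" "compact K" "K \<subseteq> \<Omega>" "\<And>x. x \<notin> K \<Longrightarrow> \<phi> x = 0" "\<And>x. x \<notin> K \<Longrightarrow> gradient \<phi> x = 0"
proof -
  from assms obtain K where K: "smooth \<phi>" "compact K" "K \<subseteq> \<Omega>" "\<And>x. x \<notin> K \<Longrightarrow> \<phi> x = 0"
    unfolding test_function_def by blast
  show thesis by (rule that[OF K]) (auto intro: gradient_zero_outside[OF compact_imp_closed[OF K(2)] K(4)])
qed

lemma test_function_smooth: "test_function \<Omega> \<phi> \<Longrightarrow> smooth \<phi>"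
  by (simp add: test_function_def)

lemma test_function_mult:
  assumes "test_function \<Omega> \<phi>" "smooth w"
  shows "test_function \<Omega> (\<lambda>x. \<phi> x * w x)"
  using assms unfolding test_function_def by (auto intro!: smooth_mult)

lemma integral_vol_B_eq_lborel:
  fixes f :: "real^3 \<Rightarrow> 'v::euclidean_space"
  assumes "\<And>x. x \<notin> B \<Longrightarrow> f x = 0"
  shows "(\<integral>x. f x \<partial>vol B) = (\<integral>x. f x \<partial>lborel)"
  unfolding integral_vol_B
  by (intro Bochner_Integration.integral_cong refl) (use assms in \<open>auto simp: indicator_def\<close>)

text \<open>The product of w with a test function has compact support, so the integral of its
  partial derivative is zero, whatever w does at the sphere.\<close>

lemma is_weak_gradient_smooth:
  fixes w :: "real^3 \<Rightarrow> 'v::euclidean_space"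
  assumes w: "smooth w"
  shows "is_weak_gradient B w (gradient w)"
  unfolding is_weak_gradient_def
proof (intro conjI allI impI)
  show "L2 (vol B) w" "L2 (vol B) (gradient w)"
    using w by (auto intro!: L2_continuous_B smooth_continuous smooth_gradient_continuous)
  fix \<phi> i assume "test_function B \<phi>"
  then obtain K where K: "smooth \<phi>" "compact K" "K \<subseteq> B" "\<And>x. x \<notin> K \<Longrightarrow> \<phi> x = 0" "\<And>x. x \<notin> K \<Longrightarrow> gradient \<phi> x = 0"
    by (rule test_functionD) blast
  have i: "integrable (vol B) (\<lambda>x. gradient \<phi> x $ i *\<^sub>R w x)" "integrable (vol B) (\<lambda>x. \<phi> x *\<^sub>R (gradient w x $ i))"
    using K(1) w by (auto intro!: L2_bilinear_integrable[OF bounded_bilinear_scaleR] L2_continuous_B smooth_continuous smooth_partial)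
  have "(\<integral>x. \<phi> x *\<^sub>R (gradient w x $ i) + gradient \<phi> x $ i *\<^sub>R w x \<partial>vol B)
      = (\<integral>x. gradient (\<lambda>x. \<phi> x *\<^sub>R w x) x $ i \<partial>lborel)"
    unfolding gradient_scaleR[OF K(1) w]
  proof (rule integral_vol_B_eq_lborel)
    fix x :: "real^3" assume "x \<notin> B"
    then have "x \<notin> K" using K(3) by blast
    then show "\<phi> x *\<^sub>R gradient w x $ i + gradient \<phi> x $ i *\<^sub>R w x = 0" using K(4,5) by simp
  qed
  also have "\<dots> = 0"
    by (rule integral_partial_eq_0[OF smooth_scaleR[OF K(1) w] K(2)]) (use K in auto)
  finally show "(\<integral>x. gradient \<phi> x $ i *\<^sub>R w x \<partial>vol B) = - (\<integral>x. \<phi> x *\<^sub>R (gradient w x $ i) \<partial>vol B)"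
    using i by (simp add: eq_neg_iff_add_eq_0 add.commute)
qed

text \<open>The squared norm keeps the function smooth at the origin. For n > 0 it is 0 where 1 -
  |x|^2 \<le> 1/n and 1 where 1 - |x|^2 \<ge> 2/n, so inside the ball its gradient lives in a shell
  of width 2/n.\<close>

definition cutoff :: "real \<Rightarrow> real^3 \<Rightarrow> real" where
  "cutoff n x = step (n * (1 - (norm x)\<^sup>2) - 1)"

lemma smooth_cutoff_argument: "smooth (\<lambda>x::real^'n. n * (1 - (norm x)\<^sup>2) - 1)"
  by (intro smooth_diff smooth_mult smooth_const smooth_power2_norm)

lemma smooth_cutoff: "smooth (cutoff n)"
  unfolding cutoff_def[abs_def] by (intro smooth_step smooth_cutoff_argument)

lemma cutoff_bounds: "0 \<le> cutoff n x" "cutoff n x \<le> 1"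
  by (simp_all add: cutoff_def step_nonneg step_le_1)

lemma test_function_cutoff:
  assumes n: "0 < n"
  shows "test_function B (cutoff n)"
  unfolding test_function_def
proof (intro conjI exI allI impI)
  let ?K = "{x::real^3. (norm x)\<^sup>2 \<le> 1 - 1 / n}"
  have sub: "?K \<subseteq> B"
  proof
    fix x :: "real^3" assume "x \<in> ?K"
    then have "(norm x)\<^sup>2 \<le> 1 - 1 / n" by simp
    also have "\<dots> < 1" using n by simp
    finally show "x \<in> B" using abs_square_less_1[of "norm x"] by simp
  qed
  have "closed ?K" by (intro closed_Collect_le continuous_intros)
  moreover have "bounded ?K" using sub bounded_subset bounded_ball by blast
  ultimately show "compact ?K" by (simp add: compact_eq_bounded_closed)
  show "?K \<subseteq> B" by (rule sub)
  fix x :: "real^3" assume "x \<notin> ?K"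
  then have "1 - (norm x)\<^sup>2 \<le> 1 / n" by simp
  then have "n * (1 - (norm x)\<^sup>2) \<le> 1" using n by (simp add: field_simps)
  then show "cutoff n x = 0" by (simp add: cutoff_def step_le_0)
qed (rule smooth_cutoff)

lemma cutoff_eventually_1:
  assumes "norm x < 1" shows "\<forall>\<^sub>F n in sequentially. cutoff (real (Suc n)) x = 1"
proof -
  have "0 < 1 - (norm x)\<^sup>2" using assms abs_square_less_1[of "norm x"] by simp
  then obtain N where N: "2 < real N * (1 - (norm x)\<^sup>2)" using reals_Archimedean3[OF \<open>0 < 1 - (norm x)\<^sup>2\<close>] by blast
  have "cutoff (real (Suc n)) x = 1" if "n \<ge> N" for n
  proof -
    have "real N * (1 - (norm x)\<^sup>2) \<le> real (Suc n) * (1 - (norm x)\<^sup>2)"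
      using that \<open>0 < 1 - (norm x)\<^sup>2\<close> by (intro mult_right_mono) auto
    with N show ?thesis unfolding cutoff_def by (intro step_ge_1) linarith
  qed
  then show ?thesis by (auto simp: eventually_sequentially)
qed

text \<open>Multiplication by the cutoffs turns each \<open>g n\<close> into a test function, and
  the products stay dominated by |f|. Thus bounded pointwise limits of smooth functions, without any
  support condition, may replace test functions.\<close>

lemma integral_limit_test_functions:
  fixes f :: "real^3 \<Rightarrow> 'v::euclidean_space"
  assumes f: "L2 (vol B) f" "\<And>\<phi>. test_function B \<phi> \<Longrightarrow> (\<integral>x. \<phi> x *\<^sub>R f x \<partial>vol B) = 0"
    and g: "\<And>n. smooth (g n)" "\<And>n x. \<bar>g n x\<bar> \<le> 1" "\<And>x. x \<in> B \<Longrightarrow> (\<lambda>n. g n x) \<longlonglongrightarrow> h x"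
      "h \<in> borel_measurable borel"
  shows "(\<integral>x. h x *\<^sub>R f x \<partial>vol B) = 0"
proof -
  have [measurable]: "f \<in> borel_measurable (vol B)" using f(1) by (rule L2_measurable)
  have gm[measurable]: "(\<lambda>x. cutoff (real (Suc n)) x * g n x) \<in> borel_measurable (vol B)" for n
    by (intro borel_imp_vol borel_measurable_continuous_onI smooth_continuous smooth_mult smooth_cutoff g)
  have hm[measurable]: "h \<in> borel_measurable (vol B)" by (intro borel_imp_vol g)
  have "(\<integral>x. (cutoff (real (Suc n)) x * g n x) *\<^sub>R f x \<partial>vol B) = 0" for n
    by (intro f(2) test_function_mult test_function_cutoff g) simp
  moreover have "(\<lambda>n. \<integral>x. (cutoff (real (Suc n)) x * g n x) *\<^sub>R f x \<partial>vol B) \<longlonglongrightarrow> (\<integral>x. h x *\<^sub>R f x \<partial>vol B)"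
  proof (rule integral_dominated_convergence[where w="\<lambda>x. norm (f x)"])
    show "integrable (vol B) (\<lambda>x. norm (f x))"
      by (intro integrable_norm L2_integrable_finite finite_measure_vol_B f)
    have "\<bar>cutoff (real (Suc n)) x * g n x\<bar> \<le> 1" for n x
    proof -
      have "\<bar>cutoff (real (Suc n)) x\<bar> * \<bar>g n x\<bar> \<le> 1 * 1"
        by (intro mult_mono g(2)) (simp_all add: cutoff_bounds)
      then show ?thesis by (simp add: abs_mult)
    qed
    then show "AE x in vol B. norm ((cutoff (real (Suc n)) x * g n x) *\<^sub>R f x) \<le> norm (f x)" for n
      by (auto intro!: AE_I2 mult_left_le_one_le simp del: abs_mult)
    show "AE x in vol B. (\<lambda>n. (cutoff (real (Suc n)) x * g n x) *\<^sub>R f x) \<longlonglongrightarrow> h x *\<^sub>R f x"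
    proof (rule AE_I2)
      fix x assume "x \<in> space (vol B)"
      then have x: "x \<in> B" by simp
      have "(\<lambda>n. cutoff (real (Suc n)) x) \<longlonglongrightarrow> 1"
        by (rule tendsto_eventually, rule cutoff_eventually_1) (use x in simp)
      from tendsto_scaleR[OF tendsto_mult[OF this g(3)[OF x]] tendsto_const]
      show "(\<lambda>n. (cutoff (real (Suc n)) x * g n x) *\<^sub>R f x) \<longlonglongrightarrow> h x *\<^sub>R f x" by simp
    qed
  qed measurable
  ultimately show ?thesis by (simp add: LIMSEQ_const_iff)
qed

lemma step_limit: "(\<lambda>n. step (real n * t)) \<longlonglongrightarrow> (if 0 < t then 1 else 0)"
proof (cases "0 < t")
  case True
  then obtain N where N: "1 < real N * t" using reals_Archimedean3[OF True] by blast
  have "step (real n * t) = 1" if "n \<ge> N" for n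
  proof -
    have "real N * t \<le> real n * t" using that True by (intro mult_right_mono) auto
    with N show ?thesis by (intro step_ge_1) linarith
  qed
  then have "\<forall>\<^sub>F n in sequentially. step (real n * t) = 1" unfolding eventually_sequentially by blast
  then show ?thesis using True by (simp add: tendsto_eventually)
qed (auto intro!: tendsto_eventually always_eventually step_le_0 simp: mult_nonneg_nonpos)

text \<open>Indicators of open boxes are pointwise limits of smooth functions, and the sets over
  which f integrates to 0 form a Dynkin system; hence f integrates to 0 over every Borel
  set.\<close>

lemma test_functions_separate:
  fixes f :: "real^3 \<Rightarrow> 'v::euclidean_space"
  assumes f: "L2 (vol B) f" "\<And>\<phi>. test_function B \<phi> \<Longrightarrow> (\<integral>x. \<phi> x *\<^sub>R f x \<partial>vol B) = 0"
  shows "AE x in vol B. f x = 0"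
proof -
  interpret finite_measure "vol B" by (rule finite_measure_vol_B)
  have fin: "integrable (vol B) f" by (intro L2_integrable_finite finite_measure_vol_B f)
  \<comment> \<open>Needed for complements in the Dynkin argument.\<close>
  have whole: "(\<integral>x. f x \<partial>vol B) = 0"
    using integral_limit_test_functions[OF f, of "\<lambda>_ _. 1" "\<lambda>_. 1"] by (simp add: smooth_const)
  have box: "(\<integral>x. indicator (box a b) x *\<^sub>R f x \<partial>vol B) = 0" for a b
  proof (rule integral_limit_test_functions[OF f])
    \<comment> \<open>In each coordinate a product of two steepening steps, tending to the indicator
      of an open interval.\<close>
    let ?g = "\<lambda>n x. \<Prod>i\<in>UNIV. step (real n * (x $ i - a $ i)) * step (real n * (b $ i - x $ i))"
    show "smooth (?g n)" for n
      by (intro smooth_prod smooth_mult smooth_step smooth_diff smooth_const smooth_nth)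
    have "0 \<le> ?g n x" "?g n x \<le> 1" for n x
      by (auto intro!: prod_nonneg prod_le_1 mult_le_one simp: step_nonneg step_le_1)
    then show "\<bar>?g n x\<bar> \<le> 1" for n x by (simp only: abs_of_nonneg)
    show "(\<lambda>n. ?g n x) \<longlonglongrightarrow> indicator (box a b) x" for x
    proof -
      have "(\<lambda>n. ?g n x) \<longlonglongrightarrow> (\<Prod>i\<in>UNIV. (if 0 < x $ i - a $ i then 1 else 0) * (if 0 < b $ i - x $ i then 1 else 0))"
        by (intro tendsto_prod tendsto_mult step_limit)
      also have "(\<Prod>i\<in>UNIV. (if 0 < x $ i - a $ i then 1 else 0) * (if 0 < b $ i - x $ i then 1 else 0)) = (indicator (box a b) x :: real)"
        by (auto simp: indicator_def mem_box_cart intro!: prod.neutral)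
      finally show ?thesis .
    qed
  qed auto
  have fA: "integrable (vol B) (\<lambda>x. indicator A x *\<^sub>R f x)" if "A \<in> sets borel" for A
  proof -
    have "(\<lambda>x. indicator A x *\<^sub>R f x) \<in> borel_measurable (vol B)"
      using that by (intro borel_measurable_scaleR L2_measurable[OF f(1)] borel_imp_vol) simp
    with fin show ?thesis
      by (rule Bochner_Integration.integrable_bound) (auto simp: indicator_def)
  qed
  let ?G = "range (\<lambda>(a, b). box a b :: (real^3) set)"
  have sb: "sets borel = sigma_sets UNIV ?G" by (subst borel_eq_box) simp
  have all: "(\<integral>x. indicator A x *\<^sub>R f x \<partial>vol B) = 0" if "A \<in> sigma_sets UNIV ?G" for A
  proof (rule sigma_sets_induct_disjoint[OF _ _ that])
    show "Int_stable ?G" by (auto simp: Int_stable_def box_Int_box)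
    show "(\<integral>x. indicator A x *\<^sub>R f x \<partial>vol B) = 0" if "A \<in> ?G" for A using that box by auto
    show "(\<integral>x. indicator (UNIV - A) x *\<^sub>R f x \<partial>vol B) = 0"
      if "A \<in> sigma_sets UNIV ?G" "(\<integral>x. indicator A x *\<^sub>R f x \<partial>vol B) = 0" for A
    proof -
      have "(\<integral>x. indicator (UNIV - A) x *\<^sub>R f x \<partial>vol B) = (\<integral>x. f x - indicator A x *\<^sub>R f x \<partial>vol B)"
        by (intro Bochner_Integration.integral_cong) (auto simp: indicator_def)
      then show ?thesis using that fin fA[of A] whole sb by simp
    qed
    show "(\<integral>x. indicator (\<Union>i. A i) x *\<^sub>R f x \<partial>vol B) = 0"
      if A: "disjoint_family A" "range A \<subseteq> sigma_sets UNIV ?G" "\<And>i. (\<integral>x. indicator (A i) x *\<^sub>R f x \<partial>vol B) = 0"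
      for A :: "nat \<Rightarrow> (real^3) set"
    proof -
      have Ai: "A i \<in> sets borel" for i using A(2) sb by auto
      have "set_lebesgue_integral (vol B) (\<Union>i. A i \<inter> B) f = (\<Sum>i. set_lebesgue_integral (vol B) (A i \<inter> B) f)"
      proof (rule lebesgue_integral_countable_add)
        show "A i \<inter> B \<in> sets (vol B)" for i using Ai by (simp add: sets_restrict_space_iff)
        show "A i \<inter> B \<inter> (A j \<inter> B) = {}" if "i \<noteq> j" for i j
          using A(1) that by (auto simp: disjoint_family_on_def)
        have "integrable (vol B) (\<lambda>x. indicator (\<Union>i. A i) x *\<^sub>R f x)" by (rule fA) (use Ai in auto)
        then show "set_integrable (vol B) (\<Union>i. A i \<inter> B) f"
          unfolding set_integrable_def
          by (rule Bochner_Integration.integrable_cong[THEN iffD1, rotated 2]) (auto simp: indicator_def)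
      qed
      moreover have "set_lebesgue_integral (vol B) (C \<inter> B) f = (\<integral>x. indicator C x *\<^sub>R f x \<partial>vol B)" for C
        unfolding set_lebesgue_integral_def
        by (rule Bochner_Integration.integral_cong) (auto simp: indicator_def)
      ultimately show ?thesis using A(3) by (simp flip: UN_extend_simps(4))
    qed
  qed auto
  have "set_lebesgue_integral (vol B) A f = 0" if "A \<in> sets (vol B)" for A
  proof -
    have "A \<in> sets borel" using that by (simp add: sets_restrict_space_iff)
    then have "A \<in> sigma_sets UNIV ?G" by (simp only: sb)
    then show ?thesis unfolding set_lebesgue_integral_def by (rule all)
  qed
  with fin show ?thesis by (rule density_zero)
qed

lemma weak_gradient_unique:
  fixes u :: "real^3 \<Rightarrow> 'v::euclidean_space"
  assumes "is_weak_gradient B u G" "is_weak_gradient B u H"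
  shows "AE x in vol B. G x = H x"
proof -
  have L: "L2 (vol B) (\<lambda>x. G x $ i)" "L2 (vol B) (\<lambda>x. H x $ i)" for i
    using assms by (auto simp: is_weak_gradient_def intro: L2_nth)
  have "AE x in vol B. G x $ i - H x $ i = 0" for i
  proof (rule test_functions_separate)
    fix \<phi> assume \<phi>: "test_function B \<phi>"
    then have "L2 (vol B) \<phi>" by (intro L2_continuous_B smooth_continuous test_function_smooth)
    then have "(\<integral>x. \<phi> x *\<^sub>R (G x $ i - H x $ i) \<partial>vol B)
      = (\<integral>x. \<phi> x *\<^sub>R (G x $ i) \<partial>vol B) - (\<integral>x. \<phi> x *\<^sub>R (H x $ i) \<partial>vol B)"
      using L by (simp add: scaleR_diff_right L2_bilinear_integrable[OF bounded_bilinear_scaleR])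
    also have "\<dots> = 0" using assms[unfolded is_weak_gradient_def, THEN conjunct2, THEN conjunct2, rule_format, OF \<phi>, of i]
      by simp
    finally show "(\<integral>x. \<phi> x *\<^sub>R (G x $ i - H x $ i) \<partial>vol B) = 0" .
  qed (intro L2_diff L)
  then have "AE x in vol B. \<forall>i\<in>UNIV. G x $ i - H x $ i = 0" by (intro AE_finite_allI) auto
  then show ?thesis by eventually_elim (simp add: vec_eq_iff)
qed

lemma is_weak_gradient_weak_gradient:
  "u \<in> H1 \<Omega> \<Longrightarrow> is_weak_gradient \<Omega> u (weak_gradient \<Omega> u)"
  unfolding H1_def weak_gradient_def by (auto intro: someI[of "is_weak_gradient \<Omega> u"])

lemma weak_gradient_AE:
  fixes u :: "real^3 \<Rightarrow> 'v::euclidean_space"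
  assumes "is_weak_gradient B u G"
  shows "AE x in vol B. weak_gradient B u x = G x"
proof -
  have "u \<in> H1 B" using assms by (auto simp: H1_def)
  from weak_gradient_unique[OF is_weak_gradient_weak_gradient[OF this] assms] show ?thesis .
qed

section \<open>A trace inequality in thin shells\<close>

subsection \<open>Estimates near the sphere\<close>

lemma nn_integral_dilate:
  fixes f :: "real^3 \<Rightarrow> ennreal"
  assumes c: "0 < c" and [measurable]: "f \<in> borel_measurable borel"
  shows "(\<integral>\<^sup>+x. f x \<partial>lborel) = ennreal (c ^ 3) * (\<integral>\<^sup>+x. f (c *\<^sub>R x) \<partial>lborel)"
proof -
  have "(\<integral>\<^sup>+x. f x \<partial>lborel) = (\<integral>\<^sup>+x. f x \<partial>density (distr lborel borel (\<lambda>x. 0 + c *\<^sub>R x)) (\<lambda>_. ennreal (\<bar>c\<bar>^DIM(real^3))))"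
    using c by (subst lborel_affine[of c 0]) auto
  also have "\<dots> = ennreal (c ^ 3) * (\<integral>\<^sup>+x. f (c *\<^sub>R x) \<partial>lborel)"
    using c by (simp add: nn_integral_density nn_integral_distr nn_integral_cmult)
  finally show ?thesis .
qed

lemma integral_dilate:
  fixes f :: "real^3 \<Rightarrow> 'v::euclidean_space"
  assumes c: "0 < c" and [measurable]: "f \<in> borel_measurable borel"
  shows "(\<integral>x. f x \<partial>lborel) = c ^ 3 *\<^sub>R (\<integral>x. f (c *\<^sub>R x) \<partial>lborel)"
proof -
  have "(\<integral>x. f x \<partial>lborel) = (\<integral>x. f x \<partial>density (distr lborel borel (\<lambda>x. 0 + c *\<^sub>R x)) (\<lambda>_. \<bar>c\<bar>^DIM(real^3)))"
    using c by (subst lborel_affine[of c 0]) auto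
  also have "\<dots> = c ^ 3 *\<^sub>R (\<integral>x. f (c *\<^sub>R x) \<partial>lborel)"
    using c by (subst integral_density) (simp_all add: integral_distr)
  finally show ?thesis .
qed

lemma nn_integral_vol_B:
  "(\<integral>\<^sup>+x. f x \<partial>vol B) = (\<integral>\<^sup>+x. f x * indicator B x \<partial>lborel)"
  by (rule nn_integral_restrict_space) simp

text \<open>Cauchy-Schwarz against the constant 1. The form in extended nonnegative reals can be
  integrated over a parameter and the integrals exchanged on measurability alone.\<close>

lemma norm_integral_interval_power2_le:
  fixes D :: "real \<Rightarrow> 'v::euclidean_space"
  assumes ab: "a \<le> b" and D: "continuous_on {a..b} D"
  shows "ennreal ((norm (\<integral>s. indicator {a..b} s *\<^sub>R D s \<partial>lborel))\<^sup>2)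
    \<le> ennreal (b - a) * (\<integral>\<^sup>+s. ennreal ((norm (D s))\<^sup>2) * indicator {a..b} s \<partial>lborel)"
proof -
  let ?M = "restrict_space lborel {a..b}"
  have emb: "emeasure ?M {a..b} = ennreal (b - a)" using ab by (simp add: emeasure_restrict_space)
  have fin: "finite_measure ?M"
    by (rule finite_measureI) (simp add: emb space_restrict_space)
  obtain C where C: "0 \<le> C" "\<And>s. s \<in> {a..b} \<Longrightarrow> norm (D s) \<le> C"
    using continuous_on_compact_bounded[OF compact_Icc D] by blast
  have Dm: "D \<in> borel_measurable ?M"
    using borel_measurable_continuous_on_restrict[OF D]
    by (simp add: measurable_restrict_space_iff cong: measurable_cong_sets)
  have L: "L2 ?M D"
    by (rule L2_bound[OF Dm finite_measure.integrable_const[OF fin, of "C\<^sup>2"]])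
      (use C in \<open>auto simp: space_restrict_space intro!: power_mono\<close>)
  have L1: "L2 ?M (\<lambda>_. 1::real)" using finite_measure.integrable_const[OF fin, of 1] by (simp add: L2_def)
  have m: "measure ?M {a..b} = b - a" using emb ab by (simp add: measure_def)
  have "norm (\<integral>s. indicator {a..b} s *\<^sub>R D s \<partial>lborel) = norm (\<integral>s. D s \<partial>?M)"
    by (subst integral_restrict_space) auto
  also have "\<dots> \<le> (\<integral>s. norm (D s) * norm (1::real) \<partial>?M)" by simp
  also have "\<dots> \<le> sqrt (\<integral>s. (norm (D s))\<^sup>2 \<partial>?M) * sqrt (\<integral>s. (norm (1::real))\<^sup>2 \<partial>?M)"
    by (rule Cauchy_Schwarz_L2[OF L L1])
  also have "(\<integral>s. (norm (1::real))\<^sup>2 \<partial>?M) = b - a"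
    using m by (simp add: space_restrict_space)
  finally have "(norm (\<integral>s. indicator {a..b} s *\<^sub>R D s \<partial>lborel))\<^sup>2 \<le> (sqrt (\<integral>s. (norm (D s))\<^sup>2 \<partial>?M) * sqrt (b - a))\<^sup>2"
    by (rule power_mono) simp
  also have "\<dots> = (b - a) * (\<integral>s. (norm (D s))\<^sup>2 \<partial>?M)"
    using ab by (simp add: power_mult_distrib)
  finally have "ennreal ((norm (\<integral>s. indicator {a..b} s *\<^sub>R D s \<partial>lborel))\<^sup>2) \<le> ennreal ((b - a) * (\<integral>s. (norm (D s))\<^sup>2 \<partial>?M))"
    by (rule ennreal_leI)
  also have "\<dots> = ennreal (b - a) * ennreal (\<integral>s. (norm (D s))\<^sup>2 \<partial>?M)" using ab by (simp add: ennreal_mult)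
  also have "ennreal (\<integral>s. (norm (D s))\<^sup>2 \<partial>?M) = (\<integral>\<^sup>+s. ennreal ((norm (D s))\<^sup>2) \<partial>?M)"
    by (rule nn_integral_eq_integral[symmetric]) (use L in \<open>auto simp: L2_def\<close>)
  also have "\<dots> = (\<integral>\<^sup>+s. ennreal ((norm (D s))\<^sup>2) * indicator {a..b} s \<partial>lborel)"
    by (subst nn_integral_restrict_space) auto
  finally show ?thesis .
qed

lemma norm_power2_vec: "(norm (v :: 'a::real_normed_vector ^ 'n))\<^sup>2 = (\<Sum>i\<in>UNIV. (norm (v $ i))\<^sup>2)"
  by (simp add: norm_vec_def L2_set_def sum_nonneg)

lemma norm_sum_scaleR_le:
  "norm (\<Sum>i\<in>UNIV. x $ i *\<^sub>R (v $ i)) \<le> norm (x :: real^'n) * norm (v :: 'a::real_normed_vector ^ 'n)"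
proof -
  have "norm (\<Sum>i\<in>UNIV. x $ i *\<^sub>R (v $ i)) \<le> (\<Sum>i\<in>UNIV. \<bar>x $ i\<bar> * \<bar>norm (v $ i)\<bar>)"
    by (rule order_trans[OF norm_sum]) simp
  also have "\<dots> \<le> L2_set (\<lambda>i. x $ i) UNIV * L2_set (\<lambda>i. norm (v $ i)) UNIV"
    by (rule L2_set_mult_ineq)
  finally show ?thesis by (simp add: norm_vec_def L2_set_def)
qed

lemma radial_derivative:
  assumes "smooth w"
  shows "((\<lambda>s. w (s *\<^sub>R x)) has_vector_derivative (\<Sum>i\<in>UNIV. x $ i *\<^sub>R (gradient w (s *\<^sub>R x) $ i))) (at s within T)"
proof -
  have "((\<lambda>s. w (s *\<^sub>R x)) has_derivative (\<lambda>h. \<Sum>i\<in>UNIV. (h *\<^sub>R x) $ i *\<^sub>R (gradient w (s *\<^sub>R x) $ i))) (at s within T)"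
    by (rule has_derivative_compose[where f="\<lambda>s. s *\<^sub>R x" and g=w, OF _ smooth_has_derivative[OF assms]])
      (auto intro!: derivative_eq_intros)
  then show ?thesis by (simp add: has_vector_derivative_def scaleR_sum_right)
qed

lemma continuous_on_radial:
  fixes f :: "'a::real_normed_vector \<Rightarrow> 'b::topological_space"
  assumes "continuous_on UNIV f" shows "continuous_on T (\<lambda>s::real. f (s *\<^sub>R x))"
  by (rule continuous_on_compose2[OF assms]) (auto intro!: continuous_intros)

text \<open>The value at x differs from the value at its radial projection by the integral of the
  radial derivative along the segment from x to the sphere.\<close>

lemma pointwise_shell_estimate:
  fixes w :: "real^3 \<Rightarrow> 'v::euclidean_space"
  assumes w: "smooth w" and x: "1 - \<delta> \<le> norm x" "norm x < 1" "x \<noteq> 0"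
  shows "ennreal ((norm (w x))\<^sup>2) \<le> 2 * ennreal ((norm (w (x /\<^sub>R norm x)))\<^sup>2)
    + ennreal (2 * \<delta>) * (\<integral>\<^sup>+s. ennreal ((norm (gradient w (s *\<^sub>R x)))\<^sup>2) * indicator {1..<1 / norm x} s \<partial>lborel)"
proof -
  let ?R = "1 / norm x"
  have R: "1 \<le> ?R" "0 < norm x" using x by simp_all
  let ?D = "\<lambda>s. \<Sum>i\<in>UNIV. x $ i *\<^sub>R (gradient w (s *\<^sub>R x) $ i)"
  let ?I = "\<integral>s. indicator {1..?R} s *\<^sub>R ?D s \<partial>lborel"
  have gc: "continuous_on UNIV (gradient w)" by (rule smooth_gradient_continuous[OF w])
  have gm[measurable]: "gradient w \<in> borel_measurable borel" by (rule borel_measurable_continuous_onI[OF gc])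
  have c: "continuous_on {1..?R} ?D"
    by (intro continuous_intros continuous_on_radial[of "\<lambda>x. gradient w x $ _"] smooth_continuous smooth_partial w)
  have "?I = w (?R *\<^sub>R x) - w (1 *\<^sub>R x)"
    by (rule integral_FTC_Icc[OF R(1) radial_derivative[OF w] c])
  then have wx: "w x = w (x /\<^sub>R norm x) + - ?I" by (simp add: divide_inverse)
  let ?n = "\<lambda>s. ennreal ((norm (gradient w (s *\<^sub>R x)))\<^sup>2)"
  have "ennreal ((norm ?I)\<^sup>2) \<le> ennreal (?R - 1) * (\<integral>\<^sup>+s. ennreal ((norm (?D s))\<^sup>2) * indicator {1..?R} s \<partial>lborel)"
    by (rule norm_integral_interval_power2_le[OF R(1) c])
  also have "\<dots> \<le> ennreal (?R - 1) * (\<integral>\<^sup>+s. ennreal ((norm x)\<^sup>2) * (?n s * indicator {1..?R} s) \<partial>lborel)"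
  proof (intro mult_left_mono nn_integral_mono)
    fix s
    have "(norm (?D s))\<^sup>2 \<le> (norm x * norm (gradient w (s *\<^sub>R x)))\<^sup>2"
      by (intro power_mono norm_sum_scaleR_le) simp
    then have "ennreal ((norm (?D s))\<^sup>2) \<le> ennreal ((norm x)\<^sup>2) * ?n s"
      by (simp add: power_mult_distrib flip: ennreal_mult)
    then show "ennreal ((norm (?D s))\<^sup>2) * indicator {1..?R} s \<le> ennreal ((norm x)\<^sup>2) * (?n s * indicator {1..?R} s)"
      unfolding mult.assoc[symmetric] by (rule mult_right_mono) simp
  qed simp
  also have "\<dots> = ennreal (?R - 1) * (ennreal ((norm x)\<^sup>2) * (\<integral>\<^sup>+s. ?n s * indicator {1..?R} s \<partial>lborel))"
    by (subst nn_integral_cmult) (use gm in simp_all)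
  also have "\<dots> = ennreal ((?R - 1) * (norm x)\<^sup>2) * (\<integral>\<^sup>+s. ?n s * indicator {1..?R} s \<partial>lborel)"
    using R by (subst ennreal_mult) (auto simp: mult.assoc)
  \<comment> \<open>The length of the parameter interval times |x|^2 is (1 - |x|) |x|, which is at
    most the width of the shell.\<close>
  also have "\<dots> \<le> ennreal \<delta> * (\<integral>\<^sup>+s. ?n s * indicator {1..?R} s \<partial>lborel)"
  proof (intro mult_right_mono ennreal_leI)
    have "(?R - 1) * (norm x)\<^sup>2 = (1 - norm x) * norm x" using R by (simp add: field_simps power2_eq_square)
    also have "\<dots> \<le> \<delta> * 1" using x by (intro mult_mono) auto
    finally show "(?R - 1) * (norm x)\<^sup>2 \<le> \<delta>" by simp
  qed simp
  \<comment> \<open>Dropping the end point keeps s x inside the open ball, where the gradient energy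
    is measured.\<close>
  also have "(\<integral>\<^sup>+s. ?n s * indicator {1..?R} s \<partial>lborel) = (\<integral>\<^sup>+s. ?n s * indicator {1..<?R} s \<partial>lborel)"
  proof (rule nn_integral_cong_AE)
    show "AE s in lborel. ?n s * indicator {1..?R} s = ?n s * indicator {1..<?R} s"
      using AE_lborel_singleton[of ?R] by eventually_elim (auto simp: indicator_def)
  qed
  finally have I: "ennreal ((norm ?I)\<^sup>2) \<le> ennreal \<delta> * (\<integral>\<^sup>+s. ?n s * indicator {1..<?R} s \<partial>lborel)" .
  have "ennreal ((norm (w x))\<^sup>2) \<le> ennreal (2 * (norm (w (x /\<^sub>R norm x)))\<^sup>2 + 2 * (norm (- ?I))\<^sup>2)"
    unfolding wx by (intro ennreal_leI norm_add_power2_le)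
  also have "\<dots> = 2 * ennreal ((norm (w (x /\<^sub>R norm x)))\<^sup>2) + 2 * ennreal ((norm ?I)\<^sup>2)"
    by (simp add: ennreal_mult)
  also have "\<dots> \<le> 2 * ennreal ((norm (w (x /\<^sub>R norm x)))\<^sup>2) + 2 * (ennreal \<delta> * (\<integral>\<^sup>+s. ?n s * indicator {1..<?R} s \<partial>lborel))"
    by (intro add_left_mono mult_left_mono I) simp
  also have "2 * (ennreal \<delta> * (\<integral>\<^sup>+s. ?n s * indicator {1..<?R} s \<partial>lborel)) = ennreal (2 * \<delta>) * (\<integral>\<^sup>+s. ?n s * indicator {1..<?R} s \<partial>lborel)"
    using x by (subst ennreal_mult) (auto simp: mult.assoc)
  finally show ?thesis .
qed

abbreviation shell :: "real \<Rightarrow> (real^3) set" where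
  "shell \<delta> \<equiv> {x. 1 - \<delta> \<le> norm x \<and> norm x < 1}"

text \<open>A function of x / |x| alone scales like volume: the ball of radius r = 1 - \<delta>
  carries the share r^3 of its integral. The shell keeps 1 - r^3 \<le> 3 \<delta>, and the 3 is
  absorbed by the factor in the cone measure.\<close>

lemma nn_integral_shell_projection:
  fixes h :: "real^3 \<Rightarrow> ennreal"
  assumes [measurable]: "h \<in> borel_measurable borel" and fin: "(\<integral>\<^sup>+x. h x \<partial>sphere_measure) < \<infinity>"
    and d: "0 < \<delta>" "\<delta> \<le> 1"
  shows "(\<integral>\<^sup>+x. h (x /\<^sub>R norm x) * indicator (shell \<delta>) x \<partial>lborel) \<le> ennreal \<delta> * (\<integral>\<^sup>+x. h x \<partial>sphere_measure)"
proof -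
  define r where "r = 1 - \<delta>"
  have r: "0 \<le> r" "r < 1" using d by (auto simp: r_def)
  define A where "A = (\<integral>\<^sup>+x. h (x /\<^sub>R norm x) * indicator B x \<partial>lborel)"
  have S: "(\<integral>\<^sup>+x. h x \<partial>sphere_measure) = 3 * A" by (simp add: nn_integral_sphere nn_integral_vol_B A_def)
  then have Afin: "A < \<infinity>" using fin by (auto simp: ennreal_mult_less_top less_top)
  have "(\<integral>\<^sup>+x. h (x /\<^sub>R norm x) * indicator (ball 0 r) x \<partial>lborel) = ennreal (r^3) * A"
  proof (cases "r = 0")
    case False
    then have r0: "0 < r" using r by simp
    have "(\<integral>\<^sup>+x. h (x /\<^sub>R norm x) * indicator (ball 0 r) x \<partial>lborel)
      = ennreal (r^3) * (\<integral>\<^sup>+x. h ((r *\<^sub>R x) /\<^sub>R norm (r *\<^sub>R x)) * indicator (ball 0 r) (r *\<^sub>R x) \<partial>lborel)"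
    proof (rule nn_integral_dilate[OF r0])
      have [measurable]: "ball 0 r \<in> sets (borel :: (real^3) measure)" by simp
      show "(\<lambda>x. h (x /\<^sub>R norm x) * indicator (ball 0 r) x) \<in> borel_measurable borel" by measurable
    qed
    also have "(\<integral>\<^sup>+x. h ((r *\<^sub>R x) /\<^sub>R norm (r *\<^sub>R x)) * indicator (ball 0 r) (r *\<^sub>R x) \<partial>lborel) = A"
    proof -
      have "(r *\<^sub>R x) /\<^sub>R norm (r *\<^sub>R x) = x /\<^sub>R norm x" for x :: "real^3"
      proof -
        have "inverse (norm (r *\<^sub>R x)) * r = inverse (norm x)" using r0 by (simp add: field_simps)
        then show ?thesis by (simp only: scaleR_scaleR)
      qed
      moreover have "indicator (ball 0 r) (r *\<^sub>R x) = (indicator B x :: ennreal)" for x :: "real^3"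
        using r0 by (simp add: indicator_def)
      ultimately show ?thesis by (simp only: A_def)
    qed
    finally show ?thesis .
  qed simp
  moreover have A1: "A = (\<integral>\<^sup>+x. h (x /\<^sub>R norm x) * indicator (ball 0 r) x \<partial>lborel) +
      (\<integral>\<^sup>+x. h (x /\<^sub>R norm x) * indicator (shell \<delta>) x \<partial>lborel)"
    unfolding A_def using r
    by (subst nn_integral_add[symmetric]) (auto intro!: nn_integral_cong simp: indicator_def r_def)
  moreover have A2: "A = ennreal (r^3) * A + ennreal (1 - r^3) * A"
    using r by (simp flip: distrib_right ennreal_plus add: power_le_one)
  ultimately have "ennreal (r^3) * A + (\<integral>\<^sup>+x. h (x /\<^sub>R norm x) * indicator (shell \<delta>) x \<partial>lborel)
      = ennreal (r^3) * A + ennreal (1 - r^3) * A" by argo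
  \<comment> \<open>Finiteness of the spherical integral permits cancelling the contribution of the
    inner ball.\<close>
  moreover have "ennreal (r^3) * A \<noteq> \<infinity>" using Afin by (auto simp: ennreal_mult_eq_top_iff)
  ultimately have "(\<integral>\<^sup>+x. h (x /\<^sub>R norm x) * indicator (shell \<delta>) x \<partial>lborel) = ennreal (1 - r^3) * A"
    unfolding ennreal_add_left_cancel by blast
  also have "\<dots> \<le> ennreal (\<delta> * 3) * A"
  proof (intro mult_right_mono ennreal_leI)
    have "1 - r^3 = \<delta> * (1 + r + r^2)" by (simp add: r_def power2_eq_square power3_eq_cube algebra_simps)
    also have "\<dots> \<le> \<delta> * 3" using r d power_le_one[of r 2] by (intro mult_left_mono) auto
    finally show "1 - r^3 \<le> \<delta> * 3" .
  qed simp
  also have "\<dots> = ennreal \<delta> * (3 * A)" using d by (simp add: ennreal_mult mult.assoc)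
  finally show ?thesis by (simp add: S)
qed

text \<open>For \<delta> \<le> 1/2 the range of s lies in an interval of length 2 \<delta>. For
  larger \<delta>, including \<delta> = 1 where the range is unbounded, the integral of s^(-3) from
  1 to \<infinity> equals 1/2, which is enough.\<close>

lemma nn_integral_cube_decay:
  assumes d: "0 < \<delta>" "\<delta> \<le> 1"
  shows "(\<integral>\<^sup>+s. ennreal (inverse (s ^ 3)) * indicator {s. 1 \<le> s \<and> s * (1 - \<delta>) < 1} s \<partial>lborel) \<le> ennreal (2 * \<delta>)"
proof (cases "\<delta> \<le> 1 / 2")
  case True
  have "(\<integral>\<^sup>+s. ennreal (inverse (s ^ 3)) * indicator {s. 1 \<le> s \<and> s * (1 - \<delta>) < 1} s \<partial>lborel)
     \<le> (\<integral>\<^sup>+s. indicator {1..1 + 2 * \<delta>} s \<partial>lborel)"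
  proof (rule nn_integral_mono)
    fix s :: real
    show "ennreal (inverse (s ^ 3)) * indicator {s. 1 \<le> s \<and> s * (1 - \<delta>) < 1} s \<le> indicator {1..1 + 2 * \<delta>} s"
    proof (cases "1 \<le> s \<and> s * (1 - \<delta>) < 1")
      case s: True
      have "s \<le> 2"
      proof (rule ccontr)
        assume "\<not> s \<le> 2"
        then have "2 * (1 / 2) \<le> s * (1 - \<delta>)" using True by (intro mult_mono) auto
        with s show False by simp
      qed
      then have "s * \<delta> \<le> 2 * \<delta>" using d by (intro mult_right_mono) auto
      then have "s \<le> 1 + 2 * \<delta>" using s by (simp add: algebra_simps)
      moreover have "inverse (s ^ 3) \<le> 1" using s by (simp add: inverse_le_1_iff)
      ultimately show ?thesis using s by simp
    qed simp
  qed
  also have "\<dots> = ennreal (2 * \<delta>)" using d by simp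
  finally show ?thesis .
next
  case False
  have "(\<integral>\<^sup>+s. ennreal (inverse (s ^ 3)) * indicator {s. 1 \<le> s \<and> s * (1 - \<delta>) < 1} s \<partial>lborel)
     \<le> (\<integral>\<^sup>+s. ennreal (inverse (s ^ 3)) * indicator {1..} s \<partial>lborel)"
    by (intro nn_integral_mono mult_left_mono) (auto simp: indicator_def)
  also have "\<dots> = ennreal (0 - (- inverse (2 * 1 ^ 2)))"
  proof (rule nn_integral_FTC_atLeast)
    show "((\<lambda>s. - inverse (2 * s ^ 2)) has_real_derivative inverse (s ^ 3)) (at s)" if "1 \<le> s" for s :: real
      using that by (auto intro!: derivative_eq_intros simp: field_simps power2_eq_square power3_eq_cube)
    have "((\<lambda>s::real. - inverse (2 * s ^ 2)) \<longlongrightarrow> - 0) at_top"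
      by (intro tendsto_minus tendsto_inverse_0_at_top filterlim_tendsto_pos_mult_at_top[OF tendsto_const])
        (auto intro!: filterlim_pow_at_top filterlim_ident)
    then show "((\<lambda>s::real. - inverse (2 * s ^ 2)) \<longlongrightarrow> 0) at_top" by simp
  qed (auto intro!: borel_measurable_continuous_onI)
  also have "\<dots> \<le> ennreal (2 * \<delta>)" using False by (intro ennreal_leI) simp
  finally show ?thesis .
qed

text \<open>The pointwise estimate is integrated over the shell. Exchanging the integrals and
  substituting y = s x gives a factor s^(-3), whose integral contributes a second \<delta>. This
  square at the gradient term is what later compensates cutoff gradients of size 1/\<delta>.\<close>

lemma shell_estimate:
  fixes w :: "real^3 \<Rightarrow> 'v::euclidean_space"
  assumes w: "smooth w" and d: "0 < \<delta>" "\<delta> \<le> 1"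
  shows "(\<integral>\<^sup>+x. ennreal ((norm (w x))\<^sup>2) * indicator (shell \<delta>) x \<partial>lborel)
    \<le> ennreal (2 * \<delta>) * (\<integral>\<^sup>+x. ennreal ((norm (w x))\<^sup>2) \<partial>sphere_measure)
      + ennreal (4 * \<delta>\<^sup>2) * (\<integral>\<^sup>+x. ennreal ((norm (gradient w x))\<^sup>2) * indicator (shell \<delta>) x \<partial>lborel)"
proof -
  have [measurable]: "gradient w \<in> borel_measurable borel" "w \<in> borel_measurable borel"
    by (rule borel_measurable_continuous_onI, rule smooth_gradient_continuous[OF w] smooth_continuous[OF w])+
  let ?g = "\<lambda>x. ennreal ((norm (gradient w x))\<^sup>2)"
  let ?h = "\<lambda>x. ennreal ((norm (w x))\<^sup>2)"
  let ?G = "\<integral>\<^sup>+x. ?g x * indicator (shell \<delta>) x \<partial>lborel"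
  have fin: "(\<integral>\<^sup>+x. ?h x \<partial>sphere_measure) < \<infinity>"
  proof -
    have "integrable sphere_measure (\<lambda>x. (norm (w x))\<^sup>2)"
      by (intro L2_integrable L2_continuous_sphere smooth_continuous w)
    then have "(\<integral>\<^sup>+x. ?h x \<partial>sphere_measure) = ennreal (\<integral>x. (norm (w x))\<^sup>2 \<partial>sphere_measure)"
      by (rule nn_integral_eq_integral) simp
    then show ?thesis by simp
  qed
  \<comment> \<open>The range of s depends on x; written as a joint indicator it can be read for
    fixed s after the exchange.\<close>
  let ?F = "\<lambda>x s. ?g (s *\<^sub>R x) * indicator {(s, x). 1 \<le> s \<and> s * norm x < 1 \<and> 1 - \<delta> \<le> norm x} (s, x)"
  have pw: "?h x * indicator (shell \<delta>) x \<le> 2 * (?h (x /\<^sub>R norm x) * indicator (shell \<delta>) x)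
      + ennreal (2 * \<delta>) * (\<integral>\<^sup>+s. ?F x s \<partial>lborel)" if "x \<noteq> 0" for x
  proof (cases "x \<in> shell \<delta>")
    case True
    have "(\<integral>\<^sup>+s. ?g (s *\<^sub>R x) * indicator {1..<1 / norm x} s \<partial>lborel) = (\<integral>\<^sup>+s. ?F x s \<partial>lborel)"
      by (rule nn_integral_cong) (use True that in \<open>auto simp: indicator_def field_simps\<close>)
    with pointwise_shell_estimate[OF w, of \<delta> x] True that show ?thesis by simp
  qed simp
  have "(\<integral>\<^sup>+x. ?h x * indicator (shell \<delta>) x \<partial>lborel) \<le>
     (\<integral>\<^sup>+x. 2 * (?h (x /\<^sub>R norm x) * indicator (shell \<delta>) x) + ennreal (2 * \<delta>) * (\<integral>\<^sup>+s. ?F x s \<partial>lborel) \<partial>lborel)"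
    by (rule nn_integral_mono_AE, use AE_lborel_singleton[of "0::real^3"] in eventually_elim) (rule pw)
  also have "\<dots> = 2 * (\<integral>\<^sup>+x. ?h (x /\<^sub>R norm x) * indicator (shell \<delta>) x \<partial>lborel)
      + ennreal (2 * \<delta>) * (\<integral>\<^sup>+x. \<integral>\<^sup>+s. ?F x s \<partial>lborel \<partial>lborel)"
    by (simp add: nn_integral_add nn_integral_cmult)
  also have "(\<integral>\<^sup>+x. \<integral>\<^sup>+s. ?F x s \<partial>lborel \<partial>lborel) = (\<integral>\<^sup>+s. \<integral>\<^sup>+x. ?F x s \<partial>lborel \<partial>lborel)"
    by (rule lborel_pair.Fubini') measurable
  also have "\<dots> \<le> (\<integral>\<^sup>+s. ennreal (inverse (s ^ 3)) * indicator {s. 1 \<le> s \<and> s * (1 - \<delta>) < 1} s * ?G \<partial>lborel)"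
  proof (rule nn_integral_mono)
    fix s :: real
    show "(\<integral>\<^sup>+x. ?F x s \<partial>lborel) \<le> ennreal (inverse (s ^ 3)) * indicator {s. 1 \<le> s \<and> s * (1 - \<delta>) < 1} s * ?G"
    proof (cases "1 \<le> s \<and> s * (1 - \<delta>) < 1")
      case True
      then have s: "0 < s" "1 \<le> s" by auto
      have "(\<integral>\<^sup>+x. ?F x s \<partial>lborel) = (\<integral>\<^sup>+x. ?g (s *\<^sub>R x) * indicator {y. norm y < 1 \<and> s * (1 - \<delta>) \<le> norm y} (s *\<^sub>R x) \<partial>lborel)"
        using s by (intro nn_integral_cong) (auto simp: indicator_def mult_le_cancel_left_pos)
      moreover have "(\<integral>\<^sup>+y. ?g y * indicator {y. norm y < 1 \<and> s * (1 - \<delta>) \<le> norm y} y \<partial>lborel) =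
          ennreal (s ^ 3) * (\<integral>\<^sup>+x. ?g (s *\<^sub>R x) * indicator {y. norm y < 1 \<and> s * (1 - \<delta>) \<le> norm y} (s *\<^sub>R x) \<partial>lborel)"
        by (rule nn_integral_dilate[OF s(1)]) measurable
      moreover have "(\<integral>\<^sup>+y. ?g y * indicator {y. norm y < 1 \<and> s * (1 - \<delta>) \<le> norm y} y \<partial>lborel) \<le> ?G"
      proof (rule nn_integral_mono)
        have "1 * (1 - \<delta>) \<le> s * (1 - \<delta>)" using s d by (intro mult_right_mono) auto
        then show "?g y * indicator {y. norm y < 1 \<and> s * (1 - \<delta>) \<le> norm y} y \<le> ?g y * indicator (shell \<delta>) y" for y
          by (auto simp: indicator_def)
      qed
      ultimately have "ennreal (s ^ 3) * (\<integral>\<^sup>+x. ?F x s \<partial>lborel) \<le> ?G" by simp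
      then have "ennreal (inverse (s ^ 3)) * (ennreal (s ^ 3) * (\<integral>\<^sup>+x. ?F x s \<partial>lborel)) \<le> ennreal (inverse (s ^ 3)) * ?G"
        by (rule mult_left_mono) simp
      moreover have "ennreal (inverse (s ^ 3)) * (ennreal (s ^ 3) * Z) = Z" for Z
        using s by (simp flip: mult.assoc ennreal_mult)
      ultimately show ?thesis using True by simp
    next
      case False
      \<comment> \<open>On the shell s (1 - \<delta>) \<le> s |x|, so s |x| < 1 is impossible for s
        beyond the range.\<close>
      have "?F x s = 0" for x
      proof -
        have "s * (1 - \<delta>) < 1" if "1 \<le> s" "s * norm x < 1" "1 - \<delta> \<le> norm x"
          using mult_left_mono[OF that(3), of s] that by linarith
        then show ?thesis using False by (auto simp: indicator_def)
      qed
      then have "(\<integral>\<^sup>+x. ?F x s \<partial>lborel) = (\<integral>\<^sup>+x. 0 \<partial>(lborel :: (real^3) measure))"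
        by (rule nn_integral_cong)
      then show ?thesis by (simp only: nn_integral_const mult_zero_left zero_le)
    qed
  qed
  also have "\<dots> = (\<integral>\<^sup>+s. ennreal (inverse (s ^ 3)) * indicator {s. 1 \<le> s \<and> s * (1 - \<delta>) < 1} s \<partial>lborel) * ?G"
    by (rule nn_integral_multc) measurable
  also have "\<dots> \<le> ennreal (2 * \<delta>) * ?G" by (intro mult_right_mono nn_integral_cube_decay d) simp
  finally have "(\<integral>\<^sup>+x. ?h x * indicator (shell \<delta>) x \<partial>lborel) \<le>
      2 * (\<integral>\<^sup>+x. ?h (x /\<^sub>R norm x) * indicator (shell \<delta>) x \<partial>lborel) + ennreal (2 * \<delta>) * (ennreal (2 * \<delta>) * ?G)"
    by (simp add: add_left_mono mult_left_mono)
  also have "\<dots> \<le> 2 * (ennreal \<delta> * (\<integral>\<^sup>+x. ?h x \<partial>sphere_measure)) + ennreal (2 * \<delta>) * (ennreal (2 * \<delta>) * ?G)"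
    by (intro add_right_mono mult_left_mono nn_integral_shell_projection fin d) auto
  also have "\<dots> = ennreal (2 * \<delta>) * (\<integral>\<^sup>+x. ?h x \<partial>sphere_measure) + ennreal (4 * \<delta>\<^sup>2) * ?G"
    using d by (simp add: ennreal_mult power2_eq_square ac_simps)
  finally show ?thesis .
qed

section \<open>Sobolev functions and their traces by smooth approximation\<close>

subsection \<open>Traces\<close>

text \<open>The gradient is an explicit argument, so that sums, products and limits come with
  theirs, whereas \<open>weak_gradient\<close> is an arbitrary representative. Nothing is imposed at
  the sphere here; \<open>sobolev_trace\<close> adds convergence there.\<close>

definition sobolev :: "(real^3 \<Rightarrow> 'a::euclidean_space) \<Rightarrow> (real^3 \<Rightarrow> 'a^3) \<Rightarrow> bool" where
  "sobolev u G \<longleftrightarrow> (\<exists>\<phi>. (\<forall>k. smooth (\<phi> k)) \<and> L2_tendsto (vol B) \<phi> u \<and>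
     L2_tendsto (vol B) (\<lambda>k. gradient (\<phi> k)) G)"

definition sobolev_trace :: "(real^3 \<Rightarrow> 'a::euclidean_space) \<Rightarrow> (real^3 \<Rightarrow> 'a^3) \<Rightarrow> (real^3 \<Rightarrow> 'a) \<Rightarrow> bool" where
  "sobolev_trace u G f \<longleftrightarrow> (\<exists>\<phi>. (\<forall>k. smooth (\<phi> k)) \<and> L2_tendsto (vol B) \<phi> u \<and>
     L2_tendsto (vol B) (\<lambda>k. gradient (\<phi> k)) G \<and> L2_tendsto sphere_measure \<phi> f)"

lemma sobolev_traceE:
  assumes "sobolev_trace u G f"
  obtains \<phi> where "\<And>k. smooth (\<phi> k)" "L2_tendsto (vol B) \<phi> u"
     "L2_tendsto (vol B) (\<lambda>k. gradient (\<phi> k)) G" "L2_tendsto sphere_measure \<phi> f"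
  using assms unfolding sobolev_trace_def by blast

lemma sobolev_trace_L2:
  assumes "sobolev_trace u G f"
  shows "L2 (vol B) u" "L2 (vol B) G" "L2 sphere_measure f"
  using assms by (auto simp: sobolev_trace_def L2_tendsto_def)

lemma sobolev_trace_imp_sobolev: "sobolev_trace u G f \<Longrightarrow> sobolev u G"
  unfolding sobolev_trace_def sobolev_def by blast

lemma sobolev_weak_gradient:
  assumes "sobolev u G" shows "is_weak_gradient B u G"
proof -
  obtain \<phi> where \<phi>: "\<And>k. smooth (\<phi> k)" "L2_tendsto (vol B) \<phi> u"
     "L2_tendsto (vol B) (\<lambda>k. gradient (\<phi> k)) G" using assms unfolding sobolev_def by blast
  have "(\<integral>x. gradient \<psi> x $ i *\<^sub>R u x \<partial>vol B) = - (\<integral>x. \<psi> x *\<^sub>R (G x $ i) \<partial>vol B)"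
    if \<psi>: "test_function B \<psi>" for \<psi> i
  proof -
    have s: "smooth \<psi>" using \<psi> by (rule test_function_smooth)
    have L: "L2 (vol B) \<psi>" "L2 (vol B) (\<lambda>x. gradient \<psi> x $ i)"
      by (intro L2_continuous_B smooth_continuous smooth_partial s)+
    have sc: "bounded_bilinear (\<lambda>(a::'a) (r::real). r *\<^sub>R a)"
      by (rule bounded_bilinear.flip[OF bounded_bilinear_scaleR])
    have eq: "(\<integral>x. gradient \<psi> x $ i *\<^sub>R \<phi> k x \<partial>vol B) = - (\<integral>x. \<psi> x *\<^sub>R (gradient (\<phi> k) x $ i) \<partial>vol B)" for k
      using is_weak_gradient_smooth[OF \<phi>(1)] \<psi> unfolding is_weak_gradient_def by blast
    have "(\<lambda>k. \<integral>x. gradient \<psi> x $ i *\<^sub>R \<phi> k x \<partial>vol B) \<longlonglongrightarrow> (\<integral>x. gradient \<psi> x $ i *\<^sub>R u x \<partial>vol B)"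
      by (rule L2_tendsto_integral_bilinear[OF sc \<phi>(2) L(2)])
    moreover have "(\<lambda>k. - (\<integral>x. \<psi> x *\<^sub>R (gradient (\<phi> k) x $ i) \<partial>vol B)) \<longlonglongrightarrow> - (\<integral>x. \<psi> x *\<^sub>R (G x $ i) \<partial>vol B)"
      by (intro tendsto_minus L2_tendsto_integral_bilinear[OF sc L2_tendsto_nth[OF \<phi>(3)] L(1)])
    ultimately show ?thesis unfolding eq by (rule LIMSEQ_unique)
  qed
  with \<phi>(2,3) show ?thesis by (simp add: is_weak_gradient_def L2_tendsto_def)
qed

lemmas sobolev_trace_weak_gradient = sobolev_weak_gradient[OF sobolev_trace_imp_sobolev]

lemma L2_tendsto_cong_AE:
  assumes "L2_tendsto M F f" "AE x in M. f x = g x" "g \<in> borel_measurable M"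
  shows "L2_tendsto M F g"
proof -
  have [measurable]: "\<And>k. F k \<in> borel_measurable M" "f \<in> borel_measurable M" "g \<in> borel_measurable M"
    using assms(1,3) by (auto simp: L2_tendsto_def L2_def)
  have "(\<integral>x. (norm (F k x - f x))\<^sup>2 \<partial>M) = (\<integral>x. (norm (F k x - g x))\<^sup>2 \<partial>M)" for k
    by (rule integral_cong_AE) (use assms(2) in auto)
  moreover have "integrable M (\<lambda>x. (norm (f x))\<^sup>2) \<longleftrightarrow> integrable M (\<lambda>x. (norm (g x))\<^sup>2)"
    by (rule integrable_cong_AE) (use assms(2) in auto)
  ultimately show ?thesis using assms by (simp add: L2_tendsto_def L2_def)
qed

lemma sobolev_trace_cong_AE:
  assumes "sobolev_trace u G f" "AE x in vol B. G x = H x" "H \<in> borel_measurable (vol B)"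
  shows "sobolev_trace u H f"
  using assms(1) L2_tendsto_cong_AE[OF _ assms(2,3)] unfolding sobolev_trace_def by blast

text \<open>Together with the converse below, this exchanges the chosen \<open>weak_gradient\<close>
  in \<open>has_trace\<close> for any convenient one; the two agree almost everywhere.\<close>

lemma sobolev_trace_imp_has_trace:
  assumes "sobolev_trace u G f" shows "has_trace u f"
proof -
  have wg: "is_weak_gradient B u G" by (rule sobolev_trace_weak_gradient[OF assms])
  then have H1: "u \<in> H1 B" by (auto simp: H1_def)
  have AE: "AE x in vol B. G x = weak_gradient B u x"
    using weak_gradient_AE[OF wg] by eventually_elim simp
  have "L2 (vol B) (weak_gradient B u)"
    using is_weak_gradient_weak_gradient[OF H1] by (simp add: is_weak_gradient_def)
  then have "sobolev_trace u (weak_gradient B u) f"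
    using sobolev_trace_cong_AE[OF assms AE] by (simp add: L2_def)
  then obtain \<phi> where \<phi>: "\<And>k. smooth (\<phi> k)" "L2_tendsto (vol B) \<phi> u"
     "L2_tendsto (vol B) (\<lambda>k. gradient (\<phi> k)) (weak_gradient B u)" "L2_tendsto sphere_measure \<phi> f"
    by (rule sobolev_traceE) blast
  have i: "integrable (vol B) (\<lambda>x. (norm (\<phi> k x - u x))\<^sup>2)"
    "integrable (vol B) (\<lambda>x. (norm (gradient (\<phi> k) x - weak_gradient B u x))\<^sup>2)" for k
    using \<phi> by (auto intro!: L2_integrable L2_diff simp: L2_tendsto_def)
  have "(\<lambda>k. (\<integral>x. (norm (\<phi> k x - u x))\<^sup>2 \<partial>vol B) + (\<integral>x. (norm (gradient (\<phi> k) x - weak_gradient B u x))\<^sup>2 \<partial>vol B)) \<longlonglongrightarrow> 0"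
    using \<phi>(2,3) by (intro tendsto_add_zero) (auto simp: L2_tendsto_def)
  then have "(\<lambda>k. \<integral>x. (norm (\<phi> k x - u x))\<^sup>2 + (norm (gradient (\<phi> k) x - weak_gradient B u x))\<^sup>2 \<partial>vol B) \<longlonglongrightarrow> 0"
    using i by simp
  then show ?thesis
    unfolding has_trace_def using H1 \<phi>(1,4)
    by (intro conjI exI[of _ \<phi>] allI) (simp_all add: L2_tendsto_def)
qed

lemma has_trace_imp_sobolev_trace:
  assumes "has_trace u f" shows "sobolev_trace u (weak_gradient B u) f"
proof -
  from assms obtain \<phi> where \<phi>: "u \<in> H1 B" "L2 sphere_measure f" "\<And>k. smooth (\<phi> k)"
    "(\<lambda>k. \<integral>x. (norm (\<phi> k x - u x))\<^sup>2 + (norm (gradient (\<phi> k) x - weak_gradient B u x))\<^sup>2 \<partial>vol B) \<longlonglongrightarrow> 0"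
    "(\<lambda>k. \<integral>x. (norm (\<phi> k x - f x))\<^sup>2 \<partial>sphere_measure) \<longlonglongrightarrow> 0"
    unfolding has_trace_def by blast
  have L: "L2 (vol B) u" "L2 (vol B) (weak_gradient B u)"
    using is_weak_gradient_weak_gradient[OF \<phi>(1)] by (auto simp: is_weak_gradient_def)
  have Lk: "L2 (vol B) (\<phi> k)" "L2 (vol B) (gradient (\<phi> k))" "L2 sphere_measure (\<phi> k)" for k
    by (intro L2_continuous_B L2_continuous_sphere smooth_continuous smooth_gradient_continuous \<phi>(3))+
  have i: "integrable (vol B) (\<lambda>x. (norm (\<phi> k x - u x))\<^sup>2)"
    "integrable (vol B) (\<lambda>x. (norm (gradient (\<phi> k) x - weak_gradient B u x))\<^sup>2)" for k
    by (intro L2_integrable L2_diff L Lk)+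
  have le: "(\<integral>x. (norm (\<phi> k x - u x))\<^sup>2 \<partial>vol B) \<le> (\<integral>x. (norm (\<phi> k x - u x))\<^sup>2 + (norm (gradient (\<phi> k) x - weak_gradient B u x))\<^sup>2 \<partial>vol B)"
     "(\<integral>x. (norm (gradient (\<phi> k) x - weak_gradient B u x))\<^sup>2 \<partial>vol B) \<le> (\<integral>x. (norm (\<phi> k x - u x))\<^sup>2 + (norm (gradient (\<phi> k) x - weak_gradient B u x))\<^sup>2 \<partial>vol B)" for k
    using i by (auto intro!: integral_mono)
  have "(\<lambda>k. \<integral>x. (norm (\<phi> k x - u x))\<^sup>2 \<partial>vol B) \<longlonglongrightarrow> 0"
    "(\<lambda>k. \<integral>x. (norm (gradient (\<phi> k) x - weak_gradient B u x))\<^sup>2 \<partial>vol B) \<longlonglongrightarrow> 0"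
    by (rule LIMSEQ_0_upper[OF \<phi>(4)]; simp add: le)+
  then show ?thesis
    unfolding sobolev_trace_def L2_tendsto_def using \<phi>(2,3,5) L Lk
    by (intro conjI exI[of _ \<phi>] allI) simp_all
qed

lemma sobolev_trace_smooth:
  assumes "smooth \<phi>" shows "sobolev_trace \<phi> (gradient \<phi>) \<phi>"
  unfolding sobolev_trace_def
  by (rule exI[of _ "\<lambda>_. \<phi>"])
    (use assms in \<open>auto intro!: L2_tendsto_const L2_continuous_B L2_continuous_sphere smooth_continuous smooth_gradient_continuous\<close>)

lemma sobolev_trace_add:
  assumes "sobolev_trace u G f" "sobolev_trace v H g"
  shows "sobolev_trace (\<lambda>x. u x + v x) (\<lambda>x. G x + H x) (\<lambda>x. f x + g x)"
proof -
  obtain \<phi> where \<phi>: "\<And>k. smooth (\<phi> k)" "L2_tendsto (vol B) \<phi> u"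
     "L2_tendsto (vol B) (\<lambda>k. gradient (\<phi> k)) G" "L2_tendsto sphere_measure \<phi> f" using assms(1) by (rule sobolev_traceE) blast
  obtain \<psi> where \<psi>: "\<And>k. smooth (\<psi> k)" "L2_tendsto (vol B) \<psi> v"
     "L2_tendsto (vol B) (\<lambda>k. gradient (\<psi> k)) H" "L2_tendsto sphere_measure \<psi> g" using assms(2) by (rule sobolev_traceE) blast
  have "gradient (\<lambda>x. \<phi> k x + \<psi> k x) = (\<lambda>x. gradient (\<phi> k) x + gradient (\<psi> k) x)" for k
    using gradient_add[OF \<phi>(1) \<psi>(1)] by (simp add: fun_eq_iff vec_eq_iff)
  then show ?thesis unfolding sobolev_trace_def
    by (intro exI[of _ "\<lambda>k x. \<phi> k x + \<psi> k x"]) (auto intro!: smooth_add L2_tendsto_add \<phi> \<psi>)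
qed

lemma L2_tendsto_vec_lambda:
  assumes "\<And>i. L2_tendsto M (\<lambda>k x. F k x i) (\<lambda>x. f x i)"
  shows "L2_tendsto M (\<lambda>k x. \<chi> i. F k x i) (\<lambda>x. \<chi> i. f x i)"
proof -
  have L: "\<And>k i. L2 M (\<lambda>x. F k x i)" "\<And>i. L2 M (\<lambda>x. f x i)" using assms by (auto simp: L2_tendsto_def)
  have "(\<lambda>k. \<Sum>i\<in>UNIV. \<integral>x. (norm (F k x i - f x i))\<^sup>2 \<partial>M) \<longlonglongrightarrow> 0"
    using assms by (intro tendsto_null_sum) (auto simp: L2_tendsto_def)
  moreover have "(\<integral>x. (norm ((\<chi> i. F k x i) - (\<chi> i. f x i)))\<^sup>2 \<partial>M) = (\<Sum>i\<in>UNIV. \<integral>x. (norm (F k x i - f x i))\<^sup>2 \<partial>M)" for k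
    using L by (simp add: norm_power2_vec L2_integrable[OF L2_diff])
  ultimately show ?thesis using L by (simp add: L2_tendsto_def L2_vec_lambda)
qed

lemma sobolev_trace_bounded_linear:
  assumes T: "bounded_linear T" and u: "sobolev_trace u G f"
  shows "sobolev_trace (\<lambda>x. T (u x)) (\<lambda>x. \<chi> i. T (G x $ i)) (\<lambda>x. T (f x))"
proof -
  obtain \<phi> where \<phi>: "\<And>k. smooth (\<phi> k)" "L2_tendsto (vol B) \<phi> u"
     "L2_tendsto (vol B) (\<lambda>k. gradient (\<phi> k)) G" "L2_tendsto sphere_measure \<phi> f" using u by (rule sobolev_traceE) blast
  have "gradient (\<lambda>x. T (\<phi> k x)) = (\<lambda>x. \<chi> i. T (gradient (\<phi> k) x $ i))" for k
    using gradient_bounded_linear[OF T \<phi>(1)] by (simp add: fun_eq_iff vec_eq_iff)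
  then show ?thesis unfolding sobolev_trace_def
    by (intro exI[of _ "\<lambda>k x. T (\<phi> k x)"])
      (auto intro!: smooth_bounded_linear[OF T] L2_tendsto_vec_lambda L2_tendsto_bounded_linear[OF T] L2_tendsto_nth \<phi>)
qed

lemma smooth_bounded_B:
  assumes "smooth m"
  obtains L where "m \<in> borel_measurable (vol B)" "\<And>x. x \<in> space (vol B) \<Longrightarrow> \<bar>m x :: real\<bar> \<le> L"
proof -
  obtain L where "\<And>x. norm x \<le> 1 \<Longrightarrow> norm (m x) \<le> L"
    using continuous_bounded_cball[OF smooth_continuous[OF assms]] by blast
  moreover have "m \<in> borel_measurable (vol B)"
    by (intro borel_imp_vol borel_measurable_continuous_onI smooth_continuous assms)
  ultimately show ?thesis by (intro that[of L]) auto
qed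

lemma L2_smooth_mult:
  assumes "smooth m" "L2 (vol B) f" shows "L2 (vol B) (\<lambda>x. m x *\<^sub>R f x)"
proof (rule smooth_bounded_B[OF assms(1)])
  fix L assume "m \<in> borel_measurable (vol B)" "\<And>x. x \<in> space (vol B) \<Longrightarrow> \<bar>m x\<bar> \<le> L"
  then show ?thesis by (rule L2_bounded_mult[OF _ _ assms(2)])
qed

lemma L2_tendsto_smooth_mult:
  assumes "smooth m" "L2_tendsto (vol B) F f"
  shows "L2_tendsto (vol B) (\<lambda>k x. m x *\<^sub>R F k x) (\<lambda>x. m x *\<^sub>R f x)"
proof (rule smooth_bounded_B[OF assms(1)])
  fix L assume "m \<in> borel_measurable (vol B)" "\<And>x. x \<in> space (vol B) \<Longrightarrow> \<bar>m x\<bar> \<le> L"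
  then show ?thesis by (rule L2_tendsto_bounded_mult[OF _ _ assms(2)])
qed

lemma sobolev_trace_cong_sphere:
  assumes "sobolev_trace u G f" "\<And>x. norm x = 1 \<Longrightarrow> f x = g x" "g \<in> borel_measurable borel"
  shows "sobolev_trace u G g"
proof -
  have f: "f \<in> borel_measurable borel"
    using sobolev_trace_L2(3)[OF assms(1)] by (simp add: L2_def cong: measurable_cong_sets)
  have "AE x in sphere_measure. f x = g x"
    by (rule AE_sphere[OF assms(2)]) (use f assms(3) in measurable)
  with assms show ?thesis
    using L2_tendsto_cong_AE[of sphere_measure _ f g] unfolding sobolev_trace_def
    by (auto cong: measurable_cong_sets)
qed

lemma L2_tendsto_approx:
  assumes "L2_tendsto M F f" "\<And>k. L2 M (G k)" "\<And>k. (\<integral>x. (norm (G k x - F k x))\<^sup>2 \<partial>M) \<le> inverse (real (Suc k))"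
  shows "L2_tendsto M G f"
proof -
  have F: "\<And>k. L2 M (F k)" using assms(1) by (simp add: L2_tendsto_def)
  have "(\<lambda>k. \<integral>x. (norm ((G k x - F k x) - 0))\<^sup>2 \<partial>M) \<longlonglongrightarrow> 0"
    by (rule LIMSEQ_0_upper[OF LIMSEQ_inverse_real_of_nat]) (use assms(3) in auto)
  then have "L2_tendsto M (\<lambda>k x. G k x - F k x) (\<lambda>x. 0)"
    using F assms(2) by (simp add: L2_tendsto_def L2_zero L2_diff)
  from L2_tendsto_add[OF this assms(1)] show ?thesis by simp
qed

text \<open>Diagonal choice: the n-th function is replaced by a smooth one that is close to it in
  the function, in the gradient and in the trace at once.\<close>

lemma sobolev_trace_closed:
  assumes "\<And>n. sobolev_trace (u n) (G n) f" "L2_tendsto (vol B) u v" "L2_tendsto (vol B) G H"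
  shows "sobolev_trace v H f"
proof -
  have "\<exists>\<psi>. smooth \<psi> \<and> (\<integral>x. (norm (\<psi> x - u n x))\<^sup>2 \<partial>vol B) \<le> inverse (real (Suc n)) \<and>
      (\<integral>x. (norm (gradient \<psi> x - G n x))\<^sup>2 \<partial>vol B) \<le> inverse (real (Suc n)) \<and>
      (\<integral>x. (norm (\<psi> x - f x))\<^sup>2 \<partial>sphere_measure) \<le> inverse (real (Suc n))" for n
  proof -
    obtain \<phi> where \<phi>: "\<And>k. smooth (\<phi> k)" "L2_tendsto (vol B) \<phi> (u n)"
     "L2_tendsto (vol B) (\<lambda>k. gradient (\<phi> k)) (G n)" "L2_tendsto sphere_measure \<phi> f"
      using assms(1)[of n] by (rule sobolev_traceE) blast
    have "\<forall>\<^sub>F k in sequentially. (\<integral>x. (norm (\<phi> k x - u n x))\<^sup>2 \<partial>vol B) < inverse (real (Suc n)) \<and>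
      (\<integral>x. (norm (gradient (\<phi> k) x - G n x))\<^sup>2 \<partial>vol B) < inverse (real (Suc n)) \<and>
      (\<integral>x. (norm (\<phi> k x - f x))\<^sup>2 \<partial>sphere_measure) < inverse (real (Suc n))"
      using \<phi>(2-4) unfolding L2_tendsto_def
      by (intro eventually_conj order_tendstoD(2)[of _ 0]) auto
    then obtain k where "(\<integral>x. (norm (\<phi> k x - u n x))\<^sup>2 \<partial>vol B) < inverse (real (Suc n)) \<and>
      (\<integral>x. (norm (gradient (\<phi> k) x - G n x))\<^sup>2 \<partial>vol B) < inverse (real (Suc n)) \<and>
      (\<integral>x. (norm (\<phi> k x - f x))\<^sup>2 \<partial>sphere_measure) < inverse (real (Suc n))"
      using eventually_happens sequentially_bot by blast
    then show ?thesis using \<phi>(1)[of k] by (intro exI[of _ "\<phi> k"]) auto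
  qed
  then have "\<forall>n. \<exists>\<psi>. smooth \<psi> \<and> (\<integral>x. (norm (\<psi> x - u n x))\<^sup>2 \<partial>vol B) \<le> inverse (real (Suc n)) \<and>
      (\<integral>x. (norm (gradient \<psi> x - G n x))\<^sup>2 \<partial>vol B) \<le> inverse (real (Suc n)) \<and>
      (\<integral>x. (norm (\<psi> x - f x))\<^sup>2 \<partial>sphere_measure) \<le> inverse (real (Suc n))" by blast
  from choice[OF this] obtain \<psi> where \<psi>: "\<And>n. smooth (\<psi> n)"
      "\<And>n. (\<integral>x. (norm (\<psi> n x - u n x))\<^sup>2 \<partial>vol B) \<le> inverse (real (Suc n))"
      "\<And>n. (\<integral>x. (norm (gradient (\<psi> n) x - G n x))\<^sup>2 \<partial>vol B) \<le> inverse (real (Suc n))"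
      "\<And>n. (\<integral>x. (norm (\<psi> n x - f x))\<^sup>2 \<partial>sphere_measure) \<le> inverse (real (Suc n))"
    by blast
  have "L2_tendsto (vol B) \<psi> v"
    by (intro L2_tendsto_approx[OF assms(2)] \<psi>(2) L2_continuous_B smooth_continuous \<psi>(1))
  moreover have "L2_tendsto (vol B) (\<lambda>n. gradient (\<psi> n)) H"
    by (intro L2_tendsto_approx[OF assms(3)] \<psi>(3) L2_continuous_B smooth_gradient_continuous \<psi>(1))
  moreover have "L2_tendsto sphere_measure \<psi> f"
    by (intro L2_tendsto_approx[OF L2_tendsto_const] \<psi>(4) L2_continuous_sphere smooth_continuous \<psi>(1)
      sobolev_trace_L2(3)[OF assms(1)])
  ultimately show ?thesis using \<psi>(1) unfolding sobolev_trace_def by blast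
qed

section \<open>Shell and Poincare inequalities for functions with trace, and cutoffs at the
  sphere\<close>

lemma shell_estimate_smooth:
  fixes w :: "real^3 \<Rightarrow> 'v::euclidean_space"
  assumes w: "smooth w" and d: "0 < \<delta>" "\<delta> \<le> 1"
  shows "(\<integral>x. (norm (indicator (shell \<delta>) x *\<^sub>R w x))\<^sup>2 \<partial>vol B)
    \<le> 2 * \<delta> * (\<integral>x. (norm (w x))\<^sup>2 \<partial>sphere_measure)
      + 4 * \<delta>\<^sup>2 * (\<integral>x. (norm (indicator (shell \<delta>) x *\<^sub>R gradient w x))\<^sup>2 \<partial>vol B)"
proof -
  have ind: "indicator (shell \<delta>) \<in> borel_measurable (vol B)" by (rule borel_imp_vol) simp
  have L: "L2 (vol B) (\<lambda>x. indicator (shell \<delta>) x *\<^sub>R w x)" "L2 (vol B) (\<lambda>x. indicator (shell \<delta>) x *\<^sub>R gradient w x)"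
    by (rule L2_bounded_mult[OF ind, where L=1];
      simp add: indicator_def L2_continuous_B smooth_continuous smooth_gradient_continuous w)+
  have conv: "ennreal (\<integral>x. (norm (indicator (shell \<delta>) x *\<^sub>R f x))\<^sup>2 \<partial>vol B)
     = (\<integral>\<^sup>+x. ennreal ((norm (f x))\<^sup>2) * indicator (shell \<delta>) x \<partial>lborel)"
    if "L2 (vol B) (\<lambda>x. indicator (shell \<delta>) x *\<^sub>R f x)" for f :: "real^3 \<Rightarrow> 'w::euclidean_space"
  proof -
    have "ennreal (\<integral>x. (norm (indicator (shell \<delta>) x *\<^sub>R f x))\<^sup>2 \<partial>vol B)
      = (\<integral>\<^sup>+x. ennreal ((norm (indicator (shell \<delta>) x *\<^sub>R f x))\<^sup>2) \<partial>vol B)"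
      by (rule nn_integral_eq_integral[symmetric]) (use that in \<open>auto simp: L2_def\<close>)
    also have "\<dots> = (\<integral>\<^sup>+x. ennreal ((norm (f x))\<^sup>2) * indicator (shell \<delta>) x \<partial>lborel)"
      unfolding nn_integral_vol_B by (rule nn_integral_cong) (auto simp: indicator_def)
    finally show ?thesis .
  qed
  have S: "(\<integral>\<^sup>+x. ennreal ((norm (w x))\<^sup>2) \<partial>sphere_measure) = ennreal (\<integral>x. (norm (w x))\<^sup>2 \<partial>sphere_measure)"
    by (rule nn_integral_eq_integral) (auto intro!: L2_integrable L2_continuous_sphere smooth_continuous w)
  have "ennreal (\<integral>x. (norm (indicator (shell \<delta>) x *\<^sub>R w x))\<^sup>2 \<partial>vol B)
    \<le> ennreal (2 * \<delta>) * ennreal (\<integral>x. (norm (w x))\<^sup>2 \<partial>sphere_measure)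
      + ennreal (4 * \<delta>\<^sup>2) * ennreal (\<integral>x. (norm (indicator (shell \<delta>) x *\<^sub>R gradient w x))\<^sup>2 \<partial>vol B)"
    unfolding conv[OF L(1)] conv[OF L(2)] S[symmetric] by (rule shell_estimate[OF w d])
  also have "\<dots> = ennreal (2 * \<delta> * (\<integral>x. (norm (w x))\<^sup>2 \<partial>sphere_measure)
      + 4 * \<delta>\<^sup>2 * (\<integral>x. (norm (indicator (shell \<delta>) x *\<^sub>R gradient w x))\<^sup>2 \<partial>vol B))"
    using d by (simp add: ennreal_mult ennreal_plus)
  finally show ?thesis
    using d by (subst (asm) ennreal_le_iff) auto
qed

lemma shell_estimate_trace:
  fixes w :: "real^3 \<Rightarrow> 'v::euclidean_space"
  assumes w: "sobolev_trace w K f" and d: "0 < \<delta>" "\<delta> \<le> 1"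
  shows "(\<integral>x. (norm (indicator (shell \<delta>) x *\<^sub>R w x))\<^sup>2 \<partial>vol B)
    \<le> 2 * \<delta> * (\<integral>x. (norm (f x))\<^sup>2 \<partial>sphere_measure)
      + 4 * \<delta>\<^sup>2 * (\<integral>x. (norm (indicator (shell \<delta>) x *\<^sub>R K x))\<^sup>2 \<partial>vol B)"
proof -
  obtain \<phi> where \<phi>: "\<And>k. smooth (\<phi> k)" "L2_tendsto (vol B) \<phi> w"
     "L2_tendsto (vol B) (\<lambda>k. gradient (\<phi> k)) K" "L2_tendsto sphere_measure \<phi> f"
    using w by (rule sobolev_traceE) blast
  have ind: "indicator (shell \<delta>) \<in> borel_measurable (vol B)" "\<And>x. \<bar>indicator (shell \<delta>) x :: real\<bar> \<le> 1"
    by (rule borel_imp_vol) (auto simp: indicator_def)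
  note lim = L2_tendsto_norm[OF L2_tendsto_bounded_mult[OF ind \<phi>(2)]] L2_tendsto_norm[OF L2_tendsto_bounded_mult[OF ind \<phi>(3)]]
    L2_tendsto_norm[OF \<phi>(4)]
  show ?thesis
    by (rule LIMSEQ_le[OF lim(1) tendsto_add[OF tendsto_mult[OF tendsto_const lim(3)] tendsto_mult[OF tendsto_const lim(2)]]])
      (use shell_estimate_smooth[OF \<phi>(1) d] in auto)
qed

text \<open>The shell of width 1 is the whole ball.\<close>

lemma Poincare_inequality:
  fixes w :: "real^3 \<Rightarrow> 'v::euclidean_space"
  assumes w: "sobolev_trace w K f"
  shows "(\<integral>x. (norm (w x))\<^sup>2 \<partial>vol B) \<le> 2 * (\<integral>x. (norm (f x))\<^sup>2 \<partial>sphere_measure) + 4 * (\<integral>x. (norm (K x))\<^sup>2 \<partial>vol B)"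
proof -
  have whole: "(\<integral>x. (norm (indicator (shell 1) x *\<^sub>R g x))\<^sup>2 \<partial>vol B) = (\<integral>x. (norm (g x))\<^sup>2 \<partial>vol B)"
    for g :: "real^3 \<Rightarrow> 'w::euclidean_space"
    by (rule Bochner_Integration.integral_cong) (auto simp: indicator_def)
  show ?thesis using shell_estimate_trace[OF w, of 1] by (simp only: whole) simp
qed

text \<open>In the ball |x|^2 \<le> |x|, so at distance more than 2/n from the sphere the argument
  of the step exceeds 1, where its derivative vanishes.\<close>

lemma gradient_cutoff_bound:
  obtains L where "0 \<le> L" "\<And>n x i. 0 < n \<Longrightarrow> x \<in> B \<Longrightarrow>
     \<bar>gradient (cutoff n) x $ i\<bar> \<le> L * n * indicator (shell (2 / n)) x"
proof -
  obtain D L where D: "\<And>t. (step has_field_derivative D t) (at t)" "\<And>t. \<bar>D t\<bar> \<le> L" "\<And>t. t \<notin> {0..1} \<Longrightarrow> D t = 0"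
    using step_deriv_bounded by blast
  have L: "0 \<le> L" using D(2)[of 0] by linarith
  have "\<bar>gradient (cutoff n) x $ i\<bar> \<le> (2 * L) * n * indicator (shell (2 / n)) x" if n: "0 < n" and x: "x \<in> B" for n x i
  proof -
    let ?t = "n * (1 - (norm x)\<^sup>2) - 1"
    have "((\<lambda>x::real^3. n * (1 - x \<bullet> x) - 1) has_derivative (\<lambda>h. - (n * (2 * (x \<bullet> h))))) (at x)"
      by (auto intro!: derivative_eq_intros simp: inner_commute algebra_simps)
    then have "((\<lambda>x::real^3. n * (1 - (norm x)\<^sup>2) - 1) has_derivative (\<lambda>h. - (n * (2 * (x \<bullet> h))))) (at x)"
      by (simp add: power2_norm_eq_inner)
    from has_derivative_compose[OF this D(1)[unfolded has_field_derivative_def]]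
    have "(cutoff n has_derivative (\<lambda>h. D ?t * - (n * (2 * (x \<bullet> h))))) (at x)"
      by (simp add: cutoff_def[abs_def])
    from gradient_nth[OF this, of i] have g: "gradient (cutoff n) x $ i = - (D ?t * (n * (2 * x $ i)))"
      by (simp add: inner_axis)
    show ?thesis
    proof (cases "x \<in> shell (2 / n)")
      case True
      have "\<bar>x $ i\<bar> \<le> 1" using component_le_norm_cart[of x i] x by simp
      then have "\<bar>D ?t\<bar> * (n * (2 * \<bar>x $ i\<bar>)) \<le> L * (n * (2 * 1))"
        using n L D(2)[of ?t] by (intro mult_mono) auto
      then show ?thesis using True n by (simp add: g abs_mult)
    next
      case False
      then have lt: "2 / n < 1 - norm x" using x by auto
      have "(norm x)\<^sup>2 \<le> norm x" using x power_decreasing[of 1 2 "norm x"] by simp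
      with lt have "2 / n < 1 - (norm x)\<^sup>2" by linarith
      then have "2 < n * (1 - (norm x)\<^sup>2)" using n by (simp add: field_simps)
      then have "D ?t = 0" by (intro D(3)) auto
      then show ?thesis using L n by (simp add: g)
    qed
  qed
  with L show ?thesis by (intro that[of "2 * L"]) auto
qed

lemma L2_tendsto_cutoff:
  fixes w :: "real^3 \<Rightarrow> 'v::euclidean_space"
  assumes w: "L2 (vol B) w"
  shows "L2_tendsto (vol B) (\<lambda>n x. cutoff (real (Suc n)) x *\<^sub>R w x) w"
proof -
  have L: "L2 (vol B) (\<lambda>x. cutoff (real (Suc n)) x *\<^sub>R w x)" for n
    by (rule L2_smooth_mult[OF smooth_cutoff w])
  have "(\<lambda>n. \<integral>x. (norm (cutoff (real (Suc n)) x *\<^sub>R w x - w x))\<^sup>2 \<partial>vol B) \<longlonglongrightarrow> (\<integral>x. 0 \<partial>vol B)"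
  proof (rule integral_dominated_convergence[where w="\<lambda>x. (norm (w x))\<^sup>2"])
    show "AE x in vol B. (\<lambda>n. (norm (cutoff (real (Suc n)) x *\<^sub>R w x - w x))\<^sup>2) \<longlonglongrightarrow> 0"
    proof (rule AE_I2, rule tendsto_eventually)
      fix x assume "x \<in> space (vol B)"
      then have "norm x < 1" by simp
      from cutoff_eventually_1[OF this]
      show "\<forall>\<^sub>F n in sequentially. (norm (cutoff (real (Suc n)) x *\<^sub>R w x - w x))\<^sup>2 = 0"
        by eventually_elim simp
    qed
    have "norm (c *\<^sub>R v - v) \<le> norm v" if "0 \<le> c" "c \<le> 1" for c and v :: 'v
    proof -
      have "norm (c *\<^sub>R v - v) = \<bar>c - 1\<bar> * norm v" by (simp flip: norm_scaleR add: scaleR_diff_left)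
      also have "\<dots> \<le> 1 * norm v" using that by (intro mult_right_mono) auto
      finally show ?thesis by simp
    qed
    then show "AE x in vol B. norm ((norm (cutoff (real (Suc n)) x *\<^sub>R w x - w x))\<^sup>2) \<le> (norm (w x))\<^sup>2" for n
      by (intro AE_I2) (simp add: cutoff_bounds power_mono)
    show "(\<lambda>x. (norm (cutoff (real (Suc n)) x *\<^sub>R w x - w x))\<^sup>2) \<in> borel_measurable (vol B)" for n
      using L2_integrable[OF L2_diff[OF L[of n] w]] by simp
  qed (use L2_integrable[OF w] in auto)
  with L w show ?thesis by (simp add: L2_tendsto_def)
qed

text \<open>The shells shrink to the empty set, since the sphere itself does not belong to
  them.\<close>

lemma integral_shell_tendsto_0:
  fixes K :: "real^3 \<Rightarrow> 'v::euclidean_space"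
  assumes K: "L2 (vol B) K"
  shows "(\<lambda>n. \<integral>x. (norm (indicator (shell (2 / real (Suc n))) x *\<^sub>R K x))\<^sup>2 \<partial>vol B) \<longlonglongrightarrow> 0"
proof -
  have ind: "indicator (shell \<delta>) \<in> borel_measurable (vol B)" for \<delta> by (rule borel_imp_vol) simp
  have Km[measurable]: "K \<in> borel_measurable (vol B)" using K by (rule L2_measurable)
  have "(\<lambda>n. \<integral>x. (norm (indicator (shell (2 / real (Suc n))) x *\<^sub>R K x))\<^sup>2 \<partial>vol B) \<longlonglongrightarrow> (\<integral>x. 0 \<partial>vol B)"
  proof (rule integral_dominated_convergence[where w="\<lambda>x. (norm (K x))\<^sup>2"])
    show "AE x in vol B. (\<lambda>n. (norm (indicator (shell (2 / real (Suc n))) x *\<^sub>R K x))\<^sup>2) \<longlonglongrightarrow> 0"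
    proof (rule AE_I2, rule tendsto_eventually)
      fix x assume "x \<in> space (vol B)"
      then have "0 < 1 - norm x" by simp
      then obtain N where N: "2 < real N * (1 - norm x)" using reals_Archimedean3[OF \<open>0 < 1 - norm x\<close>] by blast
      have "x \<notin> shell (2 / real (Suc n))" if "n \<ge> N" for n
      proof -
        have "real N * (1 - norm x) \<le> real (Suc n) * (1 - norm x)"
          using that \<open>0 < 1 - norm x\<close> by (intro mult_right_mono) auto
        with N have "2 < real (Suc n) * (1 - norm x)" by linarith
        then have "2 / real (Suc n) < 1 - norm x" by (simp add: divide_less_eq mult.commute del: of_nat_Suc)
        then show ?thesis by simp
      qed
      then show "\<forall>\<^sub>F n in sequentially. (norm (indicator (shell (2 / real (Suc n))) x *\<^sub>R K x))\<^sup>2 = 0"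
        unfolding eventually_sequentially by (intro exI[of _ N]) (simp del: of_nat_Suc)
    qed
    show "AE x in vol B. norm ((norm (indicator (shell (2 / real (Suc n))) x *\<^sub>R K x))\<^sup>2) \<le> (norm (K x))\<^sup>2" for n
      by (intro AE_I2) (simp add: indicator_def)
    show "(\<lambda>x. (norm (indicator (shell (2 / real (Suc n))) x *\<^sub>R K x))\<^sup>2) \<in> borel_measurable (vol B)" for n
      using ind[of "2 / real (Suc n)"] by measurable
  qed (use L2_integrable[OF K] in auto)
  then show ?thesis by simp
qed

text \<open>With \<delta> = 2/n the zero trace removes the term of order \<delta> from the shell
  estimate. The remaining \<delta>^2 compensates the squared size n^2 of the cutoff gradient, which
  leaves the energy of K in a shrinking shell.\<close>

lemma cutoff_gradient_tendsto_0:
  fixes w :: "real^3 \<Rightarrow> 'v::euclidean_space"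
  assumes w: "sobolev_trace w K (\<lambda>x. 0)"
  shows "L2_tendsto (vol B) (\<lambda>n x. gradient (cutoff (real (Suc n))) x $ i *\<^sub>R w x) (\<lambda>x. 0)"
proof -
  obtain L where L: "0 \<le> L" "\<And>n x i. 0 < n \<Longrightarrow> x \<in> B \<Longrightarrow>
     \<bar>gradient (cutoff n) x $ i\<bar> \<le> L * n * indicator (shell (2 / n)) x" using gradient_cutoff_bound by blast
  have ind: "indicator (shell \<delta>) \<in> borel_measurable (vol B)" "\<And>x. \<bar>indicator (shell \<delta>) x :: real\<bar> \<le> 1" for \<delta>
    by (rule borel_imp_vol) (auto simp: indicator_def)
  have wL: "L2 (vol B) w" "L2 (vol B) K" using sobolev_trace_L2[OF w] by auto
  have gL: "L2 (vol B) (\<lambda>x. gradient (cutoff n) x $ i *\<^sub>R w x)" for n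
    by (intro L2_smooth_mult smooth_partial smooth_cutoff wL)
  have bound: "(\<integral>x. (norm (gradient (cutoff n) x $ i *\<^sub>R w x))\<^sup>2 \<partial>vol B)
     \<le> 16 * L\<^sup>2 * (\<integral>x. (norm (indicator (shell (2 / n)) x *\<^sub>R K x))\<^sup>2 \<partial>vol B)" if n: "2 \<le> n" for n
  proof -
    have "(\<integral>x. (norm (gradient (cutoff n) x $ i *\<^sub>R w x))\<^sup>2 \<partial>vol B)
       \<le> (\<integral>x. (L * n)\<^sup>2 * (norm (indicator (shell (2 / n)) x *\<^sub>R w x))\<^sup>2 \<partial>vol B)"
    proof (rule integral_mono)
      show "integrable (vol B) (\<lambda>x. (L * n)\<^sup>2 * (norm (indicator (shell (2 / n)) x *\<^sub>R w x))\<^sup>2)"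
        by (intro integrable_mult_right L2_integrable L2_bounded_mult[OF ind] wL)
      fix x assume "x \<in> space (vol B)"
      then have "\<bar>gradient (cutoff n) x $ i\<bar> * norm (w x) \<le> L * n * indicator (shell (2 / n)) x * norm (w x)"
        using n by (intro mult_right_mono L(2)) auto
      then have "(norm (gradient (cutoff n) x $ i *\<^sub>R w x))\<^sup>2 \<le> (L * n * indicator (shell (2 / n)) x * norm (w x))\<^sup>2"
        by (intro power_mono) auto
      then show "(norm (gradient (cutoff n) x $ i *\<^sub>R w x))\<^sup>2 \<le> (L * n)\<^sup>2 * (norm (indicator (shell (2 / n)) x *\<^sub>R w x))\<^sup>2"
        by (simp add: power_mult_distrib mult.assoc)
    qed (intro L2_integrable gL)
    also have "\<dots> = (L * n)\<^sup>2 * (\<integral>x. (norm (indicator (shell (2 / n)) x *\<^sub>R w x))\<^sup>2 \<partial>vol B)" by simp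
    also have "\<dots> \<le> (L * n)\<^sup>2 * (4 * (2 / n)\<^sup>2 * (\<integral>x. (norm (indicator (shell (2 / n)) x *\<^sub>R K x))\<^sup>2 \<partial>vol B))"
      using shell_estimate_trace[OF w, of "2 / n"] n by (intro mult_left_mono) auto
    also have "\<dots> = 16 * L\<^sup>2 * (\<integral>x. (norm (indicator (shell (2 / n)) x *\<^sub>R K x))\<^sup>2 \<partial>vol B)"
      using n by (simp add: power_mult_distrib power_divide)
    finally show ?thesis .
  qed
  have "(\<lambda>n. 16 * L\<^sup>2 * (\<integral>x. (norm (indicator (shell (2 / real (Suc n))) x *\<^sub>R K x))\<^sup>2 \<partial>vol B)) \<longlonglongrightarrow> 0"
    by (intro tendsto_mult_right_zero integral_shell_tendsto_0 wL)
  then have "(\<lambda>n. \<integral>x. (norm (gradient (cutoff (real (Suc n))) x $ i *\<^sub>R w x))\<^sup>2 \<partial>vol B) \<longlonglongrightarrow> 0"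
  proof (rule tendsto_sandwich[OF _ _ tendsto_const, rotated 2])
    show "\<forall>\<^sub>F n in sequentially. (\<integral>x. (norm (gradient (cutoff (real (Suc n))) x $ i *\<^sub>R w x))\<^sup>2 \<partial>vol B)
      \<le> 16 * L\<^sup>2 * (\<integral>x. (norm (indicator (shell (2 / real (Suc n))) x *\<^sub>R K x))\<^sup>2 \<partial>vol B)"
      using eventually_ge_at_top[of 1] by eventually_elim (rule bound, simp)
  qed simp
  with gL show ?thesis by (simp add: L2_tendsto_def L2_zero)
qed

text \<open>
  Functions with vanishing trace are limits of compactly supported ones, so they are admissible in
  weak formulations that are only required to hold for test functions.
\<close>

lemma weak_equation_zero_trace:
  fixes P :: "'a::euclidean_space \<Rightarrow> 'v::euclidean_space \<Rightarrow> 'u::euclidean_space"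
  assumes P: "bounded_bilinear P" and F: "L2 (vol B) F" "L2 (vol B) F0"
    and eq: "\<And>\<psi>. test_function B \<psi> \<Longrightarrow>
      (\<integral>x. (\<Sum>j\<in>UNIV. gradient \<psi> x $ j *\<^sub>R (F x $ j)) + \<psi> x *\<^sub>R F0 x \<partial>vol B) = 0"
    and w: "sobolev_trace w K (\<lambda>x. 0)"
  shows "(\<integral>x. (\<Sum>j\<in>UNIV. P (K x $ j) (F x $ j)) + P (w x) (F0 x) \<partial>vol B) = 0"
proof -
  obtain \<phi> where \<phi>: "\<And>k. smooth (\<phi> k)" "L2_tendsto (vol B) \<phi> w"
     "L2_tendsto (vol B) (\<lambda>k. gradient (\<phi> k)) K" "L2_tendsto sphere_measure \<phi> (\<lambda>x. 0)"
    using w by (rule sobolev_traceE) blast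
  define \<Lambda> where "\<Lambda> D \<omega> = (\<integral>x. (\<Sum>j\<in>UNIV. P (D x $ j) (F x $ j)) + P (\<omega> x) (F0 x) \<partial>vol B)" for D \<omega>
  have split: "\<Lambda> D \<omega> = (\<Sum>j\<in>UNIV. \<integral>x. P (D x $ j) (F x $ j) \<partial>vol B) + (\<integral>x. P (\<omega> x) (F0 x) \<partial>vol B)"
    if "L2 (vol B) D" "L2 (vol B) \<omega>" for D \<omega>
    unfolding \<Lambda>_def using F that by (simp add: L2_bilinear_integrable[OF P] L2_nth)
  have cont: "(\<lambda>k. \<Lambda> (D k) (\<omega> k)) \<longlonglongrightarrow> \<Lambda> D' \<omega>'" if D: "L2_tendsto (vol B) D D'" "L2_tendsto (vol B) \<omega> \<omega>'" for D D' \<omega> \<omega>'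
  proof -
    have "(\<lambda>k. (\<Sum>j\<in>UNIV. \<integral>x. P (D k x $ j) (F x $ j) \<partial>vol B) + (\<integral>x. P (\<omega> k x) (F0 x) \<partial>vol B))
      \<longlonglongrightarrow> (\<Sum>j\<in>UNIV. \<integral>x. P (D' x $ j) (F x $ j) \<partial>vol B) + (\<integral>x. P (\<omega>' x) (F0 x) \<partial>vol B)"
      by (intro tendsto_add tendsto_sum L2_tendsto_integral_bilinear[OF P] L2_tendsto_nth D F L2_nth)
    then show ?thesis using D by (simp add: split L2_tendsto_def)
  qed
  \<comment> \<open>Test functions are real while \<omega> is vector-valued; P is expanded along the
    basis, and the scalar equation is applied to each component of \<omega>.\<close>
  have smooth0: "\<Lambda> (gradient \<omega>) \<omega> = 0" if \<omega>: "smooth \<omega>" and supp: "\<And>e. test_function B (\<lambda>x. \<omega> x \<bullet> e)" for \<omega>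
  proof -
    have L: "L2 (vol B) \<omega>" "L2 (vol B) (gradient \<omega>)"
      by (auto intro!: L2_continuous_B smooth_continuous smooth_gradient_continuous \<omega>)
    have Pe: "bounded_linear (P e)" for e by (rule bounded_bilinear.bounded_linear_right[OF P])
    have expand: "P a b = (\<Sum>e\<in>Basis. P e ((a \<bullet> e) *\<^sub>R b))" for a b
    proof -
      have "P a b = P (\<Sum>e\<in>Basis. (a \<bullet> e) *\<^sub>R e) b" by (simp add: euclidean_representation)
      also have "\<dots> = (\<Sum>e\<in>Basis. P e ((a \<bullet> e) *\<^sub>R b))"
        by (simp add: bounded_bilinear.sum_left[OF P] bounded_bilinear.scaleR_left[OF P] bounded_bilinear.scaleR_right[OF P])
      finally show ?thesis .
    qed
    let ?T = "\<lambda>e x. (\<Sum>j\<in>UNIV. (gradient \<omega> x $ j \<bullet> e) *\<^sub>R (F x $ j)) + (\<omega> x \<bullet> e) *\<^sub>R F0 x"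
    have Ti: "integrable (vol B) (?T e)" for e
      by (intro Bochner_Integration.integrable_add Bochner_Integration.integrable_sum
        L2_bilinear_integrable[OF bounded_bilinear_scaleR] L2_inner L2_nth F L)
    have "(\<Sum>j\<in>UNIV. P (gradient \<omega> x $ j) (F x $ j)) + P (\<omega> x) (F0 x) = (\<Sum>e\<in>Basis. P e (?T e x))" for x
    proof -
      have "(\<Sum>j\<in>UNIV. P (gradient \<omega> x $ j) (F x $ j)) + P (\<omega> x) (F0 x)
         = (\<Sum>j\<in>UNIV. \<Sum>e\<in>Basis. P e ((gradient \<omega> x $ j \<bullet> e) *\<^sub>R (F x $ j))) + (\<Sum>e\<in>Basis. P e ((\<omega> x \<bullet> e) *\<^sub>R F0 x))"
        by (simp only: expand[symmetric])
      also have "\<dots> = (\<Sum>e\<in>Basis. \<Sum>j\<in>UNIV. P e ((gradient \<omega> x $ j \<bullet> e) *\<^sub>R (F x $ j))) + (\<Sum>e\<in>Basis. P e ((\<omega> x \<bullet> e) *\<^sub>R F0 x))"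
        by (subst sum.swap) simp
      also have "\<dots> = (\<Sum>e\<in>Basis. P e (?T e x))"
        by (simp add: bounded_bilinear.add_right[OF P] bounded_bilinear.sum_right[OF P] sum.distrib)
      finally show ?thesis .
    qed
    then have "\<Lambda> (gradient \<omega>) \<omega> = (\<integral>x. (\<Sum>e\<in>Basis. P e (?T e x)) \<partial>vol B)" by (simp add: \<Lambda>_def)
    also have "\<dots> = (\<Sum>e\<in>Basis. \<integral>x. P e (?T e x) \<partial>vol B)"
      by (intro Bochner_Integration.integral_sum integrable_bounded_linear[OF Pe] Ti)
    also have "\<dots> = (\<Sum>e\<in>Basis. P e (\<integral>x. ?T e x \<partial>vol B))"
      by (intro sum.cong refl integral_bounded_linear[OF Pe] Ti)
    also have "\<dots> = (\<Sum>e\<in>Basis. P e 0)"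
    proof (intro sum.cong refl arg_cong[of _ _ "P _"])
      fix e
      show "(\<integral>x. ?T e x \<partial>vol B) = 0"
        using eq[OF supp, of e] gradient_bounded_linear[OF bounded_linear_inner_left \<omega>, of e] by simp
    qed
    finally show ?thesis by (simp add: bounded_bilinear.zero_right[OF P])
  qed
  let ?c = "\<lambda>n. cutoff (real (Suc n))"
  let ?D = "\<lambda>n D \<omega> x. (\<chi> j. ?c n x *\<^sub>R (D x $ j) + gradient (?c n) x $ j *\<^sub>R \<omega> x)"
  \<comment> \<open>Products of the smooth approximations with a cutoff have compact support. The
    cutoff stays fixed while k tends to infinity and is removed only afterwards: the estimate at the
    sphere needs zero trace, which w has but its approximations may lack.\<close>
  have k0: "\<Lambda> (?D n (gradient (\<phi> k)) (\<phi> k)) (\<lambda>x. ?c n x *\<^sub>R \<phi> k x) = 0" for n k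
  proof -
    have "gradient (\<lambda>x. ?c n x *\<^sub>R \<phi> k x) = ?D n (gradient (\<phi> k)) (\<phi> k)"
      using gradient_scaleR[OF smooth_cutoff \<phi>(1)] by (simp add: fun_eq_iff vec_eq_iff)
    moreover have "test_function B (\<lambda>x. (?c n x *\<^sub>R \<phi> k x) \<bullet> e)" for e
    proof -
      have "test_function B (\<lambda>x. ?c n x * (\<phi> k x \<bullet> e))"
        by (intro test_function_mult test_function_cutoff smooth_bounded_linear[OF bounded_linear_inner_left] \<phi>(1)) simp
      then show ?thesis by simp
    qed
    ultimately show ?thesis
      using smooth0[OF smooth_scaleR[OF smooth_cutoff \<phi>(1)], of "real (Suc n)" k] by simp
  qed
  have n0: "\<Lambda> (?D n K w) (\<lambda>x. ?c n x *\<^sub>R w x) = 0" for n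
  proof -
    have "(\<lambda>k. \<Lambda> (?D n (gradient (\<phi> k)) (\<phi> k)) (\<lambda>x. ?c n x *\<^sub>R \<phi> k x)) \<longlonglongrightarrow> \<Lambda> (?D n K w) (\<lambda>x. ?c n x *\<^sub>R w x)"
      by (intro cont L2_tendsto_vec_lambda L2_tendsto_add L2_tendsto_smooth_mult smooth_partial smooth_cutoff L2_tendsto_nth \<phi>)
    then show ?thesis unfolding k0 by (simp add: LIMSEQ_const_iff)
  qed
  have wL: "L2 (vol B) w" "L2 (vol B) K" using sobolev_trace_L2[OF w] by auto
  \<comment> \<open>The summand 0 is the limit of the terms with the gradient of the cutoff.\<close>
  have "L2_tendsto (vol B) (\<lambda>n. ?D n K w) (\<lambda>x. \<chi> j. K x $ j + 0)"
    by (intro L2_tendsto_vec_lambda L2_tendsto_add L2_tendsto_cutoff cutoff_gradient_tendsto_0[OF w] L2_nth wL)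
  then have "L2_tendsto (vol B) (\<lambda>n. ?D n K w) K" by simp
  then have "(\<lambda>n. \<Lambda> (?D n K w) (\<lambda>x. ?c n x *\<^sub>R w x)) \<longlonglongrightarrow> \<Lambda> K w"
    by (rule cont[OF _ L2_tendsto_cutoff[OF wL(1)]])
  then show ?thesis unfolding n0 by (simp add: LIMSEQ_const_iff \<Lambda>_def)
qed

section \<open>Dirichlet's principle\<close>

subsection \<open>The Dirichlet problem for harmonic functions\<close>

lemma sobolev_trace_scaleR:
  "sobolev_trace u G f \<Longrightarrow> sobolev_trace (\<lambda>x. c *\<^sub>R u x) (\<lambda>x. c *\<^sub>R G x) (\<lambda>x. c *\<^sub>R f x)"
proof -
  assume u: "sobolev_trace u G f"
  have "(\<chi> i. c *\<^sub>R (G x $ i)) = c *\<^sub>R G x" for x by (simp add: vec_eq_iff)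
  with sobolev_trace_bounded_linear[OF bounded_linear_scaleR_right u, of c] show ?thesis by simp
qed

lemma sobolev_trace_diff:
  "sobolev_trace u G f \<Longrightarrow> sobolev_trace v H g \<Longrightarrow>
   sobolev_trace (\<lambda>x. u x - v x) (\<lambda>x. G x - H x) (\<lambda>x. f x - g x)"
  using sobolev_trace_add[OF _ sobolev_trace_scaleR[of v H g "-1"], of u G f] by simp

lemma sobolev_trace_test_function:
  fixes e :: "'a::euclidean_space"
  assumes "test_function B \<psi>"
  shows "sobolev_trace (\<lambda>x. \<psi> x *\<^sub>R e) (\<lambda>x. \<chi> j. gradient \<psi> x $ j *\<^sub>R e) (\<lambda>x. 0)"
proof -
  have s: "smooth \<psi>" using assms by (rule test_function_smooth)
  have se: "smooth (\<lambda>x. \<psi> x *\<^sub>R e)" by (intro smooth_scaleR s smooth_const)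
  have "gradient (\<lambda>x. \<psi> x *\<^sub>R e) = (\<lambda>x. \<chi> j. gradient \<psi> x $ j *\<^sub>R e)"
    using gradient_scaleR[OF s smooth_const[of e]] by (simp add: fun_eq_iff vec_eq_iff gradient_const)
  moreover have "\<psi> x *\<^sub>R e = 0" if "norm x = 1" for x
  proof -
    from assms obtain K where "K \<subseteq> B" "\<And>x. x \<notin> K \<Longrightarrow> \<psi> x = 0" unfolding test_function_def by blast
    then show ?thesis using that by force
  qed
  ultimately show ?thesis
    using sobolev_trace_cong_sphere[OF sobolev_trace_smooth[OF se], of "\<lambda>x. 0"] by simp
qed

lemma parallelogram_midpoint:
  fixes a b :: "'a::real_inner"
  shows "(norm (a - b))\<^sup>2 = 2 * (norm a)\<^sup>2 + 2 * (norm b)\<^sup>2 - 4 * (norm ((1/2) *\<^sub>R (a + b)))\<^sup>2"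
proof -
  have "4 * (norm ((1/2) *\<^sub>R (a + b)))\<^sup>2 = (norm (a + b))\<^sup>2"
    by (simp add: power_mult_distrib power_divide)
  moreover have "(norm (a - b))\<^sup>2 + (norm (a + b))\<^sup>2 = 2 * (norm a)\<^sup>2 + 2 * (norm b)\<^sup>2"
    unfolding power2_norm_eq_inner by (simp add: inner_add_left inner_add_right inner_diff_left inner_diff_right)
  ultimately show ?thesis by linarith
qed

lemma norm_add_scaleR_power2:
  fixes a b :: "'a::real_inner"
  shows "(norm (a + t *\<^sub>R b))\<^sup>2 = (norm a)\<^sup>2 + (2 * t) * (a \<bullet> b) + t\<^sup>2 * (norm b)\<^sup>2"
  unfolding power2_norm_eq_inner by (simp add: inner_add_left inner_add_right inner_commute[of b a] power2_eq_square algebra_simps)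

text \<open>Gradients of a minimizing sequence for the energy are Cauchy by the parallelogram law,
  because midpoints have the same trace. The Poincare inequality carries convergence over to the
  functions, and the first variation of the energy is the weak equation.\<close>

lemma weakly_harmonic_extension_exists:
  fixes f :: "real^3 \<Rightarrow> 'a::euclidean_space"
  assumes "sobolev_trace U K f"
  shows "\<exists>u G. sobolev_trace u G f \<and>
    (\<forall>\<psi>. test_function B \<psi> \<longrightarrow> (\<integral>x. (\<Sum>j\<in>UNIV. gradient \<psi> x $ j *\<^sub>R (G x $ j)) \<partial>vol B) = 0)"
proof -
  define E :: "(real^3 \<Rightarrow> 'a^3) \<Rightarrow> real" where "E G = (\<integral>x. (norm (G x))\<^sup>2 \<partial>vol B)" for G
  define S where "S = {E G | u G. sobolev_trace u G f}"
  define d where "d = Inf S"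
  have bdd: "bdd_below S" by (rule bdd_belowI[of _ 0]) (auto simp: S_def E_def)
  have "E K \<in> S" unfolding S_def using assms by blast
  then have ne: "S \<noteq> {}" by blast
  have d_le: "d \<le> E G" if "sobolev_trace u G f" for u G
    unfolding d_def using that by (intro cInf_lower bdd) (auto simp: S_def)
  have "\<exists>u G. sobolev_trace u G f \<and> E G < d + inverse (real (Suc n))" for n
  proof -
    have "Inf S < d + inverse (real (Suc n))" by (simp add: d_def)
    then obtain s where "s \<in> S" "s < d + inverse (real (Suc n))" using cInf_lessD[OF ne] by blast
    then show ?thesis by (auto simp: S_def)
  qed
  then have "\<forall>n. \<exists>p. sobolev_trace (fst p) (snd p) f \<and> E (snd p) < d + inverse (real (Suc n))" by simp
  from choice[OF this] obtain p where p: "\<And>n. sobolev_trace (fst (p n)) (snd (p n)) f"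
      "\<And>n. E (snd (p n)) < d + inverse (real (Suc n))" by blast
  define u G where "u n = fst (p n)" and "G n = snd (p n)" for n
  have uG: "sobolev_trace (u n) (G n) f" "E (G n) < d + inverse (real (Suc n))" for n
    using p by (auto simp: u_def G_def)
  have L: "L2 (vol B) (u n)" "L2 (vol B) (G n)" for n using sobolev_trace_L2[OF uG(1)] by auto
  have dist: "E (\<lambda>x. G m x - G n x) \<le> 2 * inverse (real (Suc m)) + 2 * inverse (real (Suc n))" for m n
  proof -
    have mid: "sobolev_trace (\<lambda>x. (1/2) *\<^sub>R (u m x + u n x)) (\<lambda>x. (1/2) *\<^sub>R (G m x + G n x)) (\<lambda>x. (1/2) *\<^sub>R (f x + f x))"
      by (intro sobolev_trace_scaleR sobolev_trace_add uG)
    then have mid': "d \<le> E (\<lambda>x. (1/2) *\<^sub>R (G m x + G n x))" by (intro d_le) (simp flip: scaleR_2)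
    have "(norm (G m x - G n x))\<^sup>2 = 2 * (norm (G m x))\<^sup>2 + 2 * (norm (G n x))\<^sup>2 - 4 * (norm ((1/2) *\<^sub>R (G m x + G n x)))\<^sup>2" for x
      by (rule parallelogram_midpoint)
    then have "E (\<lambda>x. G m x - G n x) = (\<integral>x. 2 * (norm (G m x))\<^sup>2 + 2 * (norm (G n x))\<^sup>2 - 4 * (norm ((1/2) *\<^sub>R (G m x + G n x)))\<^sup>2 \<partial>vol B)"
      by (simp add: E_def)
    also have "\<dots> = 2 * E (G m) + 2 * E (G n) - 4 * E (\<lambda>x. (1/2) *\<^sub>R (G m x + G n x))"
      using L2_integrable[OF L(2)] L2_integrable[OF sobolev_trace_L2(2)[OF mid]] by (simp add: E_def)
    finally show ?thesis using mid' uG(2)[of m] uG(2)[of n] by linarith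
  qed
  have Cauchy: "\<exists>N. \<forall>m\<ge>N. \<forall>n\<ge>N. E (\<lambda>x. G m x - G n x) < e" if "e > 0" for e
  proof -
    obtain N where N: "inverse (real (Suc N)) < e / 4" using reals_Archimedean[of "e/4"] \<open>e > 0\<close> by auto
    have "inverse (real (Suc m)) < e / 4" if "m \<ge> N" for m
    proof -
      have "inverse (real (Suc m)) \<le> inverse (real (Suc N))" using that by (intro le_imp_inverse_le) auto
      with N show ?thesis by linarith
    qed
    note small = this
    have "E (\<lambda>x. G m x - G n x) < e" if "m \<ge> N" "n \<ge> N" for m n
      using dist[of m n] small[OF that(1)] small[OF that(2)] by linarith
    then show ?thesis by blast
  qed
  obtain H where H: "L2_tendsto (vol B) G H"
    using L2_complete[where F=G and M="vol B"] L(2) Cauchy by (auto simp: E_def)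
  have "\<exists>v. L2_tendsto (vol B) u v"
  proof (rule L2_complete[OF L(1)])
    fix e :: real assume "e > 0"
    then obtain N where N: "\<And>m n. m \<ge> N \<Longrightarrow> n \<ge> N \<Longrightarrow> E (\<lambda>x. G m x - G n x) < e / 4" using Cauchy[of "e/4"] by auto
    have le: "(\<integral>x. (norm (u m x - u n x))\<^sup>2 \<partial>vol B) \<le> 4 * E (\<lambda>x. G m x - G n x)" for m n
      using Poincare_inequality[OF sobolev_trace_diff[OF uG(1) uG(1)], of m n] by (simp add: E_def)
    have "(\<integral>x. (norm (u m x - u n x))\<^sup>2 \<partial>vol B) < e" if "m \<ge> N" "n \<ge> N" for m n
      using N[OF that] le[of m n] by linarith
    then show "\<exists>N. \<forall>m\<ge>N. \<forall>n\<ge>N. (\<integral>x. (norm (u m x - u n x))\<^sup>2 \<partial>vol B) < e" by blast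
  qed
  then obtain v where v: "L2_tendsto (vol B) u v" by blast
  have vH: "sobolev_trace v H f" by (rule sobolev_trace_closed[OF uG(1) v H])
  have HL: "L2 (vol B) H" using H by (simp add: L2_tendsto_def)
  have "E H \<le> d"
  proof (rule LIMSEQ_le)
    show "(\<lambda>n. E (G n)) \<longlonglongrightarrow> E H" unfolding E_def by (rule L2_tendsto_norm[OF H])
    show "(\<lambda>n. d + inverse (real (Suc n))) \<longlonglongrightarrow> d"
      using tendsto_add[OF tendsto_const LIMSEQ_inverse_real_of_nat, of d] by simp
    show "\<exists>N. \<forall>n\<ge>N. E (G n) \<le> d + inverse (real (Suc n))" using uG(2) less_imp_le by blast
  qed
  \<comment> \<open>First variation: a quadratic polynomial in t that is nonnegative everywhere and
    vanishes at 0 has no linear term.\<close>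
  have orth: "(\<integral>x. H x \<bullet> D x \<partial>vol B) = 0" if D: "sobolev_trace \<omega> D (\<lambda>x. 0)" for \<omega> D
  proof -
    let ?a = "\<integral>x. H x \<bullet> D x \<partial>vol B"
    have DL: "L2 (vol B) D" by (rule sobolev_trace_L2(2)[OF D])
    have ge: "0 \<le> 2 * t * ?a + t\<^sup>2 * E D" for t
    proof -
      have "sobolev_trace (\<lambda>x. v x + t *\<^sub>R \<omega> x) (\<lambda>x. H x + t *\<^sub>R D x) (\<lambda>x. f x + t *\<^sub>R 0)"
        by (intro sobolev_trace_add sobolev_trace_scaleR vH D)
      then have "E H \<le> E (\<lambda>x. H x + t *\<^sub>R D x)" using d_le \<open>E H \<le> d\<close> by fastforce
      moreover have "(norm (H x + t *\<^sub>R D x))\<^sup>2 = (norm (H x))\<^sup>2 + (2 * t) * (H x \<bullet> D x) + t\<^sup>2 * (norm (D x))\<^sup>2" for x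
        by (rule norm_add_scaleR_power2)
      ultimately have "E H \<le> (\<integral>x. (norm (H x))\<^sup>2 + (2 * t) * (H x \<bullet> D x) + t\<^sup>2 * (norm (D x))\<^sup>2 \<partial>vol B)"
        by (simp add: E_def)
      also have "\<dots> = E H + 2 * t * ?a + t\<^sup>2 * E D"
        using L2_integrable[OF HL] L2_integrable[OF DL] L2_bilinear_integrable[OF bounded_bilinear_inner HL DL]
        by (simp add: E_def)
      finally show ?thesis by simp
    qed
    have "0 \<le> E D" by (simp add: E_def)
    show ?thesis
    proof (rule ccontr)
      assume a: "?a \<noteq> 0"
      \<comment> \<open>The natural choice would divide by \<open>E D\<close>; the added 1 avoids
        division by zero and still gives a negative value.\<close>
      define t where "t = - ?a / (E D + 1)"
      have "2 * t * ?a + t\<^sup>2 * E D = - (?a\<^sup>2 * (E D + 2)) / (E D + 1)\<^sup>2"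
        using \<open>0 \<le> E D\<close> by (simp add: t_def power2_eq_square divide_simps) (simp add: algebra_simps)
      also have "\<dots> < 0" using a \<open>0 \<le> E D\<close> by (simp add: divide_neg_pos)
      finally show False using ge[of t] by simp
    qed
  qed
  \<comment> \<open>Varying in the direction of a test function times a basis vector yields one
    component of the vector-valued equation.\<close>
  have "(\<integral>x. (\<Sum>j\<in>UNIV. gradient \<psi> x $ j *\<^sub>R (H x $ j)) \<partial>vol B) = 0" if \<psi>: "test_function B \<psi>" for \<psi>
  proof (rule euclidean_eqI)
    fix e :: 'a assume "e \<in> Basis"
    have i: "integrable (vol B) (\<lambda>x. \<Sum>j\<in>UNIV. gradient \<psi> x $ j *\<^sub>R (H x $ j))"
      by (intro Bochner_Integration.integrable_sum L2_bilinear_integrable[OF bounded_bilinear_scaleR] L2_nth HL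
        L2_continuous_B smooth_continuous smooth_partial test_function_smooth[OF \<psi>])
    have "(\<integral>x. (\<Sum>j\<in>UNIV. gradient \<psi> x $ j *\<^sub>R (H x $ j)) \<partial>vol B) \<bullet> e
        = (\<integral>x. (\<Sum>j\<in>UNIV. gradient \<psi> x $ j *\<^sub>R (H x $ j)) \<bullet> e \<partial>vol B)"
      using i by simp
    also have "\<dots> = (\<integral>x. H x \<bullet> (\<chi> j. gradient \<psi> x $ j *\<^sub>R e) \<partial>vol B)"
      by (simp add: inner_vec_def inner_sum_left)
    also have "\<dots> = 0" by (rule orth[OF sobolev_trace_test_function[OF \<psi>]])
    finally show "(\<integral>x. (\<Sum>j\<in>UNIV. gradient \<psi> x $ j *\<^sub>R (H x $ j)) \<partial>vol B) \<bullet> e = 0 \<bullet> e" by simp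
  qed
  with vH show ?thesis by blast
qed

section \<open>Inverting x . grad + N + 1 on functions in the ball\<close>

subsection \<open>Radial averages\<close>

text \<open>On homogeneous polynomials of degree l this is division by l + N + 1, so it inverts the
  operator x . grad + N + 1; see \<open>radial_average_Euler\<close>.\<close>

definition radial_average :: "nat \<Rightarrow> (real^3 \<Rightarrow> 'a::euclidean_space) \<Rightarrow> real^3 \<Rightarrow> 'a" where
  "radial_average N \<phi> x = integral {0..1} (\<lambda>t. t ^ N *\<^sub>R \<phi> (t *\<^sub>R x))"

lemma radial_average_integrable:
  fixes \<phi> :: "real^3 \<Rightarrow> 'a::euclidean_space"
  assumes "smooth \<phi>"
  shows "(\<lambda>t. t ^ N *\<^sub>R \<phi> (t *\<^sub>R x)) integrable_on {0..1}"
  by (intro integrable_continuous_interval continuous_intros continuous_on_radial smooth_continuous assms)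

text \<open>Differentiation under the integral: the chain rule contributes a factor t, so partial
  derivatives of averages are again averages, with N raised by one.\<close>

lemma radial_average_has_derivative:
  fixes \<phi> :: "real^3 \<Rightarrow> 'a::euclidean_space"
  assumes \<phi>: "smooth \<phi>"
  shows "(radial_average N \<phi> has_derivative
    (\<lambda>h. \<Sum>i\<in>UNIV. h $ i *\<^sub>R radial_average (N + 1) (\<lambda>x. gradient \<phi> x $ i) x)) (at x)"
proof -
  let ?C = "\<lambda>i::3. blinfun_inner_left (axis i (1::real))"
  let ?f = "\<lambda>x t. \<Sum>i\<in>UNIV. blinfun_scaleR_left (t ^ (N + 1) *\<^sub>R (gradient \<phi> (t *\<^sub>R x) $ i)) o\<^sub>L ?C i"
  have apply_f: "blinfun_apply (?f x t) h = (\<Sum>i\<in>UNIV. h $ i *\<^sub>R (t ^ (N + 1) *\<^sub>R (gradient \<phi> (t *\<^sub>R x) $ i)))" for x t h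
    by (simp add: blinfun.sum_left inner_axis' inner_axis)
  have cont: "continuous_on UNIV (\<lambda>(x::real^3, t::real). gradient \<phi> (t *\<^sub>R x) $ i)" for i
    unfolding case_prod_beta
    by (rule continuous_on_compose2[OF smooth_continuous[OF smooth_partial[OF \<phi>], of UNIV i]]) (intro continuous_intros, simp)
  have "((\<lambda>x. integral (cbox 0 1) (\<lambda>t. t ^ N *\<^sub>R \<phi> (t *\<^sub>R x))) has_derivative integral (cbox 0 1) (?f x)) (at x within UNIV)"
  proof (rule leibniz_rule)
    fix x :: "real^3" and t :: real
    have "((\<lambda>x. t *\<^sub>R x) has_derivative (\<lambda>h. t *\<^sub>R h)) (at x)"
      by (intro bounded_linear_imp_has_derivative bounded_linear_scaleR_right)
    from has_derivative_compose[OF this smooth_has_derivative[OF \<phi>]]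
    have "((\<lambda>x. \<phi> (t *\<^sub>R x)) has_derivative (\<lambda>h. \<Sum>i\<in>UNIV. (t *\<^sub>R h) $ i *\<^sub>R (gradient \<phi> (t *\<^sub>R x) $ i))) (at x)" .
    from bounded_linear.has_derivative[OF bounded_linear_scaleR_right this, of "t ^ N"]
    show "((\<lambda>x. t ^ N *\<^sub>R \<phi> (t *\<^sub>R x)) has_derivative blinfun_apply (?f x t)) (at x within UNIV)"
      unfolding apply_f by (simp add: scaleR_sum_right mult_ac)
  next
    show "continuous_on (UNIV \<times> cbox 0 1) (\<lambda>(x, t). ?f x t)"
      unfolding case_prod_beta
      by (intro continuous_intros bounded_linear.continuous_on[OF bounded_linear_blinfun_scaleR_left]
        continuous_on_subset[OF cont[unfolded case_prod_beta]] subset_UNIV)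
  qed (use radial_average_integrable[OF \<phi>] in auto)
  moreover have "blinfun_apply (integral (cbox 0 1) (?f x)) h =
      (\<Sum>i\<in>UNIV. h $ i *\<^sub>R radial_average (N + 1) (\<lambda>x. gradient \<phi> x $ i) x)" for h
  proof -
    have "?f x integrable_on cbox 0 1"
    proof (rule integrable_continuous)
      show "continuous_on (cbox 0 1) (?f x)"
        by (intro continuous_intros bounded_linear.continuous_on[OF bounded_linear_blinfun_scaleR_left]
          continuous_on_radial smooth_continuous smooth_partial \<phi>)
    qed
    then have "blinfun_apply (integral (cbox 0 1) (?f x)) h = integral (cbox 0 1) (\<lambda>t. blinfun_apply (?f x t) h)"
      by (rule blinfun_apply_integral)
    also have "\<dots> = (\<Sum>i\<in>UNIV. integral {0..1} (\<lambda>t. h $ i *\<^sub>R (t ^ (N + 1) *\<^sub>R (gradient \<phi> (t *\<^sub>R x) $ i))))"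
      unfolding apply_f cbox_interval
      by (intro Henstock_Kurzweil_Integration.integral_sum integrable_cmul radial_average_integrable smooth_partial \<phi>) auto
    also have "\<dots> = (\<Sum>i\<in>UNIV. h $ i *\<^sub>R radial_average (N + 1) (\<lambda>x. gradient \<phi> x $ i) x)"
      unfolding radial_average_def by (intro sum.cong refl integral_cmul)
    finally show ?thesis .
  qed
  then have "blinfun_apply (integral (cbox 0 1) (?f x)) =
      (\<lambda>h. \<Sum>i\<in>UNIV. h $ i *\<^sub>R radial_average (N + 1) (\<lambda>x. gradient \<phi> x $ i) x)" by (rule ext)
  ultimately show ?thesis
    by (simp only: radial_average_def[abs_def] cbox_interval)
qed

lemma gradient_radial_average:
  assumes "smooth \<phi>"
  shows "gradient (radial_average N \<phi>) x $ i = radial_average (N + 1) (\<lambda>x. gradient \<phi> x $ i) x"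
proof -
  have "(\<Sum>j\<in>UNIV. axis i 1 $ j *\<^sub>R radial_average (N + 1) (\<lambda>x. gradient \<phi> x $ j) x)
     = (\<Sum>j\<in>UNIV. if j = i then radial_average (N + 1) (\<lambda>x. gradient \<phi> x $ j) x else 0)"
    by (intro sum.cong refl) (simp add: axis_def)
  then show ?thesis using gradient_nth[OF radial_average_has_derivative[OF assms], where i=i] by simp
qed

lemma smooth_radial_average:
  assumes "smooth \<phi>" shows "smooth (radial_average N \<phi>)"
proof -
  have "C_diff k (radial_average N \<phi>)" if "smooth \<phi>" for k N and \<phi> :: "real^3 \<Rightarrow> 'a"
    using that
  proof (induction k arbitrary: N \<phi>)
    case 0
    then show ?case using has_derivative_continuous[OF radial_average_has_derivative]
      by (auto intro: continuous_at_imp_continuous_on)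
  next
    case (Suc k)
    show ?case
    proof (rule C_diff_SucI[OF radial_average_has_derivative[OF Suc.prems]])
      fix i
      have "C_diff k (\<lambda>x. gradient (radial_average N \<phi>) x $ i)"
        unfolding gradient_radial_average[OF Suc.prems] by (intro Suc.IH smooth_partial Suc.prems)
      then show "C_diff k (\<lambda>x. \<Sum>j\<in>UNIV. axis i 1 $ j *\<^sub>R radial_average (N + 1) (\<lambda>x. gradient \<phi> x $ j) x)"
        using gradient_nth[OF radial_average_has_derivative[OF Suc.prems], where i=i] by simp
    qed
  qed
  with assms show ?thesis by (simp add: smooth_def)
qed

text \<open>The fundamental theorem of calculus for t^(N+1) \<phi>(t x) on [0, 1]; the positive
  exponent kills the lower limit.\<close>

lemma radial_average_Euler:
  assumes \<phi>: "smooth \<phi>"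
  shows "(\<Sum>i\<in>UNIV. x $ i *\<^sub>R (gradient (radial_average N \<phi>) x $ i)) + (real N + 1) *\<^sub>R radial_average N \<phi> x = \<phi> x"
proof -
  let ?D = "\<lambda>t. (\<Sum>i\<in>UNIV. x $ i *\<^sub>R (t ^ (N + 1) *\<^sub>R (gradient \<phi> (t *\<^sub>R x) $ i))) + (real N + 1) *\<^sub>R (t ^ N *\<^sub>R \<phi> (t *\<^sub>R x))"
  have "(?D has_integral (1 ^ (N + 1) *\<^sub>R \<phi> (1 *\<^sub>R x) - 0 ^ (N + 1) *\<^sub>R \<phi> (0 *\<^sub>R x))) {0..1}"
  proof (rule fundamental_theorem_of_calculus)
    fix t :: real
    have "((\<lambda>t. t ^ (N + 1)) has_real_derivative (real N + 1) * t ^ N) (at t within {0..1})"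
      using DERIV_pow[of "N + 1" t "{0..1}"] by (simp add: add.commute)
    from has_vector_derivative_scaleR[OF this radial_derivative[OF \<phi>, of x]]
    show "((\<lambda>t. t ^ (N + 1) *\<^sub>R \<phi> (t *\<^sub>R x)) has_vector_derivative ?D t) (at t within {0..1})"
      by (simp add: scaleR_sum_right mult_ac)
  qed simp
  then have "integral {0..1} ?D = \<phi> x" by (simp add: integral_unique)
  moreover have "integral {0..1} ?D = (\<Sum>i\<in>UNIV. x $ i *\<^sub>R radial_average (N + 1) (\<lambda>x. gradient \<phi> x $ i) x) + (real N + 1) *\<^sub>R radial_average N \<phi> x"
  proof -
    have i: "(\<lambda>t. x $ i *\<^sub>R (t ^ (N + 1) *\<^sub>R (gradient \<phi> (t *\<^sub>R x) $ i))) integrable_on {0..1}" for i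
      by (intro integrable_cmul radial_average_integrable smooth_partial \<phi>)
    have "integral {0..1} ?D = integral {0..1} (\<lambda>t. \<Sum>i\<in>UNIV. x $ i *\<^sub>R (t ^ (N + 1) *\<^sub>R (gradient \<phi> (t *\<^sub>R x) $ i)))
       + integral {0..1} (\<lambda>t. (real N + 1) *\<^sub>R (t ^ N *\<^sub>R \<phi> (t *\<^sub>R x)))"
      by (intro Henstock_Kurzweil_Integration.integral_add integrable_sum i integrable_cmul radial_average_integrable \<phi>) auto
    also have "integral {0..1} (\<lambda>t. \<Sum>i\<in>UNIV. x $ i *\<^sub>R (t ^ (N + 1) *\<^sub>R (gradient \<phi> (t *\<^sub>R x) $ i)))
       = (\<Sum>i\<in>UNIV. integral {0..1} (\<lambda>t. x $ i *\<^sub>R (t ^ (N + 1) *\<^sub>R (gradient \<phi> (t *\<^sub>R x) $ i))))"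
      by (intro Henstock_Kurzweil_Integration.integral_sum i) auto
    finally show ?thesis by (simp only: integral_cmul radial_average_def)
  qed
  ultimately show ?thesis by (simp add: gradient_radial_average[OF \<phi>])
qed

lemma radial_average_lborel:
  fixes \<phi> :: "real^3 \<Rightarrow> 'a::euclidean_space"
  assumes "smooth \<phi>"
  shows "radial_average N \<phi> x = (\<integral>t. indicator {0..1} t *\<^sub>R (t ^ N *\<^sub>R \<phi> (t *\<^sub>R x)) \<partial>lborel)"
proof -
  have "continuous_on {0..1} (\<lambda>t. t ^ N *\<^sub>R \<phi> (t *\<^sub>R x))"
    by (intro continuous_intros continuous_on_radial smooth_continuous assms)
  then have "set_integrable lborel {0..1} (\<lambda>t. t ^ N *\<^sub>R \<phi> (t *\<^sub>R x))"
    unfolding set_integrable_def by (intro borel_integrable_compact) simp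
  from set_borel_integral_eq_integral(2)[OF this] show ?thesis
    by (simp add: radial_average_def set_lebesgue_integral_def)
qed

text \<open>By Cauchy-Schwarz the squared average is at most the integral of t^(2N) |\<phi>(t x)|^2
  over t. Substituting y = t x costs t^(-3), which 2 N \<ge> 3 absorbs.\<close>

lemma radial_average_L2_le:
  fixes \<phi> :: "real^3 \<Rightarrow> 'a::euclidean_space"
  assumes \<phi>: "smooth \<phi>" and N: "2 \<le> N"
  shows "(\<integral>x. (norm (radial_average N \<phi> x))\<^sup>2 \<partial>vol B) \<le> (\<integral>x. (norm (\<phi> x))\<^sup>2 \<partial>vol B)"
proof -
  have [measurable]: "\<phi> \<in> borel_measurable borel"
    by (rule borel_measurable_continuous_onI, rule smooth_continuous[OF \<phi>])
  have [measurable]: "B \<in> sets borel" by simp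
  let ?h = "\<lambda>x. ennreal ((norm (\<phi> x))\<^sup>2)"
  have conv: "ennreal (\<integral>x. (norm (g x))\<^sup>2 \<partial>vol B) = (\<integral>\<^sup>+x. ennreal ((norm (g x))\<^sup>2) * indicator B x \<partial>lborel)"
    if "smooth g" for g :: "real^3 \<Rightarrow> 'a"
    unfolding nn_integral_vol_B[symmetric]
    by (rule nn_integral_eq_integral[symmetric]) (auto intro!: L2_integrable L2_continuous_B smooth_continuous that)
  let ?G = "\<integral>\<^sup>+x. ?h x * indicator B x \<partial>lborel"
  let ?F = "\<lambda>x t. ennreal (t ^ (2 * N)) * indicator {0..1} t * (?h (t *\<^sub>R x) * indicator B x)"
  have "ennreal ((norm (radial_average N \<phi> x))\<^sup>2) * indicator B x \<le> (\<integral>\<^sup>+t. ?F x t \<partial>lborel)" for x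
  proof (cases "x \<in> B")
    case True
    have "continuous_on {0..1} (\<lambda>t. t ^ N *\<^sub>R \<phi> (t *\<^sub>R x))"
      by (intro continuous_intros continuous_on_radial smooth_continuous \<phi>)
    from norm_integral_interval_power2_le[OF _ this]
    have "ennreal ((norm (radial_average N \<phi> x))\<^sup>2) \<le> (\<integral>\<^sup>+t. ennreal ((norm (t ^ N *\<^sub>R \<phi> (t *\<^sub>R x)))\<^sup>2) * indicator {0..1} t \<partial>lborel)"
      unfolding radial_average_lborel[OF \<phi>] by simp
    also have "\<dots> = (\<integral>\<^sup>+t. ?F x t \<partial>lborel)"
      by (intro nn_integral_cong)
        (use True in \<open>auto simp: indicator_def power_mult_distrib power_mult mult.commute[of 2] simp flip: ennreal_mult\<close>)
    finally show ?thesis using True by simp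
  qed simp
  then have "(\<integral>\<^sup>+x. ennreal ((norm (radial_average N \<phi> x))\<^sup>2) * indicator B x \<partial>lborel) \<le> (\<integral>\<^sup>+x. \<integral>\<^sup>+t. ?F x t \<partial>lborel \<partial>lborel)"
    by (rule nn_integral_mono)
  also have "\<dots> = (\<integral>\<^sup>+t. \<integral>\<^sup>+x. ?F x t \<partial>lborel \<partial>lborel)"
    by (rule lborel_pair.Fubini') measurable
  also have "\<dots> \<le> (\<integral>\<^sup>+t. indicator {0..1} t * ?G \<partial>(lborel :: real measure))"
  proof (rule nn_integral_mono)
    fix t :: real
    show "(\<integral>\<^sup>+x. ?F x t \<partial>lborel) \<le> indicator {0..1} t * ?G"
    proof (cases "0 < t \<and> t \<le> 1")
      case True
      have "(\<integral>\<^sup>+x. ?F x t \<partial>lborel) = ennreal (t ^ (2 * N)) * (\<integral>\<^sup>+x. ?h (t *\<^sub>R x) * indicator B x \<partial>lborel)"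
        using True by (subst nn_integral_cmult[symmetric]) auto
      also have "\<dots> \<le> ennreal (t ^ 3) * (\<integral>\<^sup>+x. ?h (t *\<^sub>R x) * indicator B x \<partial>lborel)"
        using True N by (intro mult_right_mono ennreal_leI power_decreasing) auto
      also have "(\<integral>\<^sup>+x. ?h (t *\<^sub>R x) * indicator B x \<partial>lborel) = (\<integral>\<^sup>+x. ?h (t *\<^sub>R x) * indicator {y. norm y < t} (t *\<^sub>R x) \<partial>lborel)"
        using True by (intro nn_integral_cong) (auto simp: indicator_def)
      also have "ennreal (t ^ 3) * \<dots> = (\<integral>\<^sup>+y. ?h y * indicator {y. norm y < t} y \<partial>lborel)"
        using True by (intro nn_integral_dilate[symmetric]) auto
      also have "\<dots> \<le> ?G"
        by (intro nn_integral_mono) (use True in \<open>auto simp: indicator_def\<close>)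
      finally show ?thesis using True by simp
    next
      case False
      have "?F x t = 0" for x using False N by (auto simp: indicator_def)
      then have "(\<integral>\<^sup>+x. ?F x t \<partial>lborel) = (\<integral>\<^sup>+x. 0 \<partial>(lborel :: (real^3) measure))" by (rule nn_integral_cong)
      then show ?thesis by (simp only: nn_integral_const mult_zero_left zero_le)
    qed
  qed
  also have "\<dots> = ?G" by (subst nn_integral_multc) auto
  finally have "ennreal (\<integral>x. (norm (radial_average N \<phi> x))\<^sup>2 \<partial>vol B) \<le> ennreal (\<integral>x. (norm (\<phi> x))\<^sup>2 \<partial>vol B)"
    by (simp add: conv[OF \<phi>] conv[OF smooth_radial_average[OF \<phi>]])
  then show ?thesis by (subst (asm) ennreal_le_iff) auto
qed

lemma L2_tendsto_unique:
  assumes "L2_tendsto M F f" "L2_tendsto M F g"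
  shows "AE x in M. f x = g x"
proof -
  have L: "L2 M f" "L2 M g" using assms by (auto simp: L2_tendsto_def)
  have "L2_tendsto M (\<lambda>k x. F k x + (-1) *\<^sub>R F k x) (\<lambda>x. f x + (-1) *\<^sub>R g x)"
    by (intro L2_tendsto_add L2_tendsto_bounded_linear[OF bounded_linear_scaleR_right] assms)
  from L2_tendsto_norm[OF this] have "(\<integral>x. (norm (f x - g x))\<^sup>2 \<partial>M) = 0"
    by (simp add: LIMSEQ_const_iff)
  then have "AE x in M. (norm (f x - g x))\<^sup>2 = 0"
    by (subst (asm) integral_nonneg_eq_0_iff_AE) (auto intro!: L2_integrable L2_diff L)
  then show ?thesis by eventually_elim simp
qed

text \<open>Supplies limits of radial averages without defining the average of a mere L2 function:
  linearity and the contraction bound on differences make the images of a convergent sequence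
  Cauchy.\<close>

lemma L2_tendsto_Cauchy_dominated:
  fixes g :: "nat \<Rightarrow> 'b \<Rightarrow> 'w::euclidean_space"
  assumes F: "L2_tendsto M F f" and g: "\<And>k. L2 M (g k)"
    and le: "\<And>m n. (\<integral>x. (norm (g m x - g n x))\<^sup>2 \<partial>M) \<le> (\<integral>x. (norm (F m x - F n x))\<^sup>2 \<partial>M)"
  shows "\<exists>h. L2_tendsto M g h"
proof (rule L2_complete[OF g])
  have L: "\<And>k. L2 M (F k)" "L2 M f" using F by (auto simp: L2_tendsto_def)
  fix e :: real assume "e > 0"
  have "(\<lambda>k. \<integral>x. (norm (F k x - f x))\<^sup>2 \<partial>M) \<longlonglongrightarrow> 0" using F by (simp add: L2_tendsto_def)
  from order_tendstoD(2)[OF this, of "e / 4"] \<open>e > 0\<close>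
  obtain N where N: "\<And>k. k \<ge> N \<Longrightarrow> (\<integral>x. (norm (F k x - f x))\<^sup>2 \<partial>M) < e / 4"
    by (auto simp: eventually_sequentially)
  have "(\<integral>x. (norm (g m x - g n x))\<^sup>2 \<partial>M) < e" if "m \<ge> N" "n \<ge> N" for m n
  proof -
    have i: "integrable M (\<lambda>x. (norm (F k x - f x))\<^sup>2)" "integrable M (\<lambda>x. (norm (F m x - F n x))\<^sup>2)" for k
      by (intro L2_integrable L2_diff L)+
    have "(norm (F m x - F n x))\<^sup>2 \<le> 2 * (norm (F m x - f x))\<^sup>2 + 2 * (norm (F n x - f x))\<^sup>2" for x
      using norm_add_power2_le[of "F m x - f x" "f x - F n x"] by (simp add: norm_minus_commute[of "f x"])
    then have "(\<integral>x. (norm (F m x - F n x))\<^sup>2 \<partial>M) \<le> (\<integral>x. 2 * (norm (F m x - f x))\<^sup>2 + 2 * (norm (F n x - f x))\<^sup>2 \<partial>M)"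
      using i by (intro integral_mono) auto
    also have "\<dots> = 2 * (\<integral>x. (norm (F m x - f x))\<^sup>2 \<partial>M) + 2 * (\<integral>x. (norm (F n x - f x))\<^sup>2 \<partial>M)"
      using i by simp
    finally show ?thesis using N[OF that(1)] N[OF that(2)] le[of m n] by linarith
  qed
  then show "\<exists>N. \<forall>m\<ge>N. \<forall>n\<ge>N. (\<integral>x. (norm (g m x - g n x))\<^sup>2 \<partial>M) < e" by blast
qed

lemma radial_average_diff:
  assumes "smooth \<phi>" "smooth \<psi>"
  shows "radial_average N (\<lambda>x. \<phi> x - \<psi> x) x = radial_average N \<phi> x - radial_average N \<psi> x"
  unfolding radial_average_def scaleR_diff_right
  by (intro Henstock_Kurzweil_Integration.integral_diff radial_average_integrable assms)

lemma radial_average_L2_tendsto: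
  fixes \<phi> :: "nat \<Rightarrow> real^3 \<Rightarrow> 'a::euclidean_space"
  assumes "\<And>k. smooth (\<phi> k)" "L2_tendsto (vol B) \<phi> u" "2 \<le> N"
  shows "\<exists>v. L2_tendsto (vol B) (\<lambda>k. radial_average N (\<phi> k)) v"
proof (rule L2_tendsto_Cauchy_dominated[OF assms(2)])
  show "L2 (vol B) (radial_average N (\<phi> k))" for k
    by (intro L2_continuous_B smooth_continuous smooth_radial_average assms)
  show "(\<integral>x. (norm (radial_average N (\<phi> m) x - radial_average N (\<phi> n) x))\<^sup>2 \<partial>vol B)
      \<le> (\<integral>x. (norm (\<phi> m x - \<phi> n x))\<^sup>2 \<partial>vol B)" for m n
    using radial_average_L2_le[OF smooth_diff[OF assms(1) assms(1)] assms(3), of m n]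
    by (simp add: radial_average_diff assms)
qed

lemma test_function_dilate:
  assumes \<psi>: "test_function B \<psi>" and t: "0 < t" "t \<le> 1"
  shows "test_function B (\<lambda>y. \<psi> ((1 / t) *\<^sub>R y))"
proof -
  obtain K where K: "compact K" "K \<subseteq> B" "\<And>x. x \<notin> K \<Longrightarrow> \<psi> x = 0"
    using \<psi> unfolding test_function_def by blast
  have "(\<lambda>x. t *\<^sub>R x) ` K \<subseteq> B"
  proof clarify
    fix x assume "x \<in> K"
    then have "norm x < 1" using K(2) by auto
    moreover have "t * norm x \<le> 1 * norm x" using t by (intro mult_right_mono) auto
    ultimately have "t * norm x < 1" by linarith
    then show "t *\<^sub>R x \<in> B" using t by simp
  qed
  moreover have "\<psi> ((1 / t) *\<^sub>R y) = 0" if "y \<notin> (\<lambda>x. t *\<^sub>R x) ` K" for y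
  proof (rule K(3))
    show "(1 / t) *\<^sub>R y \<notin> K"
    proof
      assume "(1 / t) *\<^sub>R y \<in> K"
      then have "t *\<^sub>R (1 / t) *\<^sub>R y \<in> (\<lambda>x. t *\<^sub>R x) ` K" by (rule imageI)
      then show False using that t by simp
    qed
  qed
  moreover have "compact ((\<lambda>x. t *\<^sub>R x) ` K)" using K(1) by (intro compact_continuous_image continuous_intros)
  ultimately show ?thesis
    using smooth_dilate[OF test_function_smooth[OF \<psi>]] unfolding test_function_def by blast
qed

text \<open>For fixed t, scaling moves the dilation from \<phi> to the test function. G annihilates
  the dilated test function and may be subtracted from the gradient of \<phi>; so the pairing is
  controlled by their distance although \<phi> itself need not be harmonic.\<close>

lemma radial_average_weak_bound:
  fixes G :: "real^3 \<Rightarrow> 'a::euclidean_space ^ 3"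
  assumes \<psi>: "test_function B \<psi>" and N: "2 \<le> N" and GL: "L2 (vol B) G"
    and harm: "\<And>\<psi>. test_function B \<psi> \<Longrightarrow> (\<integral>x. (\<Sum>j\<in>UNIV. gradient \<psi> x $ j *\<^sub>R (G x $ j)) \<partial>vol B) = 0"
  obtains C where "\<And>\<phi>. smooth \<phi> \<Longrightarrow>
    norm (\<integral>x. (\<Sum>j\<in>UNIV. gradient \<psi> x $ j *\<^sub>R (gradient (radial_average N \<phi>) x $ j)) \<partial>vol B)
      \<le> C * sqrt (\<integral>x. (norm (gradient \<phi> x - G x))\<^sup>2 \<partial>vol B)"
proof -
  have s\<psi>: "smooth \<psi>" using \<psi> by (rule test_function_smooth)
  obtain K where K: "compact K" "K \<subseteq> B" "\<And>x. x \<notin> K \<Longrightarrow> gradient \<psi> x = 0"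
    using \<psi> by (rule test_functionD) blast
  obtain S where S: "0 \<le> S" "\<And>x. x \<in> K \<Longrightarrow> norm (gradient \<psi> x) \<le> S"
    using continuous_on_compact_bounded[OF K(1) smooth_gradient_continuous[OF s\<psi>]] by blast
  have S': "\<bar>gradient \<psi> x $ j\<bar> \<le> S" for x j
  proof -
    have "norm (gradient \<psi> x) \<le> S" using S K(3) by (cases "x \<in> K") auto
    then show ?thesis using component_le_norm_cart[of "gradient \<psi> x" j] by linarith
  qed
  let ?V = "measure (vol B) B"
  let ?e = "\<lambda>\<phi>. sqrt (\<integral>x. (norm (gradient \<phi> x - G x))\<^sup>2 \<partial>vol B)"
  have "norm (\<integral>x. (\<Sum>j\<in>UNIV. gradient \<psi> x $ j *\<^sub>R (gradient (radial_average N \<phi>) x $ j)) \<partial>vol B)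
      \<le> (3 * (S * sqrt ?V)) * ?e \<phi>" if \<phi>: "smooth \<phi>" for \<phi> :: "real^3 \<Rightarrow> 'a"
  proof -
    let ?f = "\<lambda>x t. \<Sum>j\<in>UNIV. gradient \<psi> x $ j *\<^sub>R (t ^ (N + 1) *\<^sub>R (gradient \<phi> (t *\<^sub>R x) $ j))"
    define A where "A t = (\<integral>x. ?f x t \<partial>lborel)" for t
    have gL: "L2 (vol B) (\<lambda>x. gradient \<phi> x $ j - G x $ j)" for j
      by (intro L2_diff L2_nth GL L2_continuous_B smooth_gradient_continuous \<phi>)
    have comp: "sqrt (\<integral>x. (norm (gradient \<phi> x $ j - G x $ j))\<^sup>2 \<partial>vol B) \<le> ?e \<phi>" for j
    proof (rule real_sqrt_le_mono, rule integral_mono)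
      show "integrable (vol B) (\<lambda>x. (norm (gradient \<phi> x $ j - G x $ j))\<^sup>2)" by (rule L2_integrable[OF gL])
      show "integrable (vol B) (\<lambda>x. (norm (gradient \<phi> x - G x))\<^sup>2)"
        by (intro L2_integrable L2_diff GL L2_continuous_B smooth_gradient_continuous \<phi>)
      show "(norm (gradient \<phi> x $ j - G x $ j))\<^sup>2 \<le> (norm (gradient \<phi> x - G x))\<^sup>2" for x
        using Finite_Cartesian_Product.norm_nth_le[of "gradient \<phi> x - G x" j] by (intro power_mono) auto
    qed
    have A_bound: "norm (A t) \<le> 3 * (S * sqrt ?V) * ?e \<phi>" if t: "0 < t" "t \<le> 1" for t
    proof -
      let ?\<psi> = "\<lambda>y. \<psi> ((1 / t) *\<^sub>R y)"
      have test: "test_function B ?\<psi>" by (rule test_function_dilate[OF \<psi> t])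
      have g\<psi>: "gradient ?\<psi> y $ j = (1 / t) * (gradient \<psi> ((1 / t) *\<^sub>R y) $ j)" for y j
        using gradient_dilate[OF s\<psi>, of "1 / t" y j] by simp
      let ?g = "\<lambda>y. \<Sum>j\<in>UNIV. gradient \<psi> ((1 / t) *\<^sub>R y) $ j *\<^sub>R (gradient \<phi> y $ j)"
      have cg: "continuous_on UNIV ?g"
        by (intro continuous_intros continuous_on_compose2[OF smooth_continuous[OF smooth_partial[OF s\<psi>], of UNIV]]
          smooth_continuous smooth_partial \<phi>) auto
      \<comment> \<open>Dilation pulls the support of the test function towards the origin, so
        integrals over space and over the ball agree.\<close>
      have zero: "gradient \<psi> ((1 / t) *\<^sub>R y) = 0" if "y \<notin> B" for y
      proof (rule K(3))
        have "1 \<le> norm y" using that by simp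
        then have "1 \<le> norm ((1 / t) *\<^sub>R y)" using t by (simp add: field_simps)
        then show "(1 / t) *\<^sub>R y \<notin> K" using K(2) by auto
      qed
      have "A t = (\<integral>x. t ^ (N + 1) *\<^sub>R ?g (t *\<^sub>R x) \<partial>lborel)"
        unfolding A_def using t by (intro Bochner_Integration.integral_cong refl) (simp add: scaleR_sum_right mult.commute)
      also have "\<dots> = t ^ (N + 1) *\<^sub>R (\<integral>x. ?g (t *\<^sub>R x) \<partial>lborel)" by simp
      also have "(\<integral>x. ?g (t *\<^sub>R x) \<partial>lborel) = (1 / t ^ 3) *\<^sub>R (\<integral>y. ?g y \<partial>lborel)"
        using integral_dilate[OF t(1) borel_measurable_continuous_onI[OF cg]] t by simp
      also have "(\<integral>y. ?g y \<partial>lborel) = (\<integral>y. ?g y \<partial>vol B)"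
        by (rule integral_vol_B_eq_lborel[symmetric]) (simp add: zero)
      also have "(\<integral>y. ?g y \<partial>vol B) = t *\<^sub>R (\<integral>y. (\<Sum>j\<in>UNIV. gradient ?\<psi> y $ j *\<^sub>R (gradient \<phi> y $ j)) \<partial>vol B)"
      proof -
        have "?g y = t *\<^sub>R (\<Sum>j\<in>UNIV. gradient ?\<psi> y $ j *\<^sub>R (gradient \<phi> y $ j))" for y
          unfolding g\<psi> using t by (simp add: scaleR_sum_right)
        then show ?thesis by (simp only: integral_scaleR_right)
      qed
      also have "(\<integral>y. (\<Sum>j\<in>UNIV. gradient ?\<psi> y $ j *\<^sub>R (gradient \<phi> y $ j)) \<partial>vol B)
         = (\<integral>y. (\<Sum>j\<in>UNIV. gradient ?\<psi> y $ j *\<^sub>R (gradient \<phi> y $ j - G y $ j)) \<partial>vol B)"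
      proof -
        have L: "L2 (vol B) (\<lambda>y. gradient ?\<psi> y $ j)" for j
          by (intro L2_continuous_B smooth_continuous smooth_partial test_function_smooth[OF test])
        have i: "integrable (vol B) (\<lambda>y. \<Sum>j\<in>UNIV. gradient ?\<psi> y $ j *\<^sub>R (gradient \<phi> y $ j))"
            "integrable (vol B) (\<lambda>y. \<Sum>j\<in>UNIV. gradient ?\<psi> y $ j *\<^sub>R (G y $ j))"
          by (intro Bochner_Integration.integrable_sum L2_bilinear_integrable[OF bounded_bilinear_scaleR] L L2_nth GL
            L2_continuous_B smooth_gradient_continuous \<phi>)+
        then show ?thesis
          using harm[OF test] by (simp add: scaleR_diff_right sum_subtractf)
      qed
      \<comment> \<open>The power t^(N+1) comes from the gradient of the average, t^(-3) from the
        volume and t from the gradient of the dilated test function. That gradient is bounded by S /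
        t, and N \<ge> 2 makes the remaining t^(N-2) at most 1.\<close>
      also have "t ^ (N + 1) *\<^sub>R (1 / t ^ 3) *\<^sub>R t *\<^sub>R X = (t ^ (N - 2) * t) *\<^sub>R X" for X :: 'a
      proof -
        have "t ^ (N + 1) = t ^ (N - 2) * t ^ 3" using N by (simp flip: power_add)
        then show ?thesis using t by simp
      qed
      finally have At: "A t = (t ^ (N - 2) * t) *\<^sub>R (\<integral>y. (\<Sum>j\<in>UNIV. gradient ?\<psi> y $ j *\<^sub>R (gradient \<phi> y $ j - G y $ j)) \<partial>vol B)" .
      have "norm (\<integral>y. gradient ?\<psi> y $ j *\<^sub>R (gradient \<phi> y $ j - G y $ j) \<partial>vol B) \<le> (S / t * sqrt ?V) * ?e \<phi>" for j
      proof -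
        have L: "L2 (vol B) (\<lambda>y. gradient ?\<psi> y $ j)"
          by (intro L2_continuous_B smooth_continuous smooth_partial test_function_smooth[OF test])
        have "norm (\<integral>y. gradient ?\<psi> y $ j *\<^sub>R (gradient \<phi> y $ j - G y $ j) \<partial>vol B)
           \<le> (\<integral>y. norm (gradient ?\<psi> y $ j) * norm (gradient \<phi> y $ j - G y $ j) \<partial>vol B)"
          using integral_norm_bound[of "vol B" "\<lambda>y. gradient ?\<psi> y $ j *\<^sub>R (gradient \<phi> y $ j - G y $ j)"] by simp
        also have "\<dots> \<le> sqrt (\<integral>y. (norm (gradient ?\<psi> y $ j))\<^sup>2 \<partial>vol B) * sqrt (\<integral>y. (norm (gradient \<phi> y $ j - G y $ j))\<^sup>2 \<partial>vol B)"
          by (rule Cauchy_Schwarz_L2[OF L gL])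
        also have "\<dots> \<le> (S / t * sqrt ?V) * ?e \<phi>"
        proof (intro mult_mono comp)
          have "(\<integral>y. (norm (gradient ?\<psi> y $ j))\<^sup>2 \<partial>vol B) \<le> (\<integral>y. (S / t)\<^sup>2 \<partial>vol B)"
          proof (rule integral_mono)
            show "integrable (vol B) (\<lambda>y. (S / t)\<^sup>2)" by (rule finite_measure.integrable_const[OF finite_measure_vol_B])
            show "(norm (gradient ?\<psi> y $ j))\<^sup>2 \<le> (S / t)\<^sup>2" for y
              unfolding g\<psi> using S'[of "(1 / t) *\<^sub>R y" j] t by (intro power_mono) (simp_all add: divide_right_mono)
          qed (rule L2_integrable[OF L])
          also have "\<dots> = (S / t)\<^sup>2 * ?V" by simp
          finally have "sqrt (\<integral>y. (norm (gradient ?\<psi> y $ j))\<^sup>2 \<partial>vol B) \<le> sqrt ((S / t)\<^sup>2 * ?V)" by (rule real_sqrt_le_mono)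
          also have "\<dots> = S / t * sqrt ?V" using S t by (simp add: real_sqrt_mult)
          finally show "sqrt (\<integral>y. (norm (gradient ?\<psi> y $ j))\<^sup>2 \<partial>vol B) \<le> S / t * sqrt ?V" .
        qed (use S t in auto)
        finally show ?thesis .
      qed
      then have "(\<Sum>j\<in>UNIV. norm (\<integral>y. gradient ?\<psi> y $ j *\<^sub>R (gradient \<phi> y $ j - G y $ j) \<partial>vol B)) \<le> of_nat (card (UNIV :: 3 set)) * ((S / t * sqrt ?V) * ?e \<phi>)"
        by (intro sum_bounded_above) auto
      moreover have "(\<integral>y. (\<Sum>j\<in>UNIV. gradient ?\<psi> y $ j *\<^sub>R (gradient \<phi> y $ j - G y $ j)) \<partial>vol B)
        = (\<Sum>j\<in>UNIV. \<integral>y. gradient ?\<psi> y $ j *\<^sub>R (gradient \<phi> y $ j - G y $ j) \<partial>vol B)"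
        by (intro Bochner_Integration.integral_sum L2_bilinear_integrable[OF bounded_bilinear_scaleR] gL
            L2_continuous_B smooth_continuous smooth_partial test_function_smooth[OF test])
      ultimately have "norm (\<integral>y. (\<Sum>j\<in>UNIV. gradient ?\<psi> y $ j *\<^sub>R (gradient \<phi> y $ j - G y $ j)) \<partial>vol B) \<le> 3 * ((S / t * sqrt ?V) * ?e \<phi>)"
        by (simp only:) (rule order_trans[OF norm_sum], simp)
      then have "norm (A t) \<le> (t ^ (N - 2) * t) * (3 * ((S / t * sqrt ?V) * ?e \<phi>))"
        unfolding At norm_scaleR using t by (intro mult_mono) auto
      also have "\<dots> = t ^ (N - 2) * (3 * (S * sqrt ?V) * ?e \<phi>)" using t by (simp add: field_simps)
      also have "\<dots> \<le> 1 * (3 * (S * sqrt ?V) * ?e \<phi>)"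
        using t S by (intro mult_right_mono power_le_one) auto
      finally show ?thesis by simp
    qed
    let ?F = "\<lambda>x t. indicator {0..1} t *\<^sub>R ?f x t"
    \<comment> \<open>Joint integrability for Fubini: the integrand is continuous on the compact
      product and vanishes off it, since the gradient of \<psi> is 0 off K.\<close>
    have "continuous_on (K \<times> {0..1}) (\<lambda>z. ?f (fst z) (snd z))"
      by (intro continuous_intros continuous_on_compose2[OF smooth_continuous[OF smooth_partial[OF s\<psi>], of UNIV]]
        continuous_on_compose2[OF smooth_continuous[OF smooth_partial[OF \<phi>], of UNIV]]) auto
    then have "integrable lborel (\<lambda>z. indicator (K \<times> {0..1}) z *\<^sub>R ?f (fst z) (snd z))"
      by (intro borel_integrable_compact compact_Times K(1)) simp
    moreover have "(\<lambda>z. indicator (K \<times> {0..1}) z *\<^sub>R ?f (fst z) (snd z)) = (\<lambda>(x, t). ?F x t)"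
    proof (rule ext, clarify)
      fix x t
      show "indicator (K \<times> {0..1}) (x, t) *\<^sub>R ?f (fst (x, t)) (snd (x, t)) = ?F x t"
        using K(3)[of x] by (cases "x \<in> K") (simp_all add: indicator_def)
    qed
    ultimately have int: "integrable (lborel \<Otimes>\<^sub>M lborel) (\<lambda>(x, t). ?F x t)" by (simp add: lborel_prod)
    have inner: "(\<integral>t. ?F x t \<partial>lborel) = (\<Sum>j\<in>UNIV. gradient \<psi> x $ j *\<^sub>R (gradient (radial_average N \<phi>) x $ j))" for x
    proof -
      have c: "integrable lborel (\<lambda>t. indicator {0..1} t *\<^sub>R (t ^ (N + 1) *\<^sub>R (gradient \<phi> (t *\<^sub>R x) $ j)))" for j
        by (intro borel_integrable_compact continuous_intros continuous_on_radial smooth_gradient_continuous \<phi>) auto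
      have "(\<integral>t. ?F x t \<partial>lborel) = (\<integral>t. (\<Sum>j\<in>UNIV. gradient \<psi> x $ j *\<^sub>R (indicator {0..1} t *\<^sub>R (t ^ (N + 1) *\<^sub>R (gradient \<phi> (t *\<^sub>R x) $ j)))) \<partial>lborel)"
        by (intro Bochner_Integration.integral_cong refl) (simp add: scaleR_sum_right mult_ac)
      also have "\<dots> = (\<Sum>j\<in>UNIV. gradient \<psi> x $ j *\<^sub>R (\<integral>t. indicator {0..1} t *\<^sub>R (t ^ (N + 1) *\<^sub>R (gradient \<phi> (t *\<^sub>R x) $ j)) \<partial>lborel))"
        by (subst Bochner_Integration.integral_sum) (use c in \<open>auto simp del: scaleR_scaleR\<close>)
      also have "\<dots> = (\<Sum>j\<in>UNIV. gradient \<psi> x $ j *\<^sub>R (gradient (radial_average N \<phi>) x $ j))"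
        by (simp only: gradient_radial_average[OF \<phi>] radial_average_lborel[OF smooth_partial[OF \<phi>]])
      finally show ?thesis .
    qed
    have "(\<integral>x. (\<Sum>j\<in>UNIV. gradient \<psi> x $ j *\<^sub>R (gradient (radial_average N \<phi>) x $ j)) \<partial>vol B)
       = (\<integral>x. (\<Sum>j\<in>UNIV. gradient \<psi> x $ j *\<^sub>R (gradient (radial_average N \<phi>) x $ j)) \<partial>lborel)"
    proof (rule integral_vol_B_eq_lborel)
      fix x :: "real^3" assume "x \<notin> B"
      then have "gradient \<psi> x = 0" using K by blast
      then show "(\<Sum>j\<in>UNIV. gradient \<psi> x $ j *\<^sub>R (gradient (radial_average N \<phi>) x $ j)) = 0" by simp
    qed
    also have "\<dots> = (\<integral>x. \<integral>t. ?F x t \<partial>lborel \<partial>lborel)" by (simp only: inner)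
    also have "\<dots> = (\<integral>t. \<integral>x. ?F x t \<partial>lborel \<partial>lborel)" by (rule lborel_pair.Fubini_integral[OF int, symmetric])
    also have "\<dots> = (\<integral>t. indicator {0..1} t *\<^sub>R A t \<partial>lborel)" by (simp add: A_def)
    finally have eq: "(\<integral>x. (\<Sum>j\<in>UNIV. gradient \<psi> x $ j *\<^sub>R (gradient (radial_average N \<phi>) x $ j)) \<partial>vol B)
       = (\<integral>t. indicator {0..1} t *\<^sub>R A t \<partial>lborel)" .
    have "norm (\<integral>t. indicator {0..1} t *\<^sub>R A t \<partial>lborel) \<le> (\<integral>t. norm (indicator {0..1} t *\<^sub>R A t) \<partial>lborel)"
      by (rule integral_norm_bound)
    also have "\<dots> \<le> (\<integral>t. indicator {0..1} t *\<^sub>R (3 * (S * sqrt ?V) * ?e \<phi>) \<partial>(lborel :: real measure))"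
    proof (rule integral_mono_AE)
      have "integrable lborel (\<lambda>t. \<integral>x. ?F x t \<partial>lborel)" by (rule lborel_pair.integrable_snd[OF int])
      then have "integrable lborel (\<lambda>t. indicator {0..1} t *\<^sub>R A t)" by (simp only: A_def integral_scaleR_right)
      then show "integrable lborel (\<lambda>t. norm (indicator {0..1} t *\<^sub>R A t))" by (rule integrable_norm)
      show "integrable lborel (\<lambda>t::real. indicator {0..1} t *\<^sub>R (3 * (S * sqrt ?V) * ?e \<phi>))"
        by (intro borel_integrable_compact) auto
      show "AE t in lborel. norm (indicator {0..1} t *\<^sub>R A t) \<le> indicator {0..1} t *\<^sub>R (3 * (S * sqrt ?V) * ?e \<phi>)"
        using AE_lborel_singleton[of "0::real"]
      proof eventually_elim
        case (elim t)
        then show ?case using A_bound[of t] by (auto simp: indicator_def)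
      qed
    qed
    also have "\<dots> = 3 * (S * sqrt ?V) * ?e \<phi>" by simp
    finally show ?thesis by (simp only: eq)
  qed
  then show thesis by (rule that)
qed

text \<open>Averages of smooth approximations of u converge together with their gradients, and the
  Euler identity passes to the limit. The approximations need not be harmonic;
  \<open>radial_average_weak_bound\<close> shows that their defect tends to 0.\<close>

lemma radial_average_exists:
  fixes u :: "real^3 \<Rightarrow> 'a::euclidean_space"
  assumes u: "sobolev_trace u G f" and N: "2 \<le> N"
    and harm: "\<And>\<psi>. test_function B \<psi> \<Longrightarrow> (\<integral>x. (\<Sum>j\<in>UNIV. gradient \<psi> x $ j *\<^sub>R (G x $ j)) \<partial>vol B) = 0"
  shows "\<exists>v H. sobolev v H \<and>
    (\<forall>\<psi>. test_function B \<psi> \<longrightarrow> (\<integral>x. (\<Sum>j\<in>UNIV. gradient \<psi> x $ j *\<^sub>R (H x $ j)) \<partial>vol B) = 0) \<and>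
    (AE x in vol B. (\<Sum>i\<in>UNIV. x $ i *\<^sub>R (H x $ i)) + (real N + 1) *\<^sub>R v x = u x)"
proof -
  obtain \<phi> where \<phi>: "\<And>k. smooth (\<phi> k)" "L2_tendsto (vol B) \<phi> u"
     "L2_tendsto (vol B) (\<lambda>k. gradient (\<phi> k)) G" using u by (rule sobolev_traceE) blast
  have GL: "L2 (vol B) G" by (rule sobolev_trace_L2(2)[OF u])
  let ?v = "\<lambda>k. radial_average N (\<phi> k)"
  have sv: "smooth (?v k)" for k by (rule smooth_radial_average[OF \<phi>(1)])
  obtain v where v: "L2_tendsto (vol B) ?v v" using radial_average_L2_tendsto[OF \<phi>(1,2) N] by blast
  have "\<exists>h. L2_tendsto (vol B) (\<lambda>k x. gradient (?v k) x $ i) h" for i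
  proof -
    have "L2_tendsto (vol B) (\<lambda>k x. gradient (\<phi> k) x $ i) (\<lambda>x. G x $ i)" by (rule L2_tendsto_nth[OF \<phi>(3)])
    then have "\<exists>h. L2_tendsto (vol B) (\<lambda>k. radial_average (N + 1) (\<lambda>x. gradient (\<phi> k) x $ i)) h"
      using N by (intro radial_average_L2_tendsto smooth_partial \<phi>(1)) auto
    then show ?thesis by (simp only: gradient_radial_average[OF \<phi>(1)])
  qed
  then have "\<forall>i. \<exists>h. L2_tendsto (vol B) (\<lambda>k x. gradient (?v k) x $ i) h" by blast
  from choice[OF this] obtain h where h: "\<And>i. L2_tendsto (vol B) (\<lambda>k x. gradient (?v k) x $ i) (h i)" by blast
  define H where "H x = (\<chi> i. h i x)" for x
  have H: "L2_tendsto (vol B) (\<lambda>k. gradient (?v k)) H"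
  proof -
    have "L2_tendsto (vol B) (\<lambda>k x. \<chi> i. gradient (?v k) x $ i) (\<lambda>x. \<chi> i. h i x)"
      by (rule L2_tendsto_vec_lambda) (rule h)
    then show ?thesis by (simp add: H_def[abs_def] vec_lambda_eta)
  qed
  have sob: "sobolev v H" unfolding sobolev_def by (intro exI[of _ ?v] conjI allI sv v H)
  have "L2_tendsto (vol B) (\<lambda>k x. (\<Sum>i\<in>UNIV. x $ i *\<^sub>R (gradient (?v k) x $ i)) + (real N + 1) *\<^sub>R ?v k x)
     (\<lambda>x. (\<Sum>i\<in>UNIV. x $ i *\<^sub>R (H x $ i)) + (real N + 1) *\<^sub>R v x)"
  proof -
    have "L2_tendsto (vol B) (\<lambda>k x. \<Sum>i\<in>I. x $ i *\<^sub>R (gradient (?v k) x $ i)) (\<lambda>x. \<Sum>i\<in>I. x $ i *\<^sub>R (H x $ i))"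
      if "finite I" for I
      using that
      by induction (auto intro!: L2_tendsto_const L2_zero L2_tendsto_add L2_tendsto_smooth_mult smooth_nth L2_tendsto_nth H)
    then show ?thesis
      by (intro L2_tendsto_add L2_tendsto_bounded_linear[OF bounded_linear_scaleR_right] v) simp
  qed
  \<comment> \<open>By the Euler identity the sequence is the approximating sequence itself, whose
    two L2 limits agree almost everywhere.\<close>
  then have "L2_tendsto (vol B) \<phi> (\<lambda>x. (\<Sum>i\<in>UNIV. x $ i *\<^sub>R (H x $ i)) + (real N + 1) *\<^sub>R v x)"
    by (simp only: radial_average_Euler[OF \<phi>(1)])
  from L2_tendsto_unique[OF this \<phi>(2)]
  have Euler: "AE x in vol B. (\<Sum>i\<in>UNIV. x $ i *\<^sub>R (H x $ i)) + (real N + 1) *\<^sub>R v x = u x" .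
  have "(\<integral>x. (\<Sum>j\<in>UNIV. gradient \<psi> x $ j *\<^sub>R (H x $ j)) \<partial>vol B) = 0" if \<psi>: "test_function B \<psi>" for \<psi>
  proof -
    obtain C where C: "\<And>\<phi>. smooth \<phi> \<Longrightarrow>
      norm (\<integral>x. (\<Sum>j\<in>UNIV. gradient \<psi> x $ j *\<^sub>R (gradient (radial_average N \<phi>) x $ j)) \<partial>vol B)
      \<le> C * sqrt (\<integral>x. (norm (gradient \<phi> x - G x))\<^sup>2 \<partial>vol B)"
      using radial_average_weak_bound[OF \<psi> N GL harm] by blast
    have "(\<lambda>k. C * sqrt (\<integral>x. (norm (gradient (\<phi> k) x - G x))\<^sup>2 \<partial>vol B)) \<longlonglongrightarrow> C * sqrt 0"
      using \<phi>(3) unfolding L2_tendsto_def by (intro tendsto_intros) blast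
    then have "(\<lambda>k. norm (\<integral>x. (\<Sum>j\<in>UNIV. gradient \<psi> x $ j *\<^sub>R (gradient (?v k) x $ j)) \<partial>vol B)) \<longlonglongrightarrow> 0"
      by (intro LIMSEQ_0_upper[OF _ _ C[OF \<phi>(1)]]) auto
    then have "(\<lambda>k. \<integral>x. (\<Sum>j\<in>UNIV. gradient \<psi> x $ j *\<^sub>R (gradient (?v k) x $ j)) \<partial>vol B) \<longlonglongrightarrow> 0"
      by (rule tendsto_norm_zero_cancel)
    moreover have "(\<lambda>k. \<integral>x. (\<Sum>j\<in>UNIV. gradient \<psi> x $ j *\<^sub>R (gradient (?v k) x $ j)) \<partial>vol B)
       \<longlonglongrightarrow> (\<integral>x. (\<Sum>j\<in>UNIV. gradient \<psi> x $ j *\<^sub>R (H x $ j)) \<partial>vol B)"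
    proof -
      have sc: "bounded_bilinear (\<lambda>(a::'a) (r::real). r *\<^sub>R a)"
        by (rule bounded_bilinear.flip[OF bounded_bilinear_scaleR])
      have L: "L2 (vol B) (\<lambda>x. gradient \<psi> x $ j)" for j
        by (intro L2_continuous_B smooth_continuous smooth_partial test_function_smooth[OF \<psi>])
      have split: "(\<integral>x. (\<Sum>j\<in>UNIV. gradient \<psi> x $ j *\<^sub>R (D x $ j)) \<partial>vol B) = (\<Sum>j\<in>UNIV. \<integral>x. gradient \<psi> x $ j *\<^sub>R (D x $ j) \<partial>vol B)"
        if "L2 (vol B) D" for D :: "real^3 \<Rightarrow> 'a^3"
        by (intro Bochner_Integration.integral_sum L2_bilinear_integrable[OF bounded_bilinear_scaleR] L L2_nth that)
      have "(\<lambda>k. \<Sum>j\<in>UNIV. \<integral>x. gradient \<psi> x $ j *\<^sub>R (gradient (?v k) x $ j) \<partial>vol B)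
         \<longlonglongrightarrow> (\<Sum>j\<in>UNIV. \<integral>x. gradient \<psi> x $ j *\<^sub>R (H x $ j) \<partial>vol B)"
        by (intro tendsto_sum L2_tendsto_integral_bilinear[OF sc] L2_tendsto_nth H L)
      then show ?thesis using H by (simp add: split L2_tendsto_def)
    qed
    ultimately show ?thesis using LIMSEQ_unique by blast
  qed
  with sob Euler show ?thesis by blast
qed

section \<open>Green's formula and independence of all choices in the definition of the map\<close>

subsection \<open>The Dirichlet-to-Neumann map\<close>

lemma is_weak_laplacianI:
  fixes u :: "real^3 \<Rightarrow> 'a::euclidean_space"
  assumes G: "is_weak_gradient B u G" and h: "L2 (vol B) h"
    and eq: "\<And>\<psi>. test_function B \<psi> \<Longrightarrow>
      (\<integral>x. (\<Sum>j\<in>UNIV. gradient \<psi> x $ j *\<^sub>R (G x $ j)) + \<psi> x *\<^sub>R h x \<partial>vol B) = 0"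
  shows "is_weak_laplacian B u h"
  unfolding is_weak_laplacian_def
proof (intro conjI allI impI)
  show H1: "u \<in> H1 B" using G by (auto simp: H1_def)
  show "L2 (vol B) h" by (rule h)
  have GL: "L2 (vol B) G" "L2 (vol B) (weak_gradient B u)"
    using G is_weak_gradient_weak_gradient[OF H1] by (auto simp: is_weak_gradient_def)
  fix \<psi> assume \<psi>: "test_function B \<psi>"
  then have s: "smooth \<psi>" by (rule test_function_smooth)
  have L: "L2 (vol B) (\<lambda>x. gradient \<psi> x $ j)" "L2 (vol B) \<psi>" for j
    by (intro L2_continuous_B smooth_continuous smooth_partial s)+
  have i: "integrable (vol B) (\<lambda>x. \<Sum>j\<in>UNIV. gradient \<psi> x $ j *\<^sub>R (F x $ j))" if "L2 (vol B) F" for F :: "real^3 \<Rightarrow> 'a^3"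
    by (intro Bochner_Integration.integrable_sum L2_bilinear_integrable[OF bounded_bilinear_scaleR] L2_nth L that)
  have "(\<integral>x. (\<Sum>j\<in>UNIV. gradient \<psi> x $ j *\<^sub>R (weak_gradient B u x $ j)) \<partial>vol B)
     = (\<integral>x. (\<Sum>j\<in>UNIV. gradient \<psi> x $ j *\<^sub>R (G x $ j)) \<partial>vol B)"
  proof (rule integral_cong_AE)
    show "AE x in vol B. (\<Sum>j\<in>UNIV. gradient \<psi> x $ j *\<^sub>R (weak_gradient B u x $ j)) = (\<Sum>j\<in>UNIV. gradient \<psi> x $ j *\<^sub>R (G x $ j))"
      using weak_gradient_AE[OF G] by eventually_elim simp
  qed (use i[OF GL(1)] i[OF GL(2)] in auto)
  also have "\<dots> = - (\<integral>x. \<psi> x *\<^sub>R h x \<partial>vol B)"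
    using eq[OF \<psi>] i[OF GL(1)] L2_bilinear_integrable[OF bounded_bilinear_scaleR L(2) h]
    by (simp add: eq_neg_iff_add_eq_0)
  finally show "(\<integral>x. (\<Sum>j\<in>UNIV. gradient \<psi> x $ j *\<^sub>R (weak_gradient B u x $ j)) \<partial>vol B) = - (\<integral>x. \<psi> x *\<^sub>R h x \<partial>vol B)" .
qed

lemma is_weak_laplacianD:
  fixes u :: "real^3 \<Rightarrow> 'a::euclidean_space"
  assumes u: "is_weak_laplacian B u h"
  shows "L2 (vol B) (weak_gradient B u)" "L2 (vol B) u" "L2 (vol B) h"
    "\<And>\<psi>. test_function B \<psi> \<Longrightarrow>
      (\<integral>x. (\<Sum>j\<in>UNIV. gradient \<psi> x $ j *\<^sub>R (weak_gradient B u x $ j)) + \<psi> x *\<^sub>R h x \<partial>vol B) = 0"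
proof -
  have H1: "u \<in> H1 B" using u by (simp add: is_weak_laplacian_def)
  show GL: "L2 (vol B) (weak_gradient B u)" "L2 (vol B) u"
    using is_weak_gradient_weak_gradient[OF H1] by (auto simp: is_weak_gradient_def)
  show h: "L2 (vol B) h" using u by (simp add: is_weak_laplacian_def)
  fix \<psi> assume \<psi>: "test_function B \<psi>"
  then have s: "smooth \<psi>" by (rule test_function_smooth)
  have L: "L2 (vol B) (\<lambda>x. gradient \<psi> x $ j)" "L2 (vol B) \<psi>" for j
    by (intro L2_continuous_B smooth_continuous smooth_partial s)+
  have "integrable (vol B) (\<lambda>x. \<Sum>j\<in>UNIV. gradient \<psi> x $ j *\<^sub>R (weak_gradient B u x $ j))"
    by (intro Bochner_Integration.integrable_sum L2_bilinear_integrable[OF bounded_bilinear_scaleR] L2_nth L GL)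
  with u \<psi> show "(\<integral>x. (\<Sum>j\<in>UNIV. gradient \<psi> x $ j *\<^sub>R (weak_gradient B u x $ j)) + \<psi> x *\<^sub>R h x \<partial>vol B) = 0"
    using L2_bilinear_integrable[OF bounded_bilinear_scaleR L(2) h] by (simp add: is_weak_laplacian_def)
qed

text \<open>Two extensions of g differ by a function of zero trace, which the weak equation
  annihilates.\<close>

lemma Green_well_defined:
  fixes u :: "real^3 \<Rightarrow> 'a::{real_normed_field,euclidean_space}"
  assumes u: "is_weak_laplacian B u h" and w: "sobolev_trace w K g" and w': "sobolev_trace w' K' g"
  shows "(\<integral>x. (\<Sum>i\<in>UNIV. weak_gradient B u x $ i * K' x $ i) + h x * w' x \<partial>vol B)
    = (\<integral>x. (\<Sum>i\<in>UNIV. weak_gradient B u x $ i * K x $ i) + h x * w x \<partial>vol B)"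
proof -
  note uD = is_weak_laplacianD[OF u]
  have "sobolev_trace (\<lambda>x. w' x - w x) (\<lambda>x. K' x - K x) (\<lambda>x. 0)"
    using sobolev_trace_diff[OF w' w] by simp
  from weak_equation_zero_trace[OF bounded_bilinear_mult uD(1,3,4) this]
  have 0: "(\<integral>x. (\<Sum>j\<in>UNIV. (K' x - K x) $ j * weak_gradient B u x $ j) + (w' x - w x) * h x \<partial>vol B) = 0" .
  have i: "integrable (vol B) (\<lambda>x. (\<Sum>i\<in>UNIV. weak_gradient B u x $ i * D x $ i) + h x * \<omega> x)"
    if "L2 (vol B) D" "L2 (vol B) \<omega>" for D \<omega>
    by (intro Bochner_Integration.integrable_add Bochner_Integration.integrable_sum
      L2_bilinear_integrable[OF bounded_bilinear_mult] L2_nth uD that)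
  have "(\<integral>x. (\<Sum>i\<in>UNIV. weak_gradient B u x $ i * K' x $ i) + h x * w' x \<partial>vol B)
    - (\<integral>x. (\<Sum>i\<in>UNIV. weak_gradient B u x $ i * K x $ i) + h x * w x \<partial>vol B)
    = (\<integral>x. ((\<Sum>i\<in>UNIV. weak_gradient B u x $ i * K' x $ i) + h x * w' x)
        - ((\<Sum>i\<in>UNIV. weak_gradient B u x $ i * K x $ i) + h x * w x) \<partial>vol B)"
    by (rule Bochner_Integration.integral_diff[symmetric]; rule i; rule sobolev_trace_L2[OF w] sobolev_trace_L2[OF w'])
  also have "\<dots> = (\<integral>x. (\<Sum>j\<in>UNIV. (K' x - K x) $ j * weak_gradient B u x $ j) + (w' x - w x) * h x \<partial>vol B)"
    by (intro Bochner_Integration.integral_cong refl) (simp add: algebra_simps sum_subtractf)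
  finally show ?thesis using 0 by simp
qed

text \<open>Discharges the definite description: the weak Laplacian is unique almost everywhere, and
  the extension of g does not matter.\<close>

lemma normal_derivative_eq:
  fixes u :: "real^3 \<Rightarrow> 'a::{real_normed_field,euclidean_space}"
  assumes u: "is_weak_laplacian B u h" and w: "sobolev_trace w K g"
  shows "normal_derivative u g = (\<integral>x. (\<Sum>i\<in>UNIV. weak_gradient B u x $ i * K x $ i) + h x * w x \<partial>vol B)"
  unfolding normal_derivative_def
proof (rule the_equality)
  have w': "sobolev_trace w (weak_gradient B w) g"
    by (rule has_trace_imp_sobolev_trace[OF sobolev_trace_imp_has_trace[OF w]])
  show "\<exists>h' v. is_weak_laplacian B u h' \<and> has_trace v g \<and>
      (\<integral>x. (\<Sum>i\<in>UNIV. weak_gradient B u x $ i * K x $ i) + h x * w x \<partial>vol B)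
      = (\<integral>x. (\<Sum>i\<in>UNIV. weak_gradient B u x $ i * weak_gradient B v x $ i) + h' x * v x \<partial>vol B)"
    by (rule exI[of _ h], rule exI[of _ w])
      (simp add: u sobolev_trace_imp_has_trace[OF w] Green_well_defined[OF u w w'])
  fix c
  assume "\<exists>h' v. is_weak_laplacian B u h' \<and> has_trace v g \<and>
      c = (\<integral>x. (\<Sum>i\<in>UNIV. weak_gradient B u x $ i * weak_gradient B v x $ i) + h' x * v x \<partial>vol B)"
  then obtain h' v where h': "is_weak_laplacian B u h'" and v: "has_trace v g"
    and c: "c = (\<integral>x. (\<Sum>i\<in>UNIV. weak_gradient B u x $ i * weak_gradient B v x $ i) + h' x * v x \<partial>vol B)" by blast
  have v': "sobolev_trace v (weak_gradient B v) g" by (rule has_trace_imp_sobolev_trace[OF v])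
  note uD = is_weak_laplacianD[OF u] and uD' = is_weak_laplacianD[OF h']
  have "AE x in vol B. h' x - h x = 0"
  proof (rule test_functions_separate)
    show "L2 (vol B) (\<lambda>x. h' x - h x)" by (intro L2_diff uD uD')
    fix \<psi> assume \<psi>: "test_function B \<psi>"
    then have L: "L2 (vol B) \<psi>" by (intro L2_continuous_B smooth_continuous test_function_smooth)
    have "(\<integral>x. \<psi> x *\<^sub>R h' x \<partial>vol B) = (\<integral>x. \<psi> x *\<^sub>R h x \<partial>vol B)"
      using u h' \<psi> unfolding is_weak_laplacian_def by simp
    then show "(\<integral>x. \<psi> x *\<^sub>R (h' x - h x) \<partial>vol B) = 0"
      using L2_bilinear_integrable[OF bounded_bilinear_scaleR L uD(3)]
        L2_bilinear_integrable[OF bounded_bilinear_scaleR L uD'(3)] by (simp add: scaleR_diff_right)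
  qed
  then have "c = (\<integral>x. (\<Sum>i\<in>UNIV. weak_gradient B u x $ i * weak_gradient B v x $ i) + h x * v x \<partial>vol B)"
    unfolding c
  proof (intro integral_cong_AE)
    have "(\<lambda>x. (\<Sum>i\<in>UNIV. weak_gradient B u x $ i * weak_gradient B v x $ i) + k x * v x) \<in> borel_measurable (vol B)"
      if "L2 (vol B) k" for k
      by (intro borel_measurable_integrable Bochner_Integration.integrable_add Bochner_Integration.integrable_sum
        L2_bilinear_integrable[OF bounded_bilinear_mult] L2_nth uD that sobolev_trace_L2[OF v'])
    then show "(\<lambda>x. (\<Sum>i\<in>UNIV. weak_gradient B u x $ i * weak_gradient B v x $ i) + h' x * v x) \<in> borel_measurable (vol B)"
      "(\<lambda>x. (\<Sum>i\<in>UNIV. weak_gradient B u x $ i * weak_gradient B v x $ i) + h x * v x) \<in> borel_measurable (vol B)"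
      using uD(3) uD'(3) by blast+
  qed (auto elim: eventually_mono)
  also have "\<dots> = (\<integral>x. (\<Sum>i\<in>UNIV. weak_gradient B u x $ i * K x $ i) + h x * w x \<partial>vol B)"
    by (rule Green_well_defined[OF u w v'])
  finally show "c = (\<integral>x. (\<Sum>i\<in>UNIV. weak_gradient B u x $ i * K x $ i) + h x * w x \<partial>vol B)" .
qed

text \<open>The equation for the difference is tested with the difference itself; q \<ge> 0 forces
  the energy to vanish, and the Poincare inequality then forces the function to vanish.\<close>

lemma dirichlet_solution_unique:
  fixes u u' :: "real^3 \<Rightarrow> 'a::euclidean_space"
  assumes q: "\<And>x. x \<in> B \<Longrightarrow> 0 \<le> q x"
    and u: "dirichlet_solution q f u" and u': "dirichlet_solution q f u'"
  shows "AE x in vol B. u x = u' x" "AE x in vol B. weak_gradient B u x = weak_gradient B u' x"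
proof -
  note uD = is_weak_laplacianD[OF u[unfolded dirichlet_solution_def, THEN conjunct1]]
    and uD' = is_weak_laplacianD[OF u'[unfolded dirichlet_solution_def, THEN conjunct1]]
  let ?d = "\<lambda>x. u x - u' x" and ?D = "\<lambda>x. weak_gradient B u x - weak_gradient B u' x"
  have tr: "sobolev_trace ?d ?D (\<lambda>x. 0)"
    using sobolev_trace_diff[OF has_trace_imp_sobolev_trace has_trace_imp_sobolev_trace, of u f u' f] u u'
    by (simp add: dirichlet_solution_def)
  have DL: "L2 (vol B) ?D" "L2 (vol B) ?d" "L2 (vol B) (\<lambda>x. q x *\<^sub>R u x - q x *\<^sub>R u' x)"
    by (intro L2_diff uD uD')+
  have "(\<integral>x. (\<Sum>j\<in>UNIV. ?D x $ j \<bullet> ?D x $ j) + ?d x \<bullet> (q x *\<^sub>R u x - q x *\<^sub>R u' x) \<partial>vol B) = 0"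
  proof (rule weak_equation_zero_trace[OF bounded_bilinear_inner DL(1,3) _ tr])
    fix \<psi> assume \<psi>: "test_function B \<psi>"
    then have s: "smooth \<psi>" by (rule test_function_smooth)
    have L: "L2 (vol B) (\<lambda>x. gradient \<psi> x $ j)" "L2 (vol B) \<psi>" for j
      by (intro L2_continuous_B smooth_continuous smooth_partial s)+
    have i: "integrable (vol B) (\<lambda>x. (\<Sum>j\<in>UNIV. gradient \<psi> x $ j *\<^sub>R (F x $ j)) + \<psi> x *\<^sub>R k x)"
      if "L2 (vol B) F" "L2 (vol B) k" for F :: "real^3 \<Rightarrow> 'a^3" and k
      by (intro Bochner_Integration.integrable_add Bochner_Integration.integrable_sum
        L2_bilinear_integrable[OF bounded_bilinear_scaleR] L2_nth L that)
    have "(\<integral>x. (\<Sum>j\<in>UNIV. gradient \<psi> x $ j *\<^sub>R (?D x $ j)) + \<psi> x *\<^sub>R (q x *\<^sub>R u x - q x *\<^sub>R u' x) \<partial>vol B)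
      = (\<integral>x. ((\<Sum>j\<in>UNIV. gradient \<psi> x $ j *\<^sub>R (weak_gradient B u x $ j)) + \<psi> x *\<^sub>R (q x *\<^sub>R u x))
         - ((\<Sum>j\<in>UNIV. gradient \<psi> x $ j *\<^sub>R (weak_gradient B u' x $ j)) + \<psi> x *\<^sub>R (q x *\<^sub>R u' x)) \<partial>vol B)"
      by (intro Bochner_Integration.integral_cong refl) (simp add: algebra_simps sum_subtractf)
    also have "\<dots> = 0"
      using i[OF uD(1,3)] i[OF uD'(1,3)] uD(4)[OF \<psi>] uD'(4)[OF \<psi>] by simp
    finally show "(\<integral>x. (\<Sum>j\<in>UNIV. gradient \<psi> x $ j *\<^sub>R (?D x $ j)) + \<psi> x *\<^sub>R (q x *\<^sub>R u x - q x *\<^sub>R u' x) \<partial>vol B) = 0" .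
  qed
  moreover have "(\<integral>x. (norm (?D x))\<^sup>2 \<partial>vol B) \<le>
     (\<integral>x. (\<Sum>j\<in>UNIV. ?D x $ j \<bullet> ?D x $ j) + ?d x \<bullet> (q x *\<^sub>R u x - q x *\<^sub>R u' x) \<partial>vol B)"
  proof (rule integral_mono)
    show "integrable (vol B) (\<lambda>x. (\<Sum>j\<in>UNIV. ?D x $ j \<bullet> ?D x $ j) + ?d x \<bullet> (q x *\<^sub>R u x - q x *\<^sub>R u' x))"
      by (intro Bochner_Integration.integrable_add Bochner_Integration.integrable_sum
        L2_bilinear_integrable[OF bounded_bilinear_inner] L2_nth DL)
    fix x assume "x \<in> space (vol B)"
    then have "0 \<le> q x" using q by simp
    then have "0 \<le> ?d x \<bullet> (q x *\<^sub>R u x - q x *\<^sub>R u' x)" by (simp flip: scaleR_diff_right)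
    then show "(norm (?D x))\<^sup>2 \<le> (\<Sum>j\<in>UNIV. ?D x $ j \<bullet> ?D x $ j) + ?d x \<bullet> (q x *\<^sub>R u x - q x *\<^sub>R u' x)"
      by (simp only: norm_power2_vec power2_norm_eq_inner)
  qed (rule L2_integrable[OF DL(1)])
  ultimately have "(\<integral>x. (norm (?D x))\<^sup>2 \<partial>vol B) \<le> 0" by simp
  then have D0: "(\<integral>x. (norm (?D x))\<^sup>2 \<partial>vol B) = 0" by (rule order_antisym) simp
  have d0: "(\<integral>x. (norm (?d x))\<^sup>2 \<partial>vol B) = 0"
    using Poincare_inequality[OF tr] unfolding D0 by (intro order_antisym) simp_all
  have zero: "AE x in vol B. F x = 0" if "L2 (vol B) F" "(\<integral>x. (norm (F x))\<^sup>2 \<partial>vol B) = 0" for F :: "real^3 \<Rightarrow> 'w::euclidean_space"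
  proof -
    have "AE x in vol B. (norm (F x))\<^sup>2 = 0"
      using that by (subst (asm) integral_nonneg_eq_0_iff_AE) (auto intro: L2_integrable)
    then show ?thesis by eventually_elim simp
  qed
  show "AE x in vol B. u x = u' x" using zero[OF DL(2) d0] by eventually_elim simp
  show "AE x in vol B. weak_gradient B u x = weak_gradient B u' x" using zero[OF DL(1) D0] by eventually_elim simp
qed

text \<open>Frees \<open>DN_map\<close> from its choices: any solution, any of its weak gradients
  and any extension of g will do.\<close>

lemma DN_map_eq:
  fixes u :: "real^3 \<Rightarrow> 'a::{real_normed_field,euclidean_space}"
  assumes q: "\<And>x. x \<in> B \<Longrightarrow> 0 \<le> q x"
    and u: "dirichlet_solution q f u" and G: "is_weak_gradient B u G" and w: "sobolev_trace w K g"
  shows "DN_map q f g = (\<integral>x. (\<Sum>i\<in>UNIV. G x $ i * K x $ i) + (q x *\<^sub>R u x) * w x \<partial>vol B)"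
proof -
  define u' where "u' = (SOME u. dirichlet_solution q f u)"
  have u': "dirichlet_solution q f u'" unfolding u'_def using u by (rule someI[of "dirichlet_solution q f"])
  note lap = u[unfolded dirichlet_solution_def, THEN conjunct1] and lap' = u'[unfolded dirichlet_solution_def, THEN conjunct1]
  note uD = is_weak_laplacianD[OF lap] and uD' = is_weak_laplacianD[OF lap']
  have GL: "L2 (vol B) G" using G by (simp add: is_weak_gradient_def)
  have m: "(\<lambda>x. (\<Sum>i\<in>UNIV. D x $ i * K x $ i) + h x * w x) \<in> borel_measurable (vol B)"
    if "L2 (vol B) D" "L2 (vol B) h" for D h
    by (intro borel_measurable_integrable Bochner_Integration.integrable_add Bochner_Integration.integrable_sum
      L2_bilinear_integrable[OF bounded_bilinear_mult] L2_nth that sobolev_trace_L2[OF w])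
  have "DN_map q f g = (\<integral>x. (\<Sum>i\<in>UNIV. weak_gradient B u' x $ i * K x $ i) + (q x *\<^sub>R u' x) * w x \<partial>vol B)"
    unfolding DN_map_def u'_def[symmetric] by (rule normal_derivative_eq[OF lap' w])
  also have "\<dots> = (\<integral>x. (\<Sum>i\<in>UNIV. G x $ i * K x $ i) + (q x *\<^sub>R u x) * w x \<partial>vol B)"
  proof (intro integral_cong_AE m uD uD' GL)
    show "AE x in vol B. (\<Sum>i\<in>UNIV. weak_gradient B u' x $ i * K x $ i) + (q x *\<^sub>R u' x) * w x
      = (\<Sum>i\<in>UNIV. G x $ i * K x $ i) + (q x *\<^sub>R u x) * w x"
    proof -
      have "AE x in vol B. u x = u' x" by (rule dirichlet_solution_unique(1)[OF _ u u']) (rule q)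
      moreover have "AE x in vol B. weak_gradient B u x = weak_gradient B u' x"
        by (rule dirichlet_solution_unique(2)[OF _ u u']) (rule q)
      ultimately show ?thesis using weak_gradient_AE[OF G] by eventually_elim simp
    qed
  qed
  finally show ?thesis .
qed

section \<open>The Darboux transformation in weak form\<close>

subsection \<open>A Darboux transformation\<close>

lemma L2_cong:
  assumes "\<And>x. x \<in> space M \<Longrightarrow> f x = g x"
  shows "L2 M f \<longleftrightarrow> L2 M g"
proof -
  have "f \<in> borel_measurable M \<longleftrightarrow> g \<in> borel_measurable M" using assms by (rule measurable_cong)
  moreover have "integrable M (\<lambda>x. (norm (f x))\<^sup>2) \<longleftrightarrow> integrable M (\<lambda>x. (norm (g x))\<^sup>2)"
    by (rule Bochner_Integration.integrable_cong) (simp_all add: assms)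
  ultimately show ?thesis by (simp add: L2_def)
qed

lemma sobolev_L2:
  assumes "sobolev v H" shows "L2 (vol B) v" "L2 (vol B) H"
  using assms by (auto simp: sobolev_def L2_tendsto_def)

lemma sobolev_vanishing_mult:
  assumes v: "sobolev v H" and m: "smooth m" "\<And>x. norm x = 1 \<Longrightarrow> m x = 0"
  shows "sobolev_trace (\<lambda>x. m x *\<^sub>R v x) (\<lambda>x. \<chi> i. m x *\<^sub>R (H x $ i) + gradient m x $ i *\<^sub>R v x) (\<lambda>x. 0)"
proof -
  obtain \<phi> where \<phi>: "\<And>k. smooth (\<phi> k)" "L2_tendsto (vol B) \<phi> v" "L2_tendsto (vol B) (\<lambda>k. gradient (\<phi> k)) H"
    using v unfolding sobolev_def by blast
  have g: "gradient (\<lambda>x. m x *\<^sub>R \<phi> k x) = (\<lambda>x. \<chi> i. m x *\<^sub>R (gradient (\<phi> k) x $ i) + gradient m x $ i *\<^sub>R \<phi> k x)" for k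
    using gradient_scaleR[OF m(1) \<phi>(1)] by (simp add: fun_eq_iff vec_eq_iff)
  have s: "smooth (\<lambda>x. m x *\<^sub>R \<phi> k x)" for k by (intro smooth_scaleR m \<phi>)
  have "AE x in sphere_measure. m x *\<^sub>R \<phi> k x = 0" for k
  proof (rule AE_sphere)
    have [measurable]: "(\<lambda>x. m x *\<^sub>R \<phi> k x) \<in> borel_measurable borel"
      by (intro borel_measurable_continuous_onI smooth_continuous s)
    show "Measurable.pred borel (\<lambda>x. m x *\<^sub>R \<phi> k x = 0)" by measurable
  qed (simp add: m)
  then have "(\<integral>x. (norm (m x *\<^sub>R \<phi> k x - 0))\<^sup>2 \<partial>sphere_measure) = 0" for k
    by (intro integral_eq_zero_AE) (auto elim: eventually_mono)
  then have "L2_tendsto sphere_measure (\<lambda>k x. m x *\<^sub>R \<phi> k x) (\<lambda>x. 0)"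
    unfolding L2_tendsto_def by (simp only: L2_zero L2_continuous_sphere[OF smooth_continuous[OF s]] tendsto_const simp_thms)
  then show ?thesis unfolding sobolev_trace_def
    by (intro exI[of _ "\<lambda>k x. m x *\<^sub>R \<phi> k x"])
      (auto simp: g intro!: s L2_tendsto_vec_lambda L2_tendsto_add L2_tendsto_smooth_mult smooth_partial L2_tendsto_nth m(1) \<phi>)
qed

text \<open>
  In the application \<open>m\<close> is radial, \<open>\<Delta>m = \<rho> (2 m + 2 N + 2)\<close>, and \<open>u = u\<^sub>0 + m v\<close> arises from
  the harmonic function \<open>v\<close> by the first-order operator \<open>x \<cdot> \<nabla> + N + 1 + m\<close>, which intertwines
  \<open>\<Delta>\<close> and \<open>\<Delta> - 2 \<rho>\<close>.
\<close>

locale darboux =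
  fixes m \<rho> :: "real^3 \<Rightarrow> real" and N :: nat and c :: real
  assumes smooth_m: "smooth m" and smooth_rho: "smooth \<rho>"
    and gradient_m: "x \<in> B \<Longrightarrow> gradient m x $ i = \<rho> x * x $ i"
    and Euler_rho: "x \<in> B \<Longrightarrow> (\<Sum>i\<in>UNIV. x $ i * gradient \<rho> x $ i) = \<rho> x * (2 * m x + 2 * real N - 1)"
    and m_sphere: "norm x = 1 \<Longrightarrow> m x = 0" and rho_sphere: "norm x = 1 \<Longrightarrow> \<rho> x = c"
begin

text \<open>The shift d is 0 in the interior equation, and -c in Green's formula, where it makes the
  field vanish on the sphere.\<close>

lemma gradient_rho_coordinate:
  "gradient (\<lambda>x. (\<rho> x + d) * x $ j) x $ i = (\<rho> x + d) * (if i = j then 1 else 0) + gradient \<rho> x $ i * x $ j"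
proof -
  have "gradient (\<lambda>x. \<rho> x + d) x $ i = gradient \<rho> x $ i"
    using gradient_add[OF smooth_rho smooth_const] by (simp add: gradient_const)
  then show ?thesis
    using gradient_mult[OF smooth_add[OF smooth_rho smooth_const] smooth_nth, of d j x i]
    by (simp add: gradient_coordinate)
qed

lemma smooth_rho_coordinate: "smooth (\<lambda>x. (\<rho> x + d) * x $ j)"
  by (intro smooth_mult smooth_add smooth_rho smooth_const smooth_nth)

end

text \<open>The functions added here depend on f and N only; they are shared by all potentials with
  the same N.\<close>

locale darboux_solution = darboux m \<rho> N c for m \<rho> N c +
  fixes u\<^sub>0 v :: "real^3 \<Rightarrow> 'a::{real_normed_field,euclidean_space}" and G\<^sub>0 H :: "real^3 \<Rightarrow> 'a^3" and f
  assumes u0: "sobolev_trace u\<^sub>0 G\<^sub>0 f" and v: "sobolev v H"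
    and harm0: "test_function B \<psi> \<Longrightarrow> (\<integral>x. (\<Sum>j\<in>UNIV. gradient \<psi> x $ j *\<^sub>R (G\<^sub>0 x $ j)) \<partial>vol B) = 0"
    and harm: "test_function B \<psi> \<Longrightarrow> (\<integral>x. (\<Sum>j\<in>UNIV. gradient \<psi> x $ j *\<^sub>R (H x $ j)) \<partial>vol B) = 0"
    and Euler: "AE x in vol B. (\<Sum>i\<in>UNIV. x $ i *\<^sub>R (H x $ i)) + (real N + 1) *\<^sub>R v x = u\<^sub>0 x"
begin

lemma L2s: "L2 (vol B) u\<^sub>0" "L2 (vol B) G\<^sub>0" "L2 (vol B) v" "L2 (vol B) H"
  using sobolev_trace_L2[OF u0] sobolev_L2[OF v] by auto

lemma by_parts_v:
  assumes "test_function B \<psi>"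
  shows "(\<integral>x. gradient \<psi> x $ j *\<^sub>R v x + \<psi> x *\<^sub>R (H x $ j) \<partial>vol B) = 0"
proof -
  have s: "smooth \<psi>" using assms by (rule test_function_smooth)
  have "(\<integral>x. gradient \<psi> x $ j *\<^sub>R v x \<partial>vol B) = - (\<integral>x. \<psi> x *\<^sub>R (H x $ j) \<partial>vol B)"
    using sobolev_weak_gradient[OF v] assms unfolding is_weak_gradient_def by blast
  moreover have "integrable (vol B) (\<lambda>x. gradient \<psi> x $ j *\<^sub>R v x)" "integrable (vol B) (\<lambda>x. \<psi> x *\<^sub>R (H x $ j))"
    by (intro L2_bilinear_integrable[OF bounded_bilinear_scaleR] L2_continuous_B smooth_continuous smooth_partial s L2_nth L2s)+
  ultimately show ?thesis by simp
qed

definition "u x = u\<^sub>0 x + m x *\<^sub>R v x"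
definition "G x = G\<^sub>0 x + (\<chi> i. m x *\<^sub>R (H x $ i) + gradient m x $ i *\<^sub>R v x)"

lemma trace_u: "sobolev_trace u G f"
  using sobolev_trace_add[OF u0 sobolev_vanishing_mult[OF v smooth_m m_sphere]]
  by (simp add: u_def[abs_def] G_def[abs_def])

lemma L2_u: "L2 (vol B) (\<lambda>x. (2 * \<rho> x) *\<^sub>R u x)"
  by (intro L2_smooth_mult smooth_mult smooth_const smooth_rho sobolev_trace_L2[OF trace_u])

text \<open>Algebraic form of 2 grad m . grad v + v \<Delta>m = 2 \<rho> u: the Euler relation
  expresses the radial derivative of v through the harmonic function and v, and the terms with N + 1
  cancel.\<close>

lemma Euler_consequence:
  assumes "(\<Sum>i\<in>UNIV. x $ i *\<^sub>R (H x $ i)) + (real N + 1) *\<^sub>R v x = u\<^sub>0 x" "x \<in> B"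
  shows "(2 * \<rho> x) *\<^sub>R (\<Sum>i\<in>UNIV. x $ i *\<^sub>R (H x $ i)) + ((\<Sum>i\<in>UNIV. x $ i * gradient \<rho> x $ i) + 3 * \<rho> x) *\<^sub>R v x
    = (2 * \<rho> x) *\<^sub>R u x"
proof -
  have "(\<Sum>i\<in>UNIV. x $ i *\<^sub>R (H x $ i)) = u\<^sub>0 x - (real N + 1) *\<^sub>R v x" using assms(1) by (simp add: algebra_simps)
  then show ?thesis unfolding Euler_rho[OF assms(2)] u_def
    by (simp only:) (simp add: scaleR_conv_of_real algebra_simps)
qed

text \<open>The integrand splits into three parts that integrate to 0: harmonicity of the first
  function tested with \<psi>, harmonicity of v tested with \<psi> m, and the definition of the weak
  gradient of v tested with \<psi> \<rho> x_j. No second derivative of v appears.\<close>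

lemma weak_equation:
  assumes \<psi>: "test_function B \<psi>"
  shows "(\<integral>x. (\<Sum>j\<in>UNIV. gradient \<psi> x $ j *\<^sub>R (G x $ j)) + \<psi> x *\<^sub>R ((2 * \<rho> x) *\<^sub>R u x) \<partial>vol B) = 0"
proof -
  have s: "smooth \<psi>" using \<psi> by (rule test_function_smooth)
  let ?T0 = "\<lambda>x. \<Sum>j\<in>UNIV. gradient \<psi> x $ j *\<^sub>R (G\<^sub>0 x $ j)"
  let ?T1 = "\<lambda>x. \<Sum>j\<in>UNIV. gradient (\<lambda>x. \<psi> x * m x) x $ j *\<^sub>R (H x $ j)"
  \<comment> \<open>The summand 0 matches the shape of
    \<open>gradient_rho_coordinate\<close>.\<close>
  let ?T2 = "\<lambda>j x. gradient (\<lambda>x. \<psi> x * ((\<rho> x + 0) * x $ j)) x $ j *\<^sub>R v x + (\<psi> x * ((\<rho> x + 0) * x $ j)) *\<^sub>R (H x $ j)"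
  have sm: "smooth (\<lambda>x. \<psi> x * m x)" "smooth (\<lambda>x. \<psi> x * ((\<rho> x + 0) * x $ j))" for j
    by (intro smooth_mult s smooth_m smooth_rho_coordinate)+
  have T: "(\<integral>x. ?T0 x \<partial>vol B) = 0" "(\<integral>x. ?T1 x \<partial>vol B) = 0" "(\<integral>x. ?T2 j x \<partial>vol B) = 0" for j
    by (intro harm0 harm by_parts_v test_function_mult \<psi> smooth_m smooth_rho_coordinate)+
  have i: "integrable (vol B) ?T0" "integrable (vol B) ?T1" "integrable (vol B) (?T2 j)" for j
    by (intro Bochner_Integration.integrable_add Bochner_Integration.integrable_sum L2_bilinear_integrable[OF bounded_bilinear_scaleR]
      L2_continuous_B smooth_continuous smooth_partial s sm L2_nth L2s)+
  have "(\<integral>x. (\<Sum>j\<in>UNIV. gradient \<psi> x $ j *\<^sub>R (G x $ j)) + \<psi> x *\<^sub>R ((2 * \<rho> x) *\<^sub>R u x) \<partial>vol B)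
     = (\<integral>x. ?T0 x + ?T1 x + (\<Sum>j\<in>UNIV. ?T2 j x) \<partial>vol B)"
  proof (rule integral_cong_AE)
    show "(\<lambda>x. (\<Sum>j\<in>UNIV. gradient \<psi> x $ j *\<^sub>R (G x $ j)) + \<psi> x *\<^sub>R ((2 * \<rho> x) *\<^sub>R u x)) \<in> borel_measurable (vol B)"
      by (intro borel_measurable_integrable Bochner_Integration.integrable_add Bochner_Integration.integrable_sum L2_bilinear_integrable[OF bounded_bilinear_scaleR]
        L2_continuous_B smooth_continuous smooth_partial s L2_nth L2_u sobolev_trace_L2[OF trace_u])
    show "(\<lambda>x. ?T0 x + ?T1 x + (\<Sum>j\<in>UNIV. ?T2 j x)) \<in> borel_measurable (vol B)"
      by (intro borel_measurable_integrable Bochner_Integration.integrable_add Bochner_Integration.integrable_sum i)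
    have "AE x in vol B. x \<in> B" by (rule AE_I2) simp
    then show "AE x in vol B. (\<Sum>j\<in>UNIV. gradient \<psi> x $ j *\<^sub>R (G x $ j)) + \<psi> x *\<^sub>R ((2 * \<rho> x) *\<^sub>R u x)
      = ?T0 x + ?T1 x + (\<Sum>j\<in>UNIV. ?T2 j x)"
      using Euler
    proof eventually_elim
      case (elim x)
      show ?case
        unfolding Euler_consequence[OF elim(2,1), symmetric] gradient_mult[OF s smooth_m] gradient_mult[OF s smooth_rho_coordinate]
          gradient_rho_coordinate G_def gradient_m[OF elim(1)]
        by (simp add: sum_3 scaleR_conv_of_real algebra_simps)
    qed
  qed
  also have "\<dots> = 0" using i T by simp
  finally show ?thesis .
qed

lemma dirichlet_solution_u:
  assumes q: "\<And>x. x \<in> B \<Longrightarrow> q x = 2 * \<rho> x"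
  shows "dirichlet_solution q f u"
proof -
  have L: "L2 (vol B) (\<lambda>x. q x *\<^sub>R u x)"
    using L2_u by (subst L2_cong[where g="\<lambda>x. (2 * \<rho> x) *\<^sub>R u x"]) (simp_all add: q)
  have "is_weak_laplacian B u (\<lambda>x. q x *\<^sub>R u x)"
  proof (rule is_weak_laplacianI[OF sobolev_trace_weak_gradient[OF trace_u] L])
    fix \<psi> assume "test_function B \<psi>"
    have "(\<integral>x. (\<Sum>j\<in>UNIV. gradient \<psi> x $ j *\<^sub>R (G x $ j)) + \<psi> x *\<^sub>R (q x *\<^sub>R u x) \<partial>vol B)
      = (\<integral>x. (\<Sum>j\<in>UNIV. gradient \<psi> x $ j *\<^sub>R (G x $ j)) + \<psi> x *\<^sub>R ((2 * \<rho> x) *\<^sub>R u x) \<partial>vol B)"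
      by (intro Bochner_Integration.integral_cong refl) (simp add: q)
    then show "(\<integral>x. (\<Sum>j\<in>UNIV. gradient \<psi> x $ j *\<^sub>R (G x $ j)) + \<psi> x *\<^sub>R (q x *\<^sub>R u x) \<partial>vol B) = 0"
      by (simp only: weak_equation[OF \<open>test_function B \<psi>\<close>])
  qed
  then show ?thesis using sobolev_trace_imp_has_trace[OF trace_u] by (simp add: dirichlet_solution_def)
qed

text \<open>Weak form of the fact that passing to u adds c v to the normal derivative. The boundary
  integral of v w appears as the volume integral of the divergence of v w x, which makes sense
  without a trace of v. Neither integral involves m or \<rho>, so c alone carries the dependence on
  the potential.\<close>

theorem DN_map_affine:
  assumes q: "\<And>x. x \<in> B \<Longrightarrow> q x = 2 * \<rho> x" "\<And>x. x \<in> B \<Longrightarrow> 0 \<le> q x" and w: "sobolev_trace w K g"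
  shows "DN_map q f g = (\<integral>x. (\<Sum>j\<in>UNIV. G\<^sub>0 x $ j * K x $ j) \<partial>vol B)
     + c *\<^sub>R (\<integral>x. 3 *\<^sub>R (v x * w x) + (\<Sum>j\<in>UNIV. x $ j *\<^sub>R (H x $ j)) * w x + v x * (\<Sum>j\<in>UNIV. x $ j *\<^sub>R (K x $ j)) \<partial>vol B)"
proof -
  have wL: "L2 (vol B) w" "L2 (vol B) K" using sobolev_trace_L2[OF w] by auto
  have wS: "sobolev w K" by (rule sobolev_trace_imp_sobolev[OF w])
  \<comment> \<open>\<rho> - c vanishes on the sphere, so the product with w has zero trace; the
    part with c is left over and forms \<open>?T\<close>.\<close>
  let ?r = "\<lambda>j x. (\<rho> x + - c) * x $ j"
  let ?Z = "\<lambda>x. \<Sum>j\<in>UNIV. G\<^sub>0 x $ j * K x $ j"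
  let ?T = "\<lambda>x. 3 *\<^sub>R (v x * w x) + (\<Sum>j\<in>UNIV. x $ j *\<^sub>R (H x $ j)) * w x + v x * (\<Sum>j\<in>UNIV. x $ j *\<^sub>R (K x $ j))"
  let ?Y1 = "\<lambda>x. (\<Sum>j\<in>UNIV. (\<chi> i. m x *\<^sub>R (K x $ i) + gradient m x $ i *\<^sub>R w x) $ j * H x $ j) + (m x *\<^sub>R w x) * 0"
  \<comment> \<open>A field whose only component is v, in direction j, puts the definition of H as
    weak gradient of v into the format of \<open>weak_equation_zero_trace\<close>.\<close>
  let ?Y2 = "\<lambda>j x. (\<Sum>i\<in>UNIV. (\<chi> i. ?r j x *\<^sub>R (K x $ i) + gradient (?r j) x $ i *\<^sub>R w x) $ i * (\<chi> i. if i = j then v x else 0) $ i)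
     + (?r j x *\<^sub>R w x) * H x $ j"
  have Y1: "(\<integral>x. ?Y1 x \<partial>vol B) = 0"
  proof (rule weak_equation_zero_trace[OF bounded_bilinear_mult L2s(4) L2_zero])
    show "sobolev_trace (\<lambda>x. m x *\<^sub>R w x) (\<lambda>x. \<chi> i. m x *\<^sub>R (K x $ i) + gradient m x $ i *\<^sub>R w x) (\<lambda>x. 0)"
      by (rule sobolev_vanishing_mult[OF wS smooth_m m_sphere])
  qed (simp add: harm)
  have vL: "L2 (vol B) (\<lambda>x. \<chi> i. if i = j then v x else 0)" for j :: 3
  proof (rule L2_vec_lambda)
    show "L2 (vol B) (\<lambda>x. if i = j then v x else 0)" for i by (cases "i = j") (simp_all add: L2s L2_zero)
  qed
  have Y2: "(\<integral>x. ?Y2 j x \<partial>vol B) = 0" for j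
  proof (rule weak_equation_zero_trace[OF bounded_bilinear_mult vL L2_nth[OF L2s(4)]])
    show "sobolev_trace (\<lambda>x. ?r j x *\<^sub>R w x) (\<lambda>x. \<chi> i. ?r j x *\<^sub>R (K x $ i) + gradient (?r j) x $ i *\<^sub>R w x) (\<lambda>x. 0)"
      by (rule sobolev_vanishing_mult[OF wS smooth_rho_coordinate]) (simp add: rho_sphere)
    fix \<psi> assume \<psi>: "test_function B \<psi>"
    have "(\<Sum>i\<in>UNIV. gradient \<psi> x $ i *\<^sub>R ((\<chi> i. if i = j then v x else 0) $ i)) = gradient \<psi> x $ j *\<^sub>R v x" for x
      by (simp add: if_distrib[of "scaleR _"] cong: if_cong)
    then show "(\<integral>x. (\<Sum>i\<in>UNIV. gradient \<psi> x $ i *\<^sub>R ((\<chi> i. if i = j then v x else 0) $ i)) + \<psi> x *\<^sub>R (H x $ j) \<partial>vol B) = 0"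
      using by_parts_v[OF \<psi>, of j] by simp
  qed
  have gm: "L2 (vol B) (\<lambda>x. \<chi> i. \<mu> x *\<^sub>R (K x $ i) + gradient \<mu> x $ i *\<^sub>R w x)" if "smooth \<mu>" for \<mu>
    by (intro L2_vec_lambda L2_add L2_smooth_mult smooth_partial that L2_nth wL)
  have xsum: "L2 (vol B) (\<lambda>x. \<Sum>j\<in>UNIV. x $ j *\<^sub>R (F x $ j))" if "L2 (vol B) F" for F :: "real^3 \<Rightarrow> 'a^3"
    by (intro L2_sum L2_smooth_mult smooth_nth L2_nth that)
  have iZ: "integrable (vol B) ?Z"
    by (intro Bochner_Integration.integrable_sum L2_bilinear_integrable[OF bounded_bilinear_mult] L2_nth L2s wL)
  have iT: "integrable (vol B) ?T"
    by (intro Bochner_Integration.integrable_add integrable_scaleR_right L2_bilinear_integrable[OF bounded_bilinear_mult] xsum L2s wL)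
  have i1: "integrable (vol B) ?Y1"
    by (intro Bochner_Integration.integrable_add Bochner_Integration.integrable_sum L2_bilinear_integrable[OF bounded_bilinear_mult]
      L2_nth gm smooth_m L2s L2_smooth_mult wL L2_zero)
  have i2: "integrable (vol B) (?Y2 j)" for j
    by (intro Bochner_Integration.integrable_add Bochner_Integration.integrable_sum L2_bilinear_integrable[OF bounded_bilinear_mult]
      L2_nth[OF gm] smooth_rho_coordinate L2_nth[OF vL] L2_smooth_mult wL L2_nth[OF L2s(4)])
  have "DN_map q f g = (\<integral>x. (\<Sum>i\<in>UNIV. G x $ i * K x $ i) + (q x *\<^sub>R u x) * w x \<partial>vol B)"
    by (rule DN_map_eq[OF _ dirichlet_solution_u[OF q(1)] sobolev_trace_weak_gradient[OF trace_u] w]) (use q in auto)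
  also have "\<dots> = (\<integral>x. (\<Sum>i\<in>UNIV. G x $ i * K x $ i) + ((2 * \<rho> x) *\<^sub>R u x) * w x \<partial>vol B)"
    by (intro Bochner_Integration.integral_cong refl) (simp add: q(1))
  also have "\<dots> = (\<integral>x. ?Z x + c *\<^sub>R ?T x + ?Y1 x + (\<Sum>j\<in>UNIV. ?Y2 j x) \<partial>vol B)"
  proof (rule integral_cong_AE)
    show "(\<lambda>x. (\<Sum>i\<in>UNIV. G x $ i * K x $ i) + ((2 * \<rho> x) *\<^sub>R u x) * w x) \<in> borel_measurable (vol B)"
      by (intro borel_measurable_integrable Bochner_Integration.integrable_add Bochner_Integration.integrable_sum L2_bilinear_integrable[OF bounded_bilinear_mult]
        L2_nth L2_u wL sobolev_trace_L2[OF trace_u])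
    show "(\<lambda>x. ?Z x + c *\<^sub>R ?T x + ?Y1 x + (\<Sum>j\<in>UNIV. ?Y2 j x)) \<in> borel_measurable (vol B)"
      by (intro borel_measurable_integrable Bochner_Integration.integrable_add Bochner_Integration.integrable_sum integrable_scaleR_right iZ iT i1 i2)
    have "AE x in vol B. x \<in> B" by (rule AE_I2) simp
    then show "AE x in vol B. (\<Sum>i\<in>UNIV. G x $ i * K x $ i) + ((2 * \<rho> x) *\<^sub>R u x) * w x
      = ?Z x + c *\<^sub>R ?T x + ?Y1 x + (\<Sum>j\<in>UNIV. ?Y2 j x)"
      using Euler
    proof eventually_elim
      case (elim x)
      have eq: "(\<Sum>i\<in>UNIV. (\<chi> i. ?r j x *\<^sub>R (K x $ i) + gradient (?r j) x $ i *\<^sub>R w x) $ i * (\<chi> i. if i = j then v x else 0) $ i)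
          = (?r j x *\<^sub>R (K x $ j) + ((\<rho> x + - c) + gradient \<rho> x $ j * x $ j) *\<^sub>R w x) * v x" for j
        unfolding gradient_rho_coordinate by (simp add: if_distrib[of "times _"] cong: if_cong)
      show ?case
        unfolding eq Euler_consequence[OF elim(2,1), symmetric] G_def gradient_m[OF elim(1)]
        by (simp add: sum_3 scaleR_conv_of_real algebra_simps)
    qed
  qed
  also have "\<dots> = (\<integral>x. ?Z x \<partial>vol B) + c *\<^sub>R (\<integral>x. ?T x \<partial>vol B) + (\<integral>x. ?Y1 x \<partial>vol B) + (\<Sum>j\<in>UNIV. \<integral>x. ?Y2 j x \<partial>vol B)"
    using iZ iT i1 i2 by (simp only: Bochner_Integration.integral_add Bochner_Integration.integrable_add
      integrable_scaleR_right Bochner_Integration.integrable_sum Bochner_Integration.integral_sum integral_scaleR_right)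
  finally show ?thesis by (simp only: Y1 Y2 sum.neutral_const add_0_right)
qed

end

section \<open>Power series in several variables for functions of the squared norm\<close>

subsection \<open>Analyticity of radial functions\<close>

definition monomial :: "real^'n \<Rightarrow> nat^'n \<Rightarrow> real" where
  "monomial h \<alpha> = (\<Prod>i\<in>UNIV. (h $ i) ^ (\<alpha> $ i))"

lemma monomial_add: "monomial h (\<alpha> + \<beta>) = monomial h \<alpha> * monomial h \<beta>"
  by (simp add: monomial_def power_add prod.distrib)

lemma monomial_axis: "monomial h (axis i 1) = h $ i"
proof -
  have "monomial h (axis i 1) = (\<Prod>j\<in>UNIV. if j = i then h $ j else 1)"
    unfolding monomial_def by (intro prod.cong refl) (simp add: axis_def)
  then show ?thesis by simp
qed

lemma abs_monomial_le:
  assumes "\<And>i. \<bar>h $ i\<bar> \<le> s"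
  shows "\<bar>monomial h \<alpha>\<bar> \<le> monomial (\<chi> i. s) \<alpha>"
  unfolding monomial_def abs_prod by (intro prod_mono) (auto simp: power_abs intro!: power_mono assms)

lemma monomial_nonneg: "0 \<le> s \<Longrightarrow> 0 \<le> monomial (\<chi> i. s) \<alpha>"
  by (simp add: monomial_def prod_nonneg)

text \<open>Q bounds the weighted l1 norm of the coefficients on the polydisc of radius s. A bound
  instead of the exact norm keeps the notion stable under the operations below, where cancellation
  may occur.\<close>

definition power_series_bounded :: "real \<Rightarrow> real \<Rightarrow> (real^'n \<Rightarrow> real) \<Rightarrow> bool" where
  "power_series_bounded s Q f \<longleftrightarrow> (\<exists>C S. (\<forall>h. (\<forall>i. \<bar>h $ i\<bar> \<le> s) \<longrightarrow> ((\<lambda>\<alpha>. C \<alpha> * monomial h \<alpha>) has_sum f h) UNIV) \<and>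
     ((\<lambda>\<alpha>. \<bar>C \<alpha>\<bar> * monomial (\<chi> i. s) \<alpha>) has_sum S) UNIV \<and> S \<le> Q)"

lemma power_series_bounded_const: "power_series_bounded s \<bar>c\<bar> (\<lambda>h. c)"
proof -
  have *: "((\<lambda>\<alpha>. (if \<alpha> = 0 then d else 0) * monomial h \<alpha>) has_sum d) UNIV" for d and h :: "real^'n"
  proof -
    have "((\<lambda>\<alpha>. (if \<alpha> = 0 then d else 0) * monomial h \<alpha>) has_sum (\<Sum>\<alpha>\<in>{0}. (if \<alpha> = 0 then d else 0) * monomial h \<alpha>)) UNIV"
      by (rule has_sum_finite_neutralI[where B="{0}"]) auto
    then show ?thesis by (simp add: monomial_def)
  qed
  show ?thesis unfolding power_series_bounded_def
    by (rule exI[of _ "\<lambda>\<alpha>. if \<alpha> = 0 then c else 0"], rule exI[of _ "\<bar>c\<bar>"])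
      (use *[of c] *[of "\<bar>c\<bar>"] in \<open>auto simp: if_distrib[of abs] cong: if_cong\<close>)
qed

lemma power_series_bounded_add:
  assumes "power_series_bounded s P f" "power_series_bounded s Q g" "0 \<le> s"
  shows "power_series_bounded s (P + Q) (\<lambda>h. f h + g h)"
proof -
  obtain C S where C: "\<And>h. (\<forall>i. \<bar>h $ i\<bar> \<le> s) \<Longrightarrow> ((\<lambda>\<alpha>. C \<alpha> * monomial h \<alpha>) has_sum f h) UNIV"
    "((\<lambda>\<alpha>. \<bar>C \<alpha>\<bar> * monomial (\<chi> i. s) \<alpha>) has_sum S) UNIV" "S \<le> P"
    using assms(1) unfolding power_series_bounded_def by blast
  obtain D T where D: "\<And>h. (\<forall>i. \<bar>h $ i\<bar> \<le> s) \<Longrightarrow> ((\<lambda>\<alpha>. D \<alpha> * monomial h \<alpha>) has_sum g h) UNIV"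
    "((\<lambda>\<alpha>. \<bar>D \<alpha>\<bar> * monomial (\<chi> i. s) \<alpha>) has_sum T) UNIV" "T \<le> Q"
    using assms(2) unfolding power_series_bounded_def by blast
  have sum: "((\<lambda>\<alpha>. \<bar>C \<alpha>\<bar> * monomial (\<chi> i. s) \<alpha> + \<bar>D \<alpha>\<bar> * monomial (\<chi> i. s) \<alpha>) has_sum (S + T)) UNIV"
    by (intro has_sum_add C D)
  have le: "\<bar>C \<alpha> + D \<alpha>\<bar> * monomial (\<chi> i. s) \<alpha> \<le> \<bar>C \<alpha>\<bar> * monomial (\<chi> i. s) \<alpha> + \<bar>D \<alpha>\<bar> * monomial (\<chi> i. s) \<alpha>" for \<alpha>
    using mult_right_mono[OF abs_triangle_ineq monomial_nonneg[OF assms(3)]] by (simp add: distrib_right)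
  have nn: "0 \<le> \<bar>C \<alpha> + D \<alpha>\<bar> * monomial (\<chi> i. s) \<alpha>" for \<alpha> by (intro mult_nonneg_nonneg monomial_nonneg assms) simp
  have "(\<lambda>\<alpha>. \<bar>C \<alpha> + D \<alpha>\<bar> * monomial (\<chi> i. s) \<alpha>) summable_on UNIV"
    by (rule summable_on_comparison_test[OF has_sum_imp_summable[OF sum]]) (use le nn in auto)
  then obtain U where U: "((\<lambda>\<alpha>. \<bar>C \<alpha> + D \<alpha>\<bar> * monomial (\<chi> i. s) \<alpha>) has_sum U) UNIV"
    using has_sum_infsum by blast
  have "U \<le> S + T" by (rule has_sum_mono[OF U sum le])
  then have "U \<le> P + Q" using C(3) D(3) by linarith
  moreover have "((\<lambda>\<alpha>. (C \<alpha> + D \<alpha>) * monomial h \<alpha>) has_sum (f h + g h)) UNIV" if "\<forall>i. \<bar>h $ i\<bar> \<le> s" for h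
    using has_sum_add[OF C(1)[OF that] D(1)[OF that]] by (simp add: distrib_right)
  ultimately show ?thesis using U unfolding power_series_bounded_def
    by (intro exI[of _ "\<lambda>\<alpha>. C \<alpha> + D \<alpha>"] exI[of _ U]) blast
qed

text \<open>Multiplication by a coordinate merely shifts the multi-indices. Powers of |x + h|^2 -
  |x|^2 are built from such shifts, which avoids general Cauchy products.\<close>

lemma power_series_bounded_shift:
  fixes f :: "real^'n \<Rightarrow> real"
  assumes "power_series_bounded s Q f" "0 \<le> s"
  shows "power_series_bounded s (\<bar>c\<bar> * s * Q) (\<lambda>h. c * h $ i * f h)"
proof -
  obtain C S where C: "\<And>h. (\<forall>i. \<bar>h $ i\<bar> \<le> s) \<Longrightarrow> ((\<lambda>\<alpha>. C \<alpha> * monomial h \<alpha>) has_sum f h) UNIV"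
    "((\<lambda>\<alpha>. \<bar>C \<alpha>\<bar> * monomial (\<chi> i. s) \<alpha>) has_sum S) UNIV" "S \<le> Q"
    using assms(1) unfolding power_series_bounded_def by blast
  let ?e = "axis i 1 :: nat^'n"
  \<comment> \<open>The first case guards against truncated subtraction of exponents.\<close>
  define D where "D \<alpha> = (if \<alpha> $ i = 0 then 0 else c * C (\<alpha> - ?e))" for \<alpha>
  have inj: "inj (\<lambda>\<alpha>. \<alpha> + ?e)" by (rule injI) (simp add: vec_eq_iff)
  have D1: "D (\<alpha> + ?e) = c * C \<alpha>" for \<alpha>
  proof -
    have "\<alpha> + ?e - ?e = \<alpha>" by (simp add: vec_eq_iff)
    then show ?thesis by (simp add: D_def axis_def)
  qed
  have D0: "D \<alpha> = 0" if "\<alpha> \<notin> range (\<lambda>\<alpha>. \<alpha> + ?e)" for \<alpha>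
  proof (rule ccontr)
    assume "D \<alpha> \<noteq> 0"
    then have "0 < \<alpha> $ i" by (auto simp: D_def split: if_splits)
    then have "\<alpha> = (\<alpha> - ?e) + ?e" by (auto simp: vec_eq_iff axis_def)
    then show False using that by blast
  qed
  have reindex: "((\<lambda>\<alpha>. F (D \<alpha>) * monomial h \<alpha>) has_sum X) UNIV"
    if "((\<lambda>\<alpha>. F (c * C \<alpha>) * (h $ i * monomial h \<alpha>)) has_sum X) UNIV" "F 0 = 0" for F h X
  proof -
    have "((\<lambda>\<alpha>. F (D \<alpha>) * monomial h \<alpha>) has_sum X) (range (\<lambda>\<alpha>. \<alpha> + ?e))"
      unfolding has_sum_reindex[OF inj] o_def D1 monomial_add monomial_axis using that(1) by (simp add: mult_ac)
    then show ?thesis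
      by (rule has_sum_cong_neutral[THEN iffD1, rotated -1]) (use D0 that(2) in auto)
  qed
  have "((\<lambda>\<alpha>. D \<alpha> * monomial h \<alpha>) has_sum (c * h $ i * f h)) UNIV" if "\<forall>i. \<bar>h $ i\<bar> \<le> s" for h
    using reindex[of "\<lambda>x. x" h] has_sum_cmult_right[OF C(1)[OF that], of "c * h $ i"] by (simp add: mult_ac)
  moreover have "((\<lambda>\<alpha>. \<bar>D \<alpha>\<bar> * monomial (\<chi> i. s) \<alpha>) has_sum (\<bar>c\<bar> * s * S)) UNIV"
    using reindex[of abs "\<chi> i. s"] has_sum_cmult_right[OF C(2), of "\<bar>c\<bar> * s"] by (simp add: mult_ac abs_mult)
  moreover have "\<bar>c\<bar> * s * S \<le> \<bar>c\<bar> * s * Q" using C(3) assms(2) by (intro mult_left_mono) auto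
  ultimately show ?thesis unfolding power_series_bounded_def by blast
qed

lemma power_series_bounded_norm_increment:
  fixes x :: "real^3"
  assumes f: "power_series_bounded s Q f" "0 \<le> s"
  shows "power_series_bounded s ((\<Sum>i\<in>UNIV. 2 * \<bar>x $ i\<bar> * s + s * s) * Q) (\<lambda>h. ((norm (x + h))\<^sup>2 - (norm x)\<^sup>2) * f h)"
proof -
  have t: "power_series_bounded s ((2 * \<bar>x $ i\<bar> * s + s * s) * Q) (\<lambda>h. (2 * x $ i * h $ i + h $ i * h $ i) * f h)" for i
    using power_series_bounded_add[OF power_series_bounded_shift[OF f, of "2 * x $ i" i]
        power_series_bounded_shift[OF power_series_bounded_shift[OF f, of 1 i] f(2), of 1 i] f(2)]
    by (simp add: algebra_simps abs_mult)
  have e: "(norm (x + h))\<^sup>2 - (norm x)\<^sup>2 = (2 * x $ 1 * h $ 1 + h $ 1 * h $ 1) + (2 * x $ 2 * h $ 2 + h $ 2 * h $ 2) + (2 * x $ 3 * h $ 3 + h $ 3 * h $ 3)" for h :: "real^3"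
    by (simp add: power2_norm_eq_inner inner_vec_def sum_3 algebra_simps)
  show ?thesis
    using power_series_bounded_add[OF power_series_bounded_add[OF t[of 1] t[of 2] f(2)] t[of 3] f(2)]
    unfolding e sum_3 by (simp add: algebra_simps)
qed

lemma power_series_bounded_norm_increment_power:
  fixes x :: "real^3"
  assumes "0 \<le> s"
  shows "power_series_bounded s ((\<Sum>i\<in>UNIV. 2 * \<bar>x $ i\<bar> * s + s * s) ^ k) (\<lambda>h. ((norm (x + h))\<^sup>2 - (norm x)\<^sup>2) ^ k)"
proof (induction k)
  case 0
  then show ?case using power_series_bounded_const[of s 1] by simp
next
  case (Suc k)
  from power_series_bounded_norm_increment[OF Suc assms, of x] show ?case by simp
qed

text \<open>The one-variable series at |x|^2 is composed with the polynomial |x + h|^2 - |x|^2 in h,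
  whose coefficient bound \<open>P s\<close> tends to 0 with s. Once \<open>P s\<close> < r, the
  double series converges absolutely and may be rearranged by multi-indices.\<close>

lemma real_analytic_radial:
  fixes F :: "real \<Rightarrow> real"
  assumes "\<And>t\<^sub>0. 0 \<le> t\<^sub>0 \<Longrightarrow> t\<^sub>0 < R \<Longrightarrow> \<exists>A r. 0 < r \<and> (\<forall>t. \<bar>t - t\<^sub>0\<bar> < r \<longrightarrow> (\<lambda>k. A k * (t - t\<^sub>0) ^ k) sums F t)"
  shows "real_analytic_on (\<lambda>x::real^3. F ((norm x)\<^sup>2)) {x. (norm x)\<^sup>2 < R}"
  unfolding real_analytic_on_def
proof
  fix x :: "real^3" assume "x \<in> {x. (norm x)\<^sup>2 < R}"
  then obtain A r where r: "0 < r" and A: "\<And>t. \<bar>t - (norm x)\<^sup>2\<bar> < r \<Longrightarrow> (\<lambda>k. A k * (t - (norm x)\<^sup>2) ^ k) sums F t"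
    using assms[of "(norm x)\<^sup>2"] by auto
  define P where "P s = (\<Sum>i\<in>UNIV. 2 * \<bar>x $ i\<bar> * s + s * s)" for s
  have "((\<lambda>s. P s) \<longlongrightarrow> P 0) (at_right 0)" unfolding P_def by (intro tendsto_intros)
  then have "\<forall>\<^sub>F s in at_right 0. P s < r" using r by (intro order_tendstoD) (auto simp: P_def)
  moreover have "\<forall>\<^sub>F s::real in at_right 0. 0 < s" by (simp add: eventually_at_right_less)
  ultimately obtain s where s: "0 < s" "P s < r"
    using eventually_happens[OF eventually_conj] trivial_limit_at_right_real by blast
  have P0: "0 \<le> P s" unfolding P_def using s by (intro sum_nonneg) auto
  have "\<forall>k. \<exists>CS. (\<forall>h. (\<forall>i. \<bar>h $ i\<bar> \<le> s) \<longrightarrow> ((\<lambda>\<alpha>. fst CS \<alpha> * monomial h \<alpha>) has_sum ((norm (x + h))\<^sup>2 - (norm x)\<^sup>2) ^ k) UNIV) \<and>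
     ((\<lambda>\<alpha>. \<bar>fst CS \<alpha>\<bar> * monomial (\<chi> i. s) \<alpha>) has_sum snd CS) UNIV \<and> snd CS \<le> P s ^ k"
    using power_series_bounded_norm_increment_power[of s x] s unfolding power_series_bounded_def P_def[symmetric] by simp
  from choice[OF this] obtain CS where CS: "\<And>k. (\<forall>h. (\<forall>i. \<bar>h $ i\<bar> \<le> s) \<longrightarrow> ((\<lambda>\<alpha>. fst (CS k) \<alpha> * monomial h \<alpha>) has_sum ((norm (x + h))\<^sup>2 - (norm x)\<^sup>2) ^ k) UNIV) \<and>
     ((\<lambda>\<alpha>. \<bar>fst (CS k) \<alpha>\<bar> * monomial (\<chi> i. s) \<alpha>) has_sum snd (CS k)) UNIV \<and> snd (CS k) \<le> P s ^ k" by blast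
  define C S where "C k = fst (CS k)" and "S k = snd (CS k)" for k
  have C: "\<And>k h. (\<forall>i. \<bar>h $ i\<bar> \<le> s) \<Longrightarrow> ((\<lambda>\<alpha>. C k \<alpha> * monomial h \<alpha>) has_sum ((norm (x + h))\<^sup>2 - (norm x)\<^sup>2) ^ k) UNIV"
    "\<And>k. ((\<lambda>\<alpha>. \<bar>C k \<alpha>\<bar> * monomial (\<chi> i. s) \<alpha>) has_sum S k) UNIV" "\<And>k. S k \<le> P s ^ k"
    using CS by (auto simp: C_def S_def)
  define a where "a \<alpha> = (\<Sum>\<^sub>\<infinity>k\<in>UNIV. A k * C k \<alpha>)" for \<alpha>
  have S0: "0 \<le> S k" for k
    by (rule has_sum_nonneg[OF C(2)]) (intro mult_nonneg_nonneg monomial_nonneg, use s in auto)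
  have AP: "summable (\<lambda>k. norm (A k) * P s ^ k)"
  proof -
    \<comment> \<open>Convergence at a point strictly beyond \<open>P s\<close> gives absolute
      convergence at \<open>P s\<close>.\<close>
    obtain t where t: "P s < t" "t < r" using dense[OF s(2)] by blast
    have "summable (\<lambda>k. A k * t ^ k)" using A[of "(norm x)\<^sup>2 + t"] t P0 by (auto simp: sums_iff)
    then have "summable (\<lambda>k. norm (A k * P s ^ k))" by (rule powser_insidea) (use t P0 in auto)
    then show ?thesis using P0 by (simp add: abs_mult power_abs)
  qed
  have "summable (\<lambda>k. \<bar>A k\<bar> * S k)"
    by (rule summable_comparison_test'[OF AP, where N=0]) (use S0 C(3) in \<open>auto intro!: mult_left_mono\<close>)
  then have AS: "(\<lambda>k. \<bar>A k\<bar> * S k) summable_on UNIV"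
    using S0 by (intro norm_summable_imp_summable_on) simp
  have dom: "(\<lambda>(k, \<alpha>). \<bar>A k\<bar> * (\<bar>C k \<alpha>\<bar> * monomial (\<chi> i. s) \<alpha>)) summable_on UNIV \<times> UNIV"
  proof (rule summable_on_SigmaI[OF _ AS])
    show "((\<lambda>\<alpha>. case (k, \<alpha>) of (k, \<alpha>) \<Rightarrow> \<bar>A k\<bar> * (\<bar>C k \<alpha>\<bar> * monomial (\<chi> i. s) \<alpha>)) has_sum \<bar>A k\<bar> * S k) UNIV" for k
      using has_sum_cmult_right[OF C(2)] by simp
  qed (use s in \<open>auto intro!: mult_nonneg_nonneg monomial_nonneg\<close>)
  show "\<exists>a r. 0 < r \<and> (\<forall>y\<in>ball x r. ((\<lambda>\<alpha>. a \<alpha> * (\<Prod>i\<in>UNIV. (y $ i - x $ i) ^ (\<alpha> $ i))) has_sum F ((norm y)\<^sup>2)) UNIV)"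
  proof (intro exI[of _ a] exI[of _ s] conjI ballI s)
    fix y assume "y \<in> ball x s"
    define h where "h = y - x"
    have h: "\<forall>i. \<bar>h $ i\<bar> \<le> s"
      using \<open>y \<in> ball x s\<close> component_le_norm_cart[of h] by (auto simp: h_def dist_norm norm_minus_commute intro: order_trans less_imp_le)
    have y: "y = x + h" by (simp add: h_def)
    let ?T = "\<lambda>(k, \<alpha>). A k * (C k \<alpha> * monomial h \<alpha>)"
    have T: "?T summable_on UNIV \<times> UNIV"
    proof (rule abs_summable_summable, rule summable_on_comparison_test[OF dom])
      fix z :: "nat \<times> (nat^3)"
      obtain k \<alpha> where z: "z = (k, \<alpha>)" by fastforce
      show "norm (?T z) \<le> (case z of (k, \<alpha>) \<Rightarrow> \<bar>A k\<bar> * (\<bar>C k \<alpha>\<bar> * monomial (\<chi> i. s) \<alpha>))"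
        using h abs_monomial_le[of h s \<alpha>] by (auto simp: z abs_mult intro!: mult_left_mono)
    qed auto
    have "\<bar>(norm y)\<^sup>2 - (norm x)\<^sup>2\<bar> \<le> P s"
    proof -
      have "(norm y)\<^sup>2 - (norm x)\<^sup>2 = (\<Sum>i\<in>UNIV. 2 * x $ i * h $ i + h $ i * h $ i)"
        by (simp add: y power2_norm_eq_inner inner_vec_def sum_3 algebra_simps)
      also have "\<bar>\<dots>\<bar> \<le> P s"
        unfolding P_def
      proof (rule order_trans[OF sum_abs], rule sum_mono)
        fix i
        have "\<bar>2 * x $ i * h $ i + h $ i * h $ i\<bar> \<le> 2 * \<bar>x $ i\<bar> * \<bar>h $ i\<bar> + \<bar>h $ i\<bar> * \<bar>h $ i\<bar>"
          by (rule order_trans[OF abs_triangle_ineq]) (simp add: abs_mult)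
        also have "\<dots> \<le> 2 * \<bar>x $ i\<bar> * s + s * s" using h s by (intro add_mono mult_mono) auto
        finally show "\<bar>2 * x $ i * h $ i + h $ i * h $ i\<bar> \<le> 2 * \<bar>x $ i\<bar> * s + s * s" .
      qed
      finally show ?thesis .
    qed
    then have sums: "(\<lambda>k. A k * ((norm y)\<^sup>2 - (norm x)\<^sup>2) ^ k) sums F ((norm y)\<^sup>2)" using s by (intro A) linarith
    have inner: "((\<lambda>\<alpha>. ?T (k, \<alpha>)) has_sum A k * ((norm y)\<^sup>2 - (norm x)\<^sup>2) ^ k) UNIV" for k
      using has_sum_cmult_right[OF C(1)[OF h], of "A k" k] by (simp add: y)
    \<comment> \<open>Summed over the multi-indices first, the double series gives the value of F;
      summed over k first, it gives the coefficients \<open>a\<close>.\<close>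
    obtain V where V: "(?T has_sum V) (UNIV \<times> UNIV)" using T has_sum_infsum by blast
    have "((\<lambda>k. A k * ((norm y)\<^sup>2 - (norm x)\<^sup>2) ^ k) has_sum V) UNIV"
      by (rule has_sum_SigmaD[OF V inner])
    from has_sum_imp_sums[OF this] have "V = F ((norm y)\<^sup>2)" using sums sums_unique2 by blast
    with V have "((\<lambda>(\<alpha>, k). A k * (C k \<alpha> * monomial h \<alpha>)) has_sum F ((norm y)\<^sup>2)) (UNIV \<times> UNIV)"
      by (subst (asm) has_sum_swap) (simp add: case_prod_unfold)
    then have "((\<lambda>\<alpha>. a \<alpha> * monomial h \<alpha>) has_sum F ((norm y)\<^sup>2)) UNIV"
    proof (rule has_sum_SigmaD)
      fix \<alpha>
      have "(\<lambda>k. A k * (C k \<alpha> * monomial h \<alpha>)) summable_on UNIV"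
      proof -
        have "(\<lambda>(\<alpha>, k). A k * (C k \<alpha> * monomial h \<alpha>)) summable_on UNIV \<times> UNIV"
          using has_sum_imp_summable[OF \<open>((\<lambda>(\<alpha>, k). A k * (C k \<alpha> * monomial h \<alpha>)) has_sum F ((norm y)\<^sup>2)) (UNIV \<times> UNIV)\<close>] .
        from summable_on_SigmaD1[OF this, of \<alpha>] show ?thesis by simp
      qed
      then have "((\<lambda>k. A k * (C k \<alpha> * monomial h \<alpha>)) has_sum (\<Sum>\<^sub>\<infinity>k. A k * C k \<alpha> * monomial h \<alpha>)) UNIV"
        by (simp add: has_sum_infsum mult.assoc)
      then show "((\<lambda>k. case (\<alpha>, k) of (\<alpha>, k) \<Rightarrow> A k * (C k \<alpha> * monomial h \<alpha>)) has_sum a \<alpha> * monomial h \<alpha>) UNIV"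
        by (simp add: a_def infsum_cmult_left')
    qed
    then show "((\<lambda>\<alpha>. a \<alpha> * (\<Prod>i\<in>UNIV. (y $ i - x $ i) ^ (\<alpha> $ i))) has_sum F ((norm y)\<^sup>2)) UNIV"
      by (simp add: monomial_def h_def)
  qed
qed

section \<open>Analyticity and Darboux data of the explicit potentials\<close>

subsection \<open>The potentials\<close>

text \<open>Holomorphy provides a Taylor series on the whole disc; real values on the real axis
  allow passing to the real parts of its coefficients.\<close>

lemma has_real_power_series:
  fixes Fc :: "complex \<Rightarrow> complex"
  assumes hol: "Fc holomorphic_on ball (of_real t\<^sub>0) r" and r: "0 < r"
    and real: "\<And>t. \<bar>t - t\<^sub>0\<bar> < r \<Longrightarrow> Fc (of_real t) = of_real (F t)"
  shows "\<exists>A r. 0 < r \<and> (\<forall>t. \<bar>t - t\<^sub>0\<bar> < r \<longrightarrow> (\<lambda>k. A k * (t - t\<^sub>0) ^ k) sums F t)"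
proof -
  define c where "c k = (deriv ^^ k) Fc (of_real t\<^sub>0) / fact k" for k
  have "(\<lambda>k. Re (c k) * (t - t\<^sub>0) ^ k) sums F t" if t: "\<bar>t - t\<^sub>0\<bar> < r" for t
  proof -
    have "dist (of_real t\<^sub>0) (of_real t :: complex) < r"
      using t by (simp only: dist_of_real dist_real_def abs_minus_commute)
    then have "of_real t \<in> ball (of_real t\<^sub>0 :: complex) r" by (simp only: mem_ball)
    from holomorphic_power_series[OF hol this]
    have "(\<lambda>k. c k * (of_real t - of_real t\<^sub>0) ^ k) sums of_real (F t)"
      by (simp only: c_def real[OF t])
    then have "(\<lambda>k. Re (c k * (of_real t - of_real t\<^sub>0) ^ k)) sums Re (of_real (F t))" by (rule sums_Re)
    moreover have "Re (c k * (of_real t - of_real t\<^sub>0) ^ k) = Re (c k) * (t - t\<^sub>0) ^ k" for k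
      by (simp only: of_real_diff[symmetric] of_real_power[symmetric] times_complex.simps
        Re_complex_of_real Im_complex_of_real mult_zero_right diff_zero)
    ultimately show ?thesis by (simp only: Re_complex_of_real)
  qed
  then show ?thesis using r by (intro exI[of _ "\<lambda>k. Re (c k)"] exI[of _ r]) simp
qed

text \<open>The quotient (a - b) / (a + b) for a = N + 1/2 and b = d + 1.\<close>

definition potential_coefficient :: "nat \<Rightarrow> nat \<Rightarrow> real" where
  "potential_coefficient N d = (real N - real d - 1 / 2) / (real N + real d + 3 / 2)"

definition potential :: "nat \<Rightarrow> nat \<Rightarrow> real^3 \<Rightarrow> real" where
  "potential N d x = 8 * (real d + 1)\<^sup>2 * potential_coefficient N d * ((norm x)\<^sup>2) ^ d
     / (1 - potential_coefficient N d * ((norm x)\<^sup>2) ^ (d + 1))\<^sup>2"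

context
  fixes N d :: nat
  assumes dN: "d < N"
begin

private abbreviation "\<beta> \<equiv> potential_coefficient N d"
text \<open>The value of |x|^2 at which the denominator of the potential vanishes. It exceeds 1,
  which leaves room for analyticity beyond the closed ball.\<close>

private definition "R = root (d + 1) (1 / \<beta>)"

lemma beta_bounds: "0 < \<beta>" "\<beta> < 1"
proof -
  have "real d + 1 \<le> real N" using dN by linarith
  then show "0 < \<beta>" "\<beta> < 1" by (simp_all add: potential_coefficient_def)
qed

lemma R_power: "\<beta> * R ^ (d + 1) = 1" and R_gt_1: "1 < R"
proof -
  have "R ^ (d + 1) = 1 / \<beta>" unfolding R_def using beta_bounds by (intro real_root_pow_pos2) auto
  then show "\<beta> * R ^ (d + 1) = 1" using beta_bounds by simp
  have "1 < 1 / \<beta>" using beta_bounds by simp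
  then have "root (d + 1) 1 < R" unfolding R_def by (subst real_root_less_iff) auto
  then show "1 < R" by simp
qed

lemma beta_power_less_1:
  assumes "0 \<le> t" "t < R" shows "\<beta> * t ^ (d + 1) < 1"
proof -
  have "t ^ (d + 1) < R ^ (d + 1)" using assms by (intro power_strict_mono) auto
  then have "\<beta> * t ^ (d + 1) < \<beta> * R ^ (d + 1)" using beta_bounds by (intro mult_strict_left_mono) auto
  then show ?thesis by (simp only: R_power)
qed

lemma admissible_potential_potential: "admissible_potential (potential N d)"
  unfolding admissible_potential_def
proof (intro conjI ballI impI)
  show "0 \<le> potential N d x" for x
    unfolding potential_def using beta_bounds by (intro divide_nonneg_nonneg mult_nonneg_nonneg) auto
  show "potential N d x = potential N d y" if "norm x = norm y" for x y
    using that by (simp add: potential_def)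
  define F :: "real \<Rightarrow> real" where "F t = 8 * (real d + 1)\<^sup>2 * \<beta> * t ^ d / (1 - \<beta> * t ^ (d + 1))\<^sup>2" for t
  define Fc :: "complex \<Rightarrow> complex" where "Fc z = of_real (8 * (real d + 1)\<^sup>2 * \<beta>) * z ^ d / (1 - of_real \<beta> * z ^ (d + 1))\<^sup>2" for z
  have "real_analytic_on (\<lambda>x::real^3. F ((norm x)\<^sup>2)) {x. (norm x)\<^sup>2 < R}"
  proof (rule real_analytic_radial)
    fix t\<^sub>0 :: real assume t0: "0 \<le> t\<^sub>0" "t\<^sub>0 < R"
    show "\<exists>A r. 0 < r \<and> (\<forall>t. \<bar>t - t\<^sub>0\<bar> < r \<longrightarrow> (\<lambda>k. A k * (t - t\<^sub>0) ^ k) sums F t)"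
    proof (rule has_real_power_series)
      \<comment> \<open>The disc stays within |z| < R, where |\<beta> z^(d+1)| < 1.\<close>
      have "1 - of_real \<beta> * z ^ (d + 1) \<noteq> 0" if "z \<in> ball (of_real t\<^sub>0 :: complex) (R - t\<^sub>0)" for z
      proof
        assume z: "1 - of_real \<beta> * z ^ (d + 1) = 0"
        have "norm z \<le> norm (of_real t\<^sub>0 :: complex) + dist (of_real t\<^sub>0) z"
          using norm_triangle_sub[of z "of_real t\<^sub>0"] by (simp add: dist_norm norm_minus_commute)
        also have "\<dots> < R" using that t0 by simp
        finally have "\<beta> * norm z ^ (d + 1) < 1" by (intro beta_power_less_1) auto
        moreover have "of_real \<beta> * z ^ (d + 1) = 1" using z by (simp only: right_minus_eq)
        then have "norm (of_real \<beta> * z ^ (d + 1)) = 1" by (simp only: norm_one)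
        ultimately show False using beta_bounds by (simp add: norm_mult norm_power)
      qed
      then show "Fc holomorphic_on ball (of_real t\<^sub>0) (R - t\<^sub>0)"
        unfolding Fc_def by (intro holomorphic_intros) auto
      show "Fc (of_real t) = of_real (F t)" for t by (simp add: Fc_def F_def)
    qed (use t0 in simp)
  qed
  moreover have "(\<lambda>x::real^3. F ((norm x)\<^sup>2)) = potential N d" by (simp add: F_def potential_def fun_eq_iff)
  moreover have "open {x::real^3. (norm x)\<^sup>2 < R}" by (intro open_Collect_less continuous_intros)
  moreover have "cball 0 1 \<subseteq> {x::real^3. (norm x)\<^sup>2 < R}"
  proof
    fix x :: "real^3" assume "x \<in> cball 0 1"
    then have "(norm x)\<^sup>2 \<le> 1" by (simp add: power_le_one)
    then show "x \<in> {x. (norm x)\<^sup>2 < R}" using R_gt_1 by simp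
  qed
  ultimately show "\<exists>U. open U \<and> cball 0 1 \<subseteq> U \<and> real_analytic_on (potential N d) U" by auto
qed

text \<open>The predicate \<open>smooth\<close> refers to all of space, but the denominator 1 -
  \<beta> |x|^(2d+2) has zeros outside the ball. The blend \<open>D\<close> leaves it unchanged for
  |x| \<le> 1 and replaces it by 1 for |x|^2 \<ge> R.\<close>

private definition "\<chi>\<^sub>R x = step ((R - (norm x)\<^sup>2) / (R - 1))" for x :: "real^3"
private definition "D x = \<chi>\<^sub>R x * (1 - \<beta> * ((norm x)\<^sup>2) ^ (d + 1)) + (1 - \<chi>\<^sub>R x)" for x :: "real^3"
private definition "Z x = inverse (D x)" for x :: "real^3"

text \<open>For |x|^2 < R the blend is a convex combination of two positive numbers, and beyond it
  is 1.\<close>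

lemma smooth_D: "smooth D" and D_nonzero: "D x \<noteq> 0"
  and D_eq: "norm x \<le> 1 \<Longrightarrow> D x = 1 - \<beta> * ((norm x)\<^sup>2) ^ (d + 1)"
proof -
  have "smooth \<chi>\<^sub>R"
    unfolding \<chi>\<^sub>R_def[abs_def] divide_inverse
    by (intro smooth_step smooth_mult smooth_diff smooth_const smooth_power2_norm)
  then show "smooth D"
    unfolding D_def[abs_def] by (intro smooth_add smooth_mult smooth_diff smooth_const smooth_power smooth_power2_norm)
  have \<chi>: "0 \<le> \<chi>\<^sub>R x" "\<chi>\<^sub>R x \<le> 1" by (simp_all add: \<chi>\<^sub>R_def step_nonneg step_le_1)
  show "D x \<noteq> 0"
  proof (cases "(norm x)\<^sup>2 < R")
    case True
    then have "0 < 1 - \<beta> * ((norm x)\<^sup>2) ^ (d + 1)" using beta_power_less_1[of "(norm x)\<^sup>2"] by simp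
    with \<chi> have "0 < D x" unfolding D_def
      by (cases "\<chi>\<^sub>R x = 0") (auto intro!: add_pos_nonneg mult_pos_pos)
    then show ?thesis by simp
  next
    case False
    then have "\<chi>\<^sub>R x = 0" unfolding \<chi>\<^sub>R_def using R_gt_1 by (intro step_le_0) (simp add: divide_nonpos_pos)
    then show ?thesis by (simp add: D_def)
  qed
  assume "norm x \<le> 1"
  then have "(norm x)\<^sup>2 \<le> 1" by (simp add: power_le_one)
  then have "\<chi>\<^sub>R x = 1" unfolding \<chi>\<^sub>R_def using R_gt_1 by (intro step_ge_1) simp
  then show "D x = 1 - \<beta> * ((norm x)\<^sup>2) ^ (d + 1)" by (simp add: D_def)
qed

lemma smooth_Z: "smooth Z"
  unfolding Z_def[abs_def] by (intro smooth_inverse D_nonzero smooth_D)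

lemma gradient_power_norm:
  "gradient (\<lambda>x::real^3. ((norm x)\<^sup>2) ^ Suc k) x $ i = (2 * (real k + 1)) * ((norm x)\<^sup>2) ^ k * x $ i"
proof -
  have "((\<lambda>x::real^3. (x \<bullet> x) ^ Suc k) has_derivative (\<lambda>h. (real (Suc k) * (x \<bullet> x) ^ k) * (2 * (x \<bullet> h)))) (at x)"
  proof -
    have "((\<lambda>x::real^3. x \<bullet> x) has_derivative (\<lambda>h. 2 * (x \<bullet> h))) (at x)"
      by (auto intro!: derivative_eq_intros simp: inner_commute)
    from has_derivative_compose[OF this DERIV_pow[of "Suc k", unfolded has_field_derivative_def]]
    show ?thesis by simp
  qed
  from gradient_nth[OF this, of i] show ?thesis by (simp add: power2_norm_eq_inner inner_axis algebra_simps)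
qed

lemma gradient_Z:
  assumes "x \<in> B"
  shows "gradient Z x $ i = 2 * \<beta> * (real d + 1) * ((norm x)\<^sup>2) ^ d * (Z x)\<^sup>2 * x $ i"
proof -
  have s: "smooth (\<lambda>x::real^3. ((norm x)\<^sup>2) ^ (d + 1))" by (intro smooth_power smooth_power2_norm)
  have "gradient D x = gradient (\<lambda>x. 1 + (- \<beta>) * ((norm x)\<^sup>2) ^ (d + 1)) x"
    by (rule gradient_cong_open[of B]) (use assms in \<open>auto simp: D_eq\<close>)
  then have "gradient D x $ i = (- \<beta>) * gradient (\<lambda>x. ((norm x)\<^sup>2) ^ (d + 1)) x $ i"
    by (simp only: gradient_add[OF smooth_const smooth_mult[OF smooth_const s]] gradient_mult[OF smooth_const s] gradient_const) simp
  also have "\<dots> = - \<beta> * ((2 * (real d + 1)) * ((norm x)\<^sup>2) ^ d * x $ i)"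
    using gradient_power_norm[of d x i] by simp
  finally have gD: "gradient D x $ i = - \<beta> * ((2 * (real d + 1)) * ((norm x)\<^sup>2) ^ d * x $ i)" .
  have "(D has_derivative (\<lambda>h. \<Sum>i\<in>UNIV. h $ i *\<^sub>R (gradient D x $ i))) (at x)" by (rule smooth_has_derivative[OF smooth_D])
  from gradient_nth[OF Deriv.has_derivative_inverse[OF D_nonzero this], of i]
    gradient_nth[OF this, of i]
  have "gradient Z x $ i = - (inverse (D x) * gradient D x $ i * inverse (D x))"
    by (simp add: Z_def[abs_def])
  then show ?thesis by (simp add: gD Z_def power2_eq_square algebra_simps)
qed

text \<open>On the ball, with b = d + 1, W = \<open>mm\<close> + N + 1/2 is b (1 + \<beta> r^(2b)) /
  (1 - \<beta> r^(2b)), a solution of r W' = W^2 - b^2. The subtracted constant makes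
  \<open>mm\<close> vanish on the sphere, and \<open>rho\<close> extends (W^2 - b^2) / r^2 to the
  origin.\<close>

private definition "mm x = 2 * (real d + 1) * Z x - (real N + real d + 3 / 2)" for x :: "real^3"
private definition "rho x = 4 * (real d + 1)\<^sup>2 * \<beta> * (((norm x)\<^sup>2) ^ d * (Z x * Z x))" for x :: "real^3"

text \<open>Trades the power of the norm for Z, so that the Euler relation for \<open>rho\<close>
  closes up in terms of \<open>mm\<close>.\<close>

lemma Z_relation: "norm x \<le> 1 \<Longrightarrow> \<beta> * ((norm x)\<^sup>2) ^ (d + 1) * Z x = Z x - 1"
  using D_nonzero[of x] by (simp add: Z_def D_eq field_simps)

lemma sum_power2_norm: "(\<Sum>i\<in>UNIV. x $ i * x $ i) = (norm (x :: real^3))\<^sup>2"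
  by (simp add: power2_norm_eq_inner inner_vec_def)

lemma Euler_power_norm:
  "(\<Sum>i\<in>UNIV. x $ i * gradient (\<lambda>x::real^3. ((norm x)\<^sup>2) ^ k) x $ i) = 2 * real k * ((norm x)\<^sup>2) ^ k"
proof (cases k)
  case (Suc j)
  have "(\<Sum>i\<in>UNIV. x $ i * gradient (\<lambda>x::real^3. ((norm x)\<^sup>2) ^ k) x $ i)
     = (2 * (real j + 1)) * ((norm x)\<^sup>2) ^ j * (\<Sum>i\<in>UNIV. x $ i * x $ i)"
    unfolding Suc gradient_power_norm sum_distrib_left by (intro sum.cong refl) simp
  also have "\<dots> = 2 * real k * ((norm x)\<^sup>2) ^ k" unfolding sum_power2_norm Suc by simp
  finally show ?thesis .
qed (simp add: gradient_const)

lemma darboux_potential: "darboux mm rho N ((real N + 1 / 2)\<^sup>2 - (real d + 1)\<^sup>2)"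
proof
  show "smooth mm" unfolding mm_def[abs_def] by (intro smooth_diff smooth_mult smooth_const smooth_Z)
  have sZZ: "smooth (\<lambda>x. Z x * Z x)" by (intro smooth_mult smooth_Z)
  have sn: "smooth (\<lambda>x::real^3. ((norm x)\<^sup>2) ^ d)" by (intro smooth_power smooth_power2_norm)
  show "smooth rho" unfolding rho_def[abs_def] by (intro smooth_mult smooth_const sn smooth_Z)
  fix x :: "real^3"
  show "gradient mm x $ i = rho x * x $ i" if "x \<in> B" for i
  proof -
    have "mm = (\<lambda>x. (2 * (real d + 1)) * Z x + (- (real N + real d + 3 / 2)))" by (simp add: mm_def fun_eq_iff)
    then have "gradient mm x $ i = (2 * (real d + 1)) * gradient Z x $ i"
      by (simp only: gradient_add[OF smooth_mult[OF smooth_const smooth_Z] smooth_const] gradient_mult[OF smooth_const smooth_Z] gradient_const) simp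
    then show ?thesis by (simp add: gradient_Z[OF that] rho_def power2_eq_square algebra_simps)
  qed
  show "(\<Sum>i\<in>UNIV. x $ i * gradient rho x $ i) = rho x * (2 * mm x + 2 * real N - 1)" if "x \<in> B"
  proof -
    let ?k = "4 * (real d + 1)\<^sup>2 * \<beta>" and ?n = "(norm x)\<^sup>2"
    have gZZ: "gradient (\<lambda>x. Z x * Z x) x $ i = (4 * \<beta> * (real d + 1) * ?n ^ d * (Z x) ^ 3) * x $ i" for i
      unfolding gradient_mult[OF smooth_Z smooth_Z] gradient_Z[OF that] by (simp add: power2_eq_square power3_eq_cube algebra_simps)
    have "gradient rho x $ i = ?k * (?n ^ d * gradient (\<lambda>x. Z x * Z x) x $ i + gradient (\<lambda>x. ((norm x)\<^sup>2) ^ d) x $ i * (Z x * Z x))" for i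
      unfolding rho_def[abs_def] gradient_mult[OF smooth_const smooth_mult[OF sn sZZ]] gradient_mult[OF sn sZZ] gradient_const by simp
    then have "(\<Sum>i\<in>UNIV. x $ i * gradient rho x $ i)
      = ?k * (?n ^ d * (4 * \<beta> * (real d + 1) * ?n ^ d * (Z x) ^ 3) * (\<Sum>i\<in>UNIV. x $ i * x $ i)
         + (Z x * Z x) * (\<Sum>i\<in>UNIV. x $ i * gradient (\<lambda>x. ((norm x)\<^sup>2) ^ d) x $ i))"
      unfolding gZZ by (simp add: sum_3 algebra_simps)
    also have "\<dots> = rho x * (4 * (real d + 1) * (\<beta> * ?n ^ (d + 1) * Z x) + 2 * real d)"
      unfolding sum_power2_norm Euler_power_norm rho_def by (simp add: power3_eq_cube algebra_simps)
    also have "\<beta> * ?n ^ (d + 1) * Z x = Z x - 1" using that by (intro Z_relation) simp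
    finally show ?thesis by (simp add: mm_def algebra_simps)
  qed
  assume "norm x = 1"
  then have Zx: "Z x = inverse (1 - \<beta>)" by (simp add: Z_def D_eq)
  \<comment> \<open>This is a + b. Since 1 - \<beta> = 2 b / (a + b), the value of 2 b Z on the
    sphere is a + b, and \<open>rho\<close> becomes \<beta> e^2 = (a - b) (a + b).\<close>
  define e where "e = real N + real d + 3 / 2"
  have e: "0 < e" by (simp add: e_def)
  have be: "\<beta> * e = real N - real d - 1 / 2"
    using e unfolding potential_coefficient_def e_def[symmetric] by simp
  then have "(1 - \<beta>) * e = 2 * (real d + 1)" by (simp add: left_diff_distrib e_def)
  then have Ze: "2 * (real d + 1) * Z x = e" using beta_bounds unfolding Zx by (simp add: field_simps)
  then show "mm x = 0" by (simp add: mm_def e_def)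
  have "rho x = \<beta> * (2 * (real d + 1) * Z x) * (2 * (real d + 1) * Z x)"
    using \<open>norm x = 1\<close> by (simp add: rho_def power2_eq_square algebra_simps)
  also have "\<dots> = (real N - real d - 1 / 2) * e" unfolding Ze be ..
  also have "\<dots> = (real N + 1 / 2)\<^sup>2 - (real d + 1)\<^sup>2" by (simp add: e_def power2_eq_square algebra_simps)
  finally show "rho x = (real N + 1 / 2)\<^sup>2 - (real d + 1)\<^sup>2" .
qed

lemma potential_eq_rho: "x \<in> B \<Longrightarrow> potential N d x = 2 * rho x"
  by (simp add: potential_def rho_def Z_def D_eq power2_eq_square divide_inverse)

lemma potential_darboux:
  "\<exists>m \<rho>. darboux m \<rho> N ((real N + 1 / 2)\<^sup>2 - (real d + 1)\<^sup>2) \<and> (\<forall>x\<in>B. potential N d x = 2 * \<rho> x)"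
  using darboux_potential potential_eq_rho by blast

end

text \<open>The order of quantifiers is essential: the extension of g, the harmonic function and its
  radial average are fixed before d, so the two coefficients are common to all d < N.\<close>

lemma DN_map_potential_affine:
  fixes f g :: "real^3 \<Rightarrow> 'a::{real_normed_field,euclidean_space}"
  assumes f: "f \<in> H_half" and g: "g \<in> H_half" and N: "2 \<le> N"
  shows "\<exists>\<alpha> \<beta>. \<forall>d<N. DN_map (potential N d) f g = \<alpha> + ((real N + 1 / 2)\<^sup>2 - (real d + 1)\<^sup>2) *\<^sub>R \<beta>"
proof -
  obtain U w where U: "has_trace U f" and w: "has_trace w g" using f g by (auto simp: H_half_def)
  have w': "sobolev_trace w (weak_gradient B w) g" by (rule has_trace_imp_sobolev_trace[OF w])
  from weakly_harmonic_extension_exists[OF has_trace_imp_sobolev_trace[OF U]]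
  obtain u\<^sub>0 G\<^sub>0 where "sobolev_trace u\<^sub>0 G\<^sub>0 f \<and>
    (\<forall>\<psi>. test_function B \<psi> \<longrightarrow> (\<integral>x. (\<Sum>j\<in>UNIV. gradient \<psi> x $ j *\<^sub>R (G\<^sub>0 x $ j)) \<partial>vol B) = 0)"
    by (elim exE)
  note u0 = this[THEN conjunct1] this[THEN conjunct2, rule_format]
  have "\<exists>v H. sobolev v H \<and>
    (\<forall>\<psi>. test_function B \<psi> \<longrightarrow> (\<integral>x. (\<Sum>j\<in>UNIV. gradient \<psi> x $ j *\<^sub>R (H x $ j)) \<partial>vol B) = 0) \<and>
    (AE x in vol B. (\<Sum>i\<in>UNIV. x $ i *\<^sub>R (H x $ i)) + (real N + 1) *\<^sub>R v x = u\<^sub>0 x)"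
    by (rule radial_average_exists[OF u0(1) N]) (rule u0(2))
  then obtain v H where "sobolev v H \<and>
    (\<forall>\<psi>. test_function B \<psi> \<longrightarrow> (\<integral>x. (\<Sum>j\<in>UNIV. gradient \<psi> x $ j *\<^sub>R (H x $ j)) \<partial>vol B) = 0) \<and>
    (AE x in vol B. (\<Sum>i\<in>UNIV. x $ i *\<^sub>R (H x $ i)) + (real N + 1) *\<^sub>R v x = u\<^sub>0 x)"
    by (elim exE)
  note v = this[THEN conjunct1] this[THEN conjunct2, THEN conjunct1, rule_format] this[THEN conjunct2, THEN conjunct2]
  have "DN_map (potential N d) f g = (\<integral>x. (\<Sum>j\<in>UNIV. G\<^sub>0 x $ j * weak_gradient B w x $ j) \<partial>vol B)
     + ((real N + 1 / 2)\<^sup>2 - (real d + 1)\<^sup>2) *\<^sub>R (\<integral>x. 3 *\<^sub>R (v x * w x) + (\<Sum>j\<in>UNIV. x $ j *\<^sub>R (H x $ j)) * w x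
       + v x * (\<Sum>j\<in>UNIV. x $ j *\<^sub>R (weak_gradient B w x $ j)) \<partial>vol B)" if "d < N" for d
  proof -
    obtain m \<rho> where m: "darboux m \<rho> N ((real N + 1 / 2)\<^sup>2 - (real d + 1)\<^sup>2)" "\<And>x. x \<in> B \<Longrightarrow> potential N d x = 2 * \<rho> x"
      using potential_darboux[OF \<open>d < N\<close>] by blast
    interpret darboux_solution m \<rho> N "(real N + 1 / 2)\<^sup>2 - (real d + 1)\<^sup>2" u\<^sub>0 v G\<^sub>0 H f
      by (intro darboux_solution.intro darboux_solution_axioms.intro m u0 v)
    have "0 \<le> potential N d x" if "x \<in> B" for x
      using admissible_potential_potential[OF \<open>d < N\<close>] that by (auto simp: admissible_potential_def)
    then show ?thesis by (intro DN_map_affine m w')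
  qed
  then show ?thesis by blast
qed

text \<open>\<open>sesq_pairing\<close> evaluates a functional at the conjugate of g, which has to
  be a trace again.\<close>

lemma H_half_cnj:
  assumes "g \<in> H_half" shows "(\<lambda>x. cnj (g x)) \<in> H_half"
proof -
  obtain w where "has_trace w g" using assms by (auto simp: H_half_def)
  from sobolev_trace_imp_has_trace[OF sobolev_trace_bounded_linear[OF bounded_linear_cnj has_trace_imp_sobolev_trace[OF this]]]
  show ?thesis by (auto simp: H_half_def)
qed

section \<open>Finite differences of polynomials and alternating sums over subsets\<close>

subsection \<open>Matching moments\<close>

text \<open>The negative of the usual difference: the n-fold iterate at 0 then gives the value at k
  the sign (-1)^k, as in alternating sums over subsets.\<close>

definition forward_difference :: "(nat \<Rightarrow> 'a::ab_group_add) \<Rightarrow> nat \<Rightarrow> 'a" where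
  "forward_difference f x = f x - f (x + 1)"

lemma forward_difference_zero: "(forward_difference ^^ n) (\<lambda>x. 0) = (\<lambda>x. 0)"
  by (induction n) (simp_all add: forward_difference_def[abs_def])

lemma forward_difference_add:
  "(forward_difference ^^ n) (\<lambda>x. f x + g x) = (\<lambda>x. (forward_difference ^^ n) f x + (forward_difference ^^ n) g x)"
  by (induction n) (simp_all add: forward_difference_def[abs_def] fun_eq_iff)

lemma forward_difference_cmult:
  "(forward_difference ^^ n) (\<lambda>x. a * f x) = (\<lambda>x. a * (forward_difference ^^ n) f x)" for a :: "'a::ring"
  by (induction n) (simp_all add: forward_difference_def[abs_def] fun_eq_iff algebra_simps)

lemma forward_difference_scaleR:
  fixes f :: "nat \<Rightarrow> 'a::real_vector"
  shows
  "(forward_difference ^^ n) (\<lambda>x. a *\<^sub>R f x) = (\<lambda>x. a *\<^sub>R (forward_difference ^^ n) f x)"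
  by (induction n) (simp_all add: forward_difference_def[abs_def] fun_eq_iff algebra_simps)

lemma forward_difference_shift:
  "(forward_difference ^^ n) (\<lambda>x. f (Suc x)) = (\<lambda>x. (forward_difference ^^ n) f (Suc x))"
  by (induction n) (simp_all add: forward_difference_def[abs_def] fun_eq_iff)

text \<open>Discrete Leibniz rule: the difference of (a + b x) f is (a + b x) times the difference
  of f, minus b times a shift of f. A linear factor thus raises the order of annihilation by
  one.\<close>

lemma forward_difference_linear:
  fixes f :: "nat \<Rightarrow> 'a::real_vector"
  assumes "(forward_difference ^^ n) f = (\<lambda>x. 0)"
  shows "(forward_difference ^^ Suc n) (\<lambda>x. (a + b * real x) *\<^sub>R f x) = (\<lambda>x. 0)"
  using assms
proof (induction n arbitrary: f)
  case 0
  then show ?case by (simp add: forward_difference_def[abs_def])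
next
  case (Suc n)
  have e: "forward_difference (\<lambda>x. (a + b * real x) *\<^sub>R f x)
    = (\<lambda>x. (a + b * real x) *\<^sub>R forward_difference f x + (- b) *\<^sub>R f (Suc x))"
    by (simp add: forward_difference_def[abs_def] fun_eq_iff algebra_simps)
  have "(forward_difference ^^ n) (forward_difference f) = (\<lambda>x. 0)"
    using Suc.prems by (simp only: funpow_Suc_right o_def)
  from Suc.IH[OF this]
  show ?case
    unfolding funpow_Suc_right[of "Suc n"] o_def e forward_difference_add forward_difference_scaleR forward_difference_shift
    by (simp only: Suc.prems) simp
qed

text \<open>A^2 - (d + 1)^2 factors into A - 1 - d and A + 1 + d, so each factor of the product
  costs two orders of differences.\<close>

lemma forward_difference_prod:
  fixes \<alpha> \<beta> :: "nat \<Rightarrow> 'a::{real_algebra_1,comm_ring_1}"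
  shows "(forward_difference ^^ (2 * r + 1)) (\<lambda>d. \<Prod>j=1..r. \<alpha> j + (A\<^sup>2 - (real d + 1)\<^sup>2) *\<^sub>R \<beta> j) = (\<lambda>x. 0)"
proof (induction r)
  case 0
  show ?case by (simp add: forward_difference_def[abs_def])
next
  case (Suc r)
  let ?P = "\<lambda>d. \<Prod>j=1..r. \<alpha> j + (A\<^sup>2 - (real d + 1)\<^sup>2) *\<^sub>R \<beta> j"
  have "(\<lambda>d. \<Prod>j=1..Suc r. \<alpha> j + (A\<^sup>2 - (real d + 1)\<^sup>2) *\<^sub>R \<beta> j)
     = (\<lambda>d. \<alpha> (Suc r) * ?P d + \<beta> (Suc r) * (((A - 1) + (-1) * real d) *\<^sub>R (((A + 1) + 1 * real d) *\<^sub>R ?P d)))"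
  proof -
    have "(a + (A\<^sup>2 - (real d + 1)\<^sup>2) *\<^sub>R b) * p = a * p + b * (((A - 1) + (-1) * real d) *\<^sub>R (((A + 1) + 1 * real d) *\<^sub>R p))"
      for a b p :: 'a and d
    proof -
      have "((A - 1) + (-1) * real d) * ((A + 1) + 1 * real d) = A\<^sup>2 - (real d + 1)\<^sup>2"
        by (simp add: power2_eq_square algebra_simps)
      then show ?thesis unfolding scaleR_scaleR by (simp only: distrib_right mult_scaleR_left mult_scaleR_right)
    qed
    note step = this
    have "(\<Prod>j=1..Suc r. \<alpha> j + (A\<^sup>2 - (real d + 1)\<^sup>2) *\<^sub>R \<beta> j)
      = (\<alpha> (Suc r) + (A\<^sup>2 - (real d + 1)\<^sup>2) *\<^sub>R \<beta> (Suc r)) * ?P d" for d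
      by (rule prod.nat_ivl_Suc') simp
    then show ?thesis by (simp only: step)
  qed
  moreover have "(forward_difference ^^ (2 * Suc r + 1)) ?P = (\<lambda>x. 0)"
  proof -
    have "2 * Suc r + 1 = 2 + (2 * r + 1)" by simp
    then have "(forward_difference ^^ (2 * Suc r + 1)) ?P = (forward_difference ^^ 2) ((forward_difference ^^ (2 * r + 1)) ?P)"
      by (simp only: funpow_add o_apply)
    also have "\<dots> = (forward_difference ^^ 2) (\<lambda>x. 0)" by (rule arg_cong[OF Suc])
    also have "\<dots> = (\<lambda>x. 0)" by (rule forward_difference_zero)
    finally show ?thesis .
  qed
  moreover have "(forward_difference ^^ (2 * Suc r + 1)) (\<lambda>d. ((A - 1) + (-1) * real d) *\<^sub>R (((A + 1) + 1 * real d) *\<^sub>R ?P d)) = (\<lambda>x. 0)"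
  proof -
    have "2 * Suc r + 1 = Suc (Suc (2 * r + 1))" by simp
    then show ?thesis
      using forward_difference_linear[OF forward_difference_linear[OF Suc], of "A - 1" "-1" "A + 1" 1] by (simp only:)
  qed
  ultimately show ?case
    by (simp only: forward_difference_add forward_difference_cmult) simp
qed

text \<open>Subsets of \<open>{..<Suc n}\<close> are split by membership of n. Adding n raises the
  cardinality by one and flips the sign, which amounts to one application of
  \<open>forward_difference\<close>.\<close>

lemma sum_Pow_forward_difference:
  fixes f :: "nat \<Rightarrow> 'a::{real_algebra_1}"
  shows "(\<Sum>S\<in>Pow {..<n}. (-1) ^ card S * f (card S)) = (forward_difference ^^ n) f 0"
proof (induction n arbitrary: f)
  case 0
  show ?case by simp
next
  case (Suc n)
  have inj: "inj_on (insert n) (Pow {..<n})" by (auto simp: inj_on_def)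
  have card: "card (insert n S) = Suc (card S)" if "S \<in> Pow {..<n}" for S
    using that finite_subset[of S "{..<n}"] by (subst card_insert_disjoint) auto
  have "(\<Sum>S\<in>Pow {..<Suc n}. (-1) ^ card S * f (card S))
     = (\<Sum>S\<in>Pow {..<n}. (-1) ^ card S * f (card S)) + (\<Sum>S\<in>insert n ` Pow {..<n}. (-1) ^ card S * f (card S))"
    unfolding lessThan_Suc Pow_insert by (rule sum.union_disjoint) auto
  also have "(\<Sum>S\<in>insert n ` Pow {..<n}. (-1) ^ card S * f (card S)) = (\<Sum>S\<in>Pow {..<n}. - ((-1) ^ card S * f (Suc (card S))))"
    by (subst sum.reindex[OF inj]) (intro sum.cong refl, simp add: card)
  also have "(\<Sum>S\<in>Pow {..<n}. (-1) ^ card S * f (card S)) + \<dots> = (\<Sum>S\<in>Pow {..<n}. (-1) ^ card S * forward_difference f (card S))"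
    by (simp add: forward_difference_def algebra_simps flip: sum.distrib)
  also have "\<dots> = (forward_difference ^^ n) (forward_difference f) 0" by (rule Suc.IH)
  finally show ?case by (simp only: funpow_Suc_right o_def)
qed

definition even_subsets :: "nat \<Rightarrow> nat set set" where
  "even_subsets n = {S \<in> Pow {..<n}. even (card S)}"

definition odd_subsets :: "nat \<Rightarrow> nat set set" where
  "odd_subsets n = {S \<in> Pow {..<n}. odd (card S)}"

lemma even_odd_subsets:
  "finite (even_subsets n)" "finite (odd_subsets n)" "{} \<in> even_subsets n" "0 < n \<Longrightarrow> {0} \<in> odd_subsets n"
  by (auto simp: even_subsets_def odd_subsets_def)

lemma sum_even_odd_subsets:
  fixes f :: "nat \<Rightarrow> 'a::{real_algebra_1}"
  shows "(\<Sum>S\<in>even_subsets n. f (card S)) - (\<Sum>S\<in>odd_subsets n. f (card S)) = (forward_difference ^^ n) f 0"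
proof -
  have "Pow {..<n} = even_subsets n \<union> odd_subsets n" by (auto simp: even_subsets_def odd_subsets_def)
  then have "(\<Sum>S\<in>Pow {..<n}. (-1) ^ card S * f (card S))
     = (\<Sum>S\<in>even_subsets n. (-1) ^ card S * f (card S)) + (\<Sum>S\<in>odd_subsets n. (-1) ^ card S * f (card S))"
    by (simp only:) (intro sum.union_disjoint; auto simp: even_subsets_def odd_subsets_def)
  also have "(\<Sum>S\<in>even_subsets n. (-1) ^ card S * f (card S)) = (\<Sum>S\<in>even_subsets n. f (card S))"
    by (intro sum.cong refl) (simp add: even_subsets_def)
  also have "(\<Sum>S\<in>odd_subsets n. (-1) ^ card S * f (card S)) = - (\<Sum>S\<in>odd_subsets n. f (card S))"
    unfolding sum_negf[symmetric] by (intro sum.cong refl) (simp add: odd_subsets_def)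
  finally show ?thesis by (simp add: sum_Pow_forward_difference)
qed

text \<open>The alternating sum of the constant 1 vanishes; hence the two uniform distributions have
  equal weights.\<close>

lemma card_even_odd_subsets:
  assumes "0 < n" shows "card (even_subsets n) = card (odd_subsets n)"
proof -
  obtain m where n: "n = Suc m" using assms gr0_implies_Suc by blast
  have "(forward_difference ^^ n) (\<lambda>_. 1 :: real) = (\<lambda>x. 0)"
  proof -
    have "forward_difference (\<lambda>_. 1 :: real) = (\<lambda>x. 0)" by (simp add: forward_difference_def fun_eq_iff)
    then show ?thesis unfolding n by (simp only: funpow_Suc_right o_def forward_difference_zero)
  qed
  then show ?thesis using sum_even_odd_subsets[of "\<lambda>_. 1 :: real" n] by simp
qed

lemma expectation_pmf_of_set:
  fixes F :: "'b \<Rightarrow> 'a::{banach,second_countable_topology}"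
  assumes "finite X" "X \<noteq> {}"
  shows "measure_pmf.expectation (map_pmf h (pmf_of_set X)) F = (1 / real (card X)) *\<^sub>R (\<Sum>S\<in>X. F (h S))"
proof -
  have "measure_pmf.expectation (map_pmf h (pmf_of_set X)) F = measure_pmf.expectation (pmf_of_set X) (\<lambda>S. F (h S))"
    by simp
  also have "\<dots> = (\<Sum>S\<in>X. pmf (pmf_of_set X) S *\<^sub>R F (h S))"
    by (rule integral_measure_pmf[OF assms(1)]) (use assms in auto)
  also have "\<dots> = (1 / real (card X)) *\<^sub>R (\<Sum>S\<in>X. F (h S))"
    unfolding scaleR_sum_right using assms by (intro sum.cong refl) simp
  finally show ?thesis .
qed

text \<open>Differences beyond the order 2 r + 1 preserve 0, so one n serves all moments up to a
  given order.\<close>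

lemma expectation_even_odd:
  fixes F :: "(real^3 \<Rightarrow> real) \<Rightarrow> 'a::{real_normed_field,banach,second_countable_topology}"
  assumes n: "2 * r + 1 \<le> n"
    and F: "\<And>d. d \<le> n \<Longrightarrow> F (q d) = (\<Prod>j=1..r. \<alpha> j + (A\<^sup>2 - (real d + 1)\<^sup>2) *\<^sub>R \<beta> j)"
  shows "measure_pmf.expectation (map_pmf (\<lambda>S. q (card S)) (pmf_of_set (even_subsets n))) F
       = measure_pmf.expectation (map_pmf (\<lambda>S. q (card S)) (pmf_of_set (odd_subsets n))) F"
proof -
  let ?P = "\<lambda>d. \<Prod>j=1..r. \<alpha> j + (A\<^sup>2 - (real d + 1)\<^sup>2) *\<^sub>R \<beta> j"
  have n0: "0 < n" using n by simp
  have ne: "even_subsets n \<noteq> {}" "odd_subsets n \<noteq> {}" using even_odd_subsets(3) even_odd_subsets(4)[OF n0] by blast+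
  have le: "card S \<le> n" if "S \<subseteq> {..<n}" for S using card_mono[OF _ that] by simp
  have "(\<Sum>S\<in>even_subsets n. F (q (card S))) = (\<Sum>S\<in>even_subsets n. ?P (card S))"
    by (intro sum.cong refl F le) (auto simp: even_subsets_def)
  moreover have "(\<Sum>S\<in>odd_subsets n. F (q (card S))) = (\<Sum>S\<in>odd_subsets n. ?P (card S))"
    by (intro sum.cong refl F le) (auto simp: odd_subsets_def)
  moreover have "(\<Sum>S\<in>even_subsets n. ?P (card S)) = (\<Sum>S\<in>odd_subsets n. ?P (card S))"
  proof -
    have "(forward_difference ^^ n) ?P = (forward_difference ^^ (n - (2 * r + 1))) ((forward_difference ^^ (2 * r + 1)) ?P)"
      using n by (simp only: funpow_add[symmetric, THEN fun_cong, unfolded o_def] le_add_diff_inverse2)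
    then have "(forward_difference ^^ n) ?P 0 = 0" by (simp only: forward_difference_prod forward_difference_zero)
    then show ?thesis using sum_even_odd_subsets[of ?P n] by simp
  qed
  ultimately have "(\<Sum>S\<in>even_subsets n. F (q (card S))) = (\<Sum>S\<in>odd_subsets n. F (q (card S)))" by (simp only:)
  then show ?thesis
    unfolding expectation_pmf_of_set[OF even_odd_subsets(1) ne(1)] expectation_pmf_of_set[OF even_odd_subsets(2) ne(2)]
    by (simp only: card_even_odd_subsets[OF n0])
qed

theorem theorem3p5:
  fixes M :: nat
  assumes "M \<ge> 1"
  shows "\<exists>P\<^sub>A P\<^sub>B :: (real ^ 3 \<Rightarrow> real) pmf.
    random_potential P\<^sub>A \<and> random_potential P\<^sub>B \<and>
    (\<exists>x\<in>B. mean_potential P\<^sub>A x \<noteq> mean_potential P\<^sub>B x) \<and>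
    (\<forall>r\<in>{1..M}. \<forall>f g :: nat \<Rightarrow> real ^ 3 \<Rightarrow> real.
       (\<forall>j\<in>{1..r}. f j \<in> H_half \<and> g j \<in> H_half) \<longrightarrow>
       integrable (measure_pmf P\<^sub>A) (real_DN_product r f g) \<and>
       integrable (measure_pmf P\<^sub>B) (real_DN_product r f g) \<and>
       measure_pmf.expectation P\<^sub>A (real_DN_product r f g)
         = measure_pmf.expectation P\<^sub>B (real_DN_product r f g)) \<and>
    (\<forall>r\<in>{1..M}. \<forall>S\<subseteq>{1..r}. \<forall>f g :: nat \<Rightarrow> real ^ 3 \<Rightarrow> complex.
       (\<forall>j\<in>{1..r}. f j \<in> H_half \<and> g j \<in> H_half) \<longrightarrow>
       integrable (measure_pmf P\<^sub>A) (complex_DN_product r S f g) \<and>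
       integrable (measure_pmf P\<^sub>B) (complex_DN_product r S f g) \<and>
       measure_pmf.expectation P\<^sub>A (complex_DN_product r S f g)
         = measure_pmf.expectation P\<^sub>B (complex_DN_product r S f g))"
proof -
  \<comment> \<open>2 M + 1 exceeds the degree 2 M of the highest moment. Cardinalities reach n, and
    N = n + 2 satisfies both n < N for the potentials and N \<ge> 2 for the radial average.\<close>
  define n N where "n = 2 * M + 1" and "N = n + 2"
  have N: "2 \<le> N" and n0: "0 < n" by (auto simp: N_def n_def)
  define P\<^sub>A P\<^sub>B where "P\<^sub>A = map_pmf (\<lambda>S. potential N (card S)) (pmf_of_set (even_subsets n))"
    and "P\<^sub>B = map_pmf (\<lambda>S. potential N (card S)) (pmf_of_set (odd_subsets n))"
  have ne: "even_subsets n \<noteq> {}" "odd_subsets n \<noteq> {}" using even_odd_subsets(3) even_odd_subsets(4)[OF n0] by blast+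
  have le: "card S \<le> n" if "S \<subseteq> {..<n}" for S using card_mono[OF _ that] by simp
  have supp: "set_pmf P\<^sub>A = (\<lambda>S. potential N (card S)) ` even_subsets n"
      "set_pmf P\<^sub>B = (\<lambda>S. potential N (card S)) ` odd_subsets n"
    by (simp_all add: P\<^sub>A_def P\<^sub>B_def ne even_odd_subsets)
  have fin: "finite (set_pmf P\<^sub>A)" "finite (set_pmf P\<^sub>B)" unfolding supp by (simp_all add: even_odd_subsets)
  have adm: "admissible_potential (potential N d)" if "d \<le> n" for d
    by (rule admissible_potential_potential) (use that in \<open>simp add: N_def\<close>)
  have RP: "random_potential P\<^sub>A" "random_potential P\<^sub>B"
  proof -
    have "admissible_potential (potential N (card S))" if "S \<in> even_subsets n \<union> odd_subsets n" for S
      by (intro adm le) (use that in \<open>auto simp: even_subsets_def odd_subsets_def\<close>)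
    then show "random_potential P\<^sub>A" "random_potential P\<^sub>B"
      using fin unfolding random_potential_def by (auto simp: supp)
  qed
  \<comment> \<open>At the origin (|x|^2)^d vanishes unless d = 0, where 0^0 = 1.\<close>
  have pot0: "0 < potential N 0 0" "d \<noteq> 0 \<Longrightarrow> potential N d 0 = 0" for d
    using beta_bounds[of 0 N] N by (auto simp: potential_def)
  have mean: "mean_potential P\<^sub>A 0 \<noteq> mean_potential P\<^sub>B 0"
  proof -
    \<comment> \<open>Sets of odd cardinality are nonempty, so d > 0 throughout.\<close>
    have "(\<Sum>S\<in>odd_subsets n. potential N (card S) 0) = 0"
      by (intro sum.neutral ballI pot0(2)) (auto simp: odd_subsets_def intro: odd_pos)
    then have "mean_potential P\<^sub>B 0 = 0"
      unfolding mean_potential_def P\<^sub>B_def by (subst expectation_pmf_of_set) (simp_all add: ne even_odd_subsets)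
    \<comment> \<open>The empty set has even cardinality and contributes the only nonzero
      term.\<close>
    moreover have "0 < (\<Sum>S\<in>even_subsets n. potential N (card S) 0)"
    proof (rule sum_pos2[OF even_odd_subsets(1) even_odd_subsets(3)])
      show "0 < potential N (card {}) 0" using pot0 by simp
      show "0 \<le> potential N (card S) 0" for S using pot0(1) pot0(2)[of "card S"] by (cases "card S = 0") auto
    qed
    then have "0 < mean_potential P\<^sub>A 0"
      unfolding mean_potential_def P\<^sub>A_def
      by (subst expectation_pmf_of_set) (simp_all add: ne even_odd_subsets card_gt_0_iff)
    ultimately show ?thesis by simp
  qed
  \<comment> \<open>Polymorphic in the scalars, to serve the real and the complex case; the
    coefficients form a pair so that \<open>bchoice\<close> selects both at once.\<close>
  have affine: "\<exists>p. \<forall>d\<le>n. DN_map (potential N d) f g = fst p + ((real N + 1 / 2)\<^sup>2 - (real d + 1)\<^sup>2) *\<^sub>R snd p"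
    if f: "f \<in> H_half" and g: "g \<in> H_half" for f g :: "real^3 \<Rightarrow> 'a::{real_normed_field,euclidean_space}"
  proof -
    obtain \<alpha> \<beta> where "\<forall>d<N. DN_map (potential N d) f g = \<alpha> + ((real N + 1 / 2)\<^sup>2 - (real d + 1)\<^sup>2) *\<^sub>R \<beta>"
      using DN_map_potential_affine[OF f g N] by blast
    then show ?thesis by (intro exI[of _ "(\<alpha>, \<beta>)"]) (auto simp: N_def)
  qed
  have real: "measure_pmf.expectation P\<^sub>A (real_DN_product r f g) = measure_pmf.expectation P\<^sub>B (real_DN_product r f g)"
    if r: "r \<in> {1..M}" and fg: "\<forall>j\<in>{1..r}. f j \<in> H_half \<and> g j \<in> H_half" for r f g
  proof -
    have "\<forall>j\<in>{1..r}. \<exists>p. \<forall>d\<le>n. DN_map (potential N d) (f j) (g j) = fst p + ((real N + 1 / 2)\<^sup>2 - (real d + 1)\<^sup>2) *\<^sub>R snd p"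
    proof
      fix j assume "j \<in> {1..r}"
      with fg have "f j \<in> H_half" "g j \<in> H_half" by blast+
      then show "\<exists>p. \<forall>d\<le>n. DN_map (potential N d) (f j) (g j) = fst p + ((real N + 1 / 2)\<^sup>2 - (real d + 1)\<^sup>2) *\<^sub>R snd p"
        by (rule affine)
    qed
    from bchoice[OF this] obtain p where p: "\<And>j d. j \<in> {1..r} \<Longrightarrow> d \<le> n \<Longrightarrow>
      DN_map (potential N d) (f j) (g j) = fst (p j) + ((real N + 1 / 2)\<^sup>2 - (real d + 1)\<^sup>2) *\<^sub>R snd (p j)" by blast
    show ?thesis unfolding P\<^sub>A_def P\<^sub>B_def
    proof (rule expectation_even_odd)
      show "2 * r + 1 \<le> n" using r by (simp add: n_def)
      show "real_DN_product r f g (potential N d) = (\<Prod>j=1..r. fst (p j) + ((real N + 1 / 2)\<^sup>2 - (real d + 1)\<^sup>2) *\<^sub>R snd (p j))"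
        if "d \<le> n" for d
        unfolding real_DN_product_def pairing_def by (intro prod.cong refl p that)
    qed
  qed
  have complex: "measure_pmf.expectation P\<^sub>A (complex_DN_product r S f g) = measure_pmf.expectation P\<^sub>B (complex_DN_product r S f g)"
    if r: "r \<in> {1..M}" and fg: "\<forall>j\<in>{1..r}. f j \<in> H_half \<and> g j \<in> H_half" for r S f g
  proof -
    have "\<forall>j\<in>{1..r}. \<exists>p. \<forall>d\<le>n. DN_map (potential N d) (f j) (\<lambda>x. cnj (g j x)) = fst p + ((real N + 1 / 2)\<^sup>2 - (real d + 1)\<^sup>2) *\<^sub>R snd p"
    proof
      fix j assume "j \<in> {1..r}"
      with fg have "f j \<in> H_half" "(\<lambda>x. cnj (g j x)) \<in> H_half" using H_half_cnj by blast+
      then show "\<exists>p. \<forall>d\<le>n. DN_map (potential N d) (f j) (\<lambda>x. cnj (g j x)) = fst p + ((real N + 1 / 2)\<^sup>2 - (real d + 1)\<^sup>2) *\<^sub>R snd p"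
        by (rule affine)
    qed
    from bchoice[OF this] obtain p where p: "\<And>j d. j \<in> {1..r} \<Longrightarrow> d \<le> n \<Longrightarrow>
      DN_map (potential N d) (f j) (\<lambda>x. cnj (g j x)) = fst (p j) + ((real N + 1 / 2)\<^sup>2 - (real d + 1)\<^sup>2) *\<^sub>R snd (p j)" by blast
    show ?thesis unfolding P\<^sub>A_def P\<^sub>B_def
    proof (rule expectation_even_odd)
      show "2 * r + 1 \<le> n" using r by (simp add: n_def)
      \<comment> \<open>d enters only through a real factor, so conjugating a factor conjugates its
        two coefficients and leaves the degree in d unchanged.\<close>
      show "complex_DN_product r S f g (potential N d) = (\<Prod>j=1..r. (if j \<in> S then cnj (fst (p j)) else fst (p j))
          + ((real N + 1 / 2)\<^sup>2 - (real d + 1)\<^sup>2) *\<^sub>R (if j \<in> S then cnj (snd (p j)) else snd (p j)))"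
        if "d \<le> n" for d
        unfolding complex_DN_product_def sesq_pairing_def
        by (intro prod.cong refl) (simp only: p that, simp add: scaleR_conv_of_real)
    qed
  qed
  have int: "integrable (measure_pmf P\<^sub>A) F" "integrable (measure_pmf P\<^sub>B) F" for F :: "(real^3 \<Rightarrow> real) \<Rightarrow> 'a::{banach,second_countable_topology}"
    by (intro integrable_measure_pmf_finite fin)+
  show ?thesis
    by (rule exI[of _ P\<^sub>A], rule exI[of _ P\<^sub>B], intro conjI ballI allI impI RP bexI[of _ 0] mean int real complex) auto
qed

end
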